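(* For any $p\in(1,\infty)$ and every weight $w$ on $\mathbb{Z}$ in the Muckenhoupt class $A_p$, the maximal operator $K^*:\ell^p(w)\to\ell^p(w)$ is a bounded operator.
   Context: Let $d(n)=\sum_{k\mid n}1$ be the divisor function and $D(N)=\sum_{n=1}^N d(n)$. For a function $f$ on the integers, define $$K_N f(x)=\frac{1}{D(N)}\sum_{n=1}^{N} d(n)\, f(x+n),\qquad K^*f(x)=\sup_{N\geq 1}|K_Nf(x)|,\qquad x\in\mathbb{Z}.$$ A weight is a function $w:\mathbb{Z}\to(0,\infty)$, and $\ell^p(w)$ is the space of functions $f$ on $\mathbb{Z}$ with $\|f\|_{\ell^p(w)}=\big(\sum_{x\in\mathbb{Z}}|f(x)|^p w(x)\big)^{1/p}<\infty$. The weight $w$ belongs to the (discrete) Muckenhoupt class $A_p$ if $$\sup_I \Big(\frac1{|I|}\sum_{x\in I}w(x)\Big)\Big(\frac1{|I|}\sum_{x\in I}w(x)^{-1/(p-1)}\Big)^{p-1}<\infty,$$ where the supremum is over all finite intervals $I$ of consecutive integers and $|I|$ is the number of elements of $I$. *)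

theory Defs
  imports "HOL-Analysis.Analysis"
begin

text \<open>
  For \<open>n = 0\<close> the set of divisors is infinite, so \<open>divisor_fun 0 = 0\<close>;
  this value is never used below.
\<close>
definition divisor_fun :: "nat \<Rightarrow> nat" where
  "divisor_fun n = (\<Sum>k | k dvd n. 1)"

definition divisor_sum :: "nat \<Rightarrow> nat" where
  "divisor_sum N = (\<Sum>n=1..N. divisor_fun n)"

definition divisor_avg :: "nat \<Rightarrow> (int \<Rightarrow> complex) \<Rightarrow> int \<Rightarrow> complex" where
  "divisor_avg N f x =
     1 / of_nat (divisor_sum N) * (\<Sum>n=1..N. of_nat (divisor_fun n) * f (x + int n))"

text \<open>
  The supremum is taken in the reals, so it is meaningful only where the averages at
  \<open>x\<close> are bounded in \<open>N\<close>. Any statement about \<open>divisor_max f\<close> has to assert this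
  boundedness separately (see \<open>divisor_max_finite\<close>).
\<close>
definition divisor_max :: "(int \<Rightarrow> complex) \<Rightarrow> int \<Rightarrow> real" where
  "divisor_max f x = (SUP N\<in>{1..}. cmod (divisor_avg N f x))"

definition divisor_max_finite :: "(int \<Rightarrow> complex) \<Rightarrow> int \<Rightarrow> bool" where
  "divisor_max_finite f x \<longleftrightarrow> bdd_above ((\<lambda>N. cmod (divisor_avg N f x)) ` {1..})"

definition is_weight :: "(int \<Rightarrow> real) \<Rightarrow> bool" where
  "is_weight w \<longleftrightarrow> (\<forall>x. w x > 0)"

text \<open>The codomain is generic because the operator maps complex to real functions.\<close>
definition weighted_lp :: "real \<Rightarrow> (int \<Rightarrow> real) \<Rightarrow> (int \<Rightarrow> 'a::real_normed_vector) set" where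
  "weighted_lp p w = {f. (\<lambda>x. norm (f x) powr p * w x) summable_on UNIV}"

definition weighted_lp_norm :: "real \<Rightarrow> (int \<Rightarrow> real) \<Rightarrow> (int \<Rightarrow> 'a::real_normed_vector) \<Rightarrow> real" where
  "weighted_lp_norm p w f = (\<Sum>\<^sub>\<infinity>x\<in>UNIV. norm (f x) powr p * w x) powr (1 / p)"

definition muckenhoupt :: "real \<Rightarrow> (int \<Rightarrow> real) \<Rightarrow> bool" where
  "muckenhoupt p w \<longleftrightarrow>
     bdd_above ((\<lambda>I. ((\<Sum>x\<in>I. w x) / real (card I)) *
                     ((\<Sum>x\<in>I. w x powr (- 1 / (p - 1))) / real (card I)) powr (p - 1))
       ` {{a..b} | a b. a \<le> b})"

end

theory Submission
  imports Defs "HOL-Computational_Algebra.Squarefree"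
begin

text \<open>
  Why the theorem holds. Let \<open>N \<le> 4 ^ J\<close> with \<open>4 ^ J\<close> comparable to \<open>N\<close>. Every pair of complementary divisors
  of \<open>n \<le> 4 ^ J\<close> has a member not exceeding \<open>2 ^ J\<close>, so for nonnegative \<open>f\<close> the divisor average is, up to a
  constant, dominated by the average over \<open>n \<le> 4 ^ J\<close> with
  \<open>d(n)\<close> replaced by the number of divisors \<open>k \<le> 2 ^ J\<close> of \<open>n\<close>. The identity
  \<open>k * [k dvd n] = (\<Sum>q | q dvd k. c\<^sub>q(n))\<close> for Ramanujan sums \<open>c\<^sub>q\<close> rewrites the latter as
  \<open>\<Sum>q. \<gamma> J q / q * C\<^sub>q f\<close>, where \<open>0 \<le> \<gamma> J q \<le> 1\<close> and \<open>C\<^sub>q\<close> averages \<open>f\<close> against \<open>c\<^sub>q\<close> over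
  \<open>n \<le> 4 ^ J\<close>. The moduli are grouped into blocks \<open>2 ^ s \<le> q < 2 ^ (s + 1)\<close> with \<open>s \<le> J\<close>; it suffices
  that the maximal function of the \<open>s\<close>-th block, the supremum running over \<open>J \<ge> s\<close>, has norm \<open>O(\<rho> ^ s)\<close> on
  \<open>\<ell>\<^sup>p(w)\<close> for some \<open>\<rho> < 1\<close> (\<open>block_maximal_weighted\<close>). The scale \<open>J\<close> is always an arbitrary
  function of the point \<open>x\<close>, which makes all operators linear.

  Two facts are played off against each other. The first is cancellation (\<open>block_maximal_l2\<close>): on unweighted \<open>\<ell>\<^sup>2\<close>
  the block maximal function decays like \<open>2 powr (- s / 4)\<close> up to powers of \<open>s\<close>. The frequencies \<open>a / q\<close> of the
  block are separated by \<open>4 ^ - (s + 1)\<close>, so each single scale is \<open>O((s + 1) / 2 ^ s)\<close>, and the scales \<open>J < 3 * s\<close>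
  may be summed. For larger \<open>N\<close> the operator \<open>C\<^sub>q\<close> at scale \<open>N\<close> almost reproduces itself after a first average at the
  shorter scale \<open>q * 2 ^ s\<close>; the supremum over \<open>N\<close> then costs only Hardy-Littlewood maximal functions along the
  divisors of \<open>q\<close>, while the short averages for different \<open>q\<close> are almost orthogonal, which turns the factor
  \<open>1 / q\<close> into a gain by Cauchy-Schwarz. The second fact is size (\<open>block_avg_restricted\<close>): the kernel of a block is at most
  twice the number of divisors up to \<open>2 ^ (s + 1)\<close>, whose moments are powers of \<open>s\<close>, so on functions bounded
  by an indicator \<open>1\<^sub>E\<close> the block maximal function is at most a power of \<open>s\<close> times
  \<open>(M 1\<^sub>E) powr (1 - 1 / m)\<close>, where \<open>M\<close> is the Hardy-Littlewood maximal function and \<open>m\<close> is at our disposal.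

  The two facts are interpolated on functions bounded by \<open>1\<^sub>E\<close> with \<open>w\<close> nearly constant on \<open>E\<close>. There \<open>M 1\<^sub>E\<close> is controlled
  in \<open>\<ell>\<^sup>r(w powr b)\<close> for all \<open>(r, b)\<close> near \<open>(p, 1)\<close>, because \<open>A\<^sub>p\<close> weights self-improve (\<open>Ap_open\<close>). A general
  interpolation lemma (\<open>interpolation_from_level_sets\<close>) recovers the strong bound on \<open>\<ell>\<^sup>p(w)\<close> from these restricted
  bounds at four exponent pairs around \<open>(p, 1)\<close>, and the resulting geometric decay in \<open>s\<close> is summed.
\<close>

section \<open>Self-improvement of Muckenhoupt weights\<close>

text \<open>
  After normalising both sums to one, the inequality is Young's inequality summed over the index
  set.
\<close>
lemma Holder_sum_powr:
  fixes u v :: "'a \<Rightarrow> real"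
  assumes "finite A" "\<And>x. x \<in> A \<Longrightarrow> 0 < u x" "\<And>x. x \<in> A \<Longrightarrow> 0 < v x"
    and "0 \<le> \<alpha>" "0 \<le> \<beta>" "\<alpha> + \<beta> = 1"
  shows "(\<Sum>x\<in>A. u x powr \<alpha> * v x powr \<beta>) \<le> sum u A powr \<alpha> * sum v A powr \<beta>"
proof (cases "A = {}")
  case False
  define U V where "U = sum u A" and "V = sum v A"
  have pos: "0 < U" "0 < V"
    unfolding U_def V_def using assms False by (auto intro: sum_pos)
  have "(\<Sum>x\<in>A. u x powr \<alpha> * v x powr \<beta>)
      = U powr \<alpha> * V powr \<beta> * (\<Sum>x\<in>A. (u x / U) powr \<alpha> * (v x / V) powr \<beta>)"
    unfolding sum_distrib_left using assms pos
    by (intro sum.cong) (auto simp: powr_divide less_imp_le)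
  also have "\<dots> \<le> U powr \<alpha> * V powr \<beta> * (\<Sum>x\<in>A. \<alpha> * (u x / U) + \<beta> * (v x / V))"
    using assms pos by (intro mult_left_mono sum_mono Youngs_inequality_0) auto
  also have "(\<Sum>x\<in>A. \<alpha> * (u x / U) + \<beta> * (v x / V)) = \<alpha> * (U / U) + \<beta> * (V / V)"
    unfolding sum.distrib sum_distrib_left[symmetric] sum_divide_distrib[symmetric] U_def V_def by simp
  also have "\<dots> = 1" using pos assms by simp
  finally show ?thesis unfolding U_def V_def by simp
qed auto

text \<open>
  Hoelder's inequality against the constant function.
\<close>
lemma power_mean_le:
  fixes u :: "'a \<Rightarrow> real"
  assumes "finite A" "A \<noteq> {}" "\<And>x. x \<in> A \<Longrightarrow> 0 < u x" "0 \<le> s" "s \<le> 1"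
  shows "(\<Sum>x\<in>A. u x powr s) / card A \<le> (sum u A / card A) powr s"
proof -
  have c: "real (card A) > 0" using assms by (simp add: card_gt_0_iff)
  have "(\<Sum>x\<in>A. u x powr s) = (\<Sum>x\<in>A. u x powr s * (\<lambda>_. 1) x powr (1 - s))" by simp
  also have "\<dots> \<le> sum u A powr s * (\<Sum>x\<in>A. 1) powr (1 - s)"
    using assms by (intro Holder_sum_powr) auto
  also have "\<dots> = (sum u A / card A) powr s * card A"
    using c assms by (simp add: powr_divide sum_nonneg less_imp_le powr_diff)
  finally show ?thesis using c by (simp add: field_simps)
qed

definition Ap_bound :: "real \<Rightarrow> (int \<Rightarrow> real) \<Rightarrow> real \<Rightarrow> bool" where
  "Ap_bound p w K \<longleftrightarrow> (\<forall>a b. a \<le> b \<longrightarrow>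
     (sum w {a..b} / card {a..b}) *
     ((\<Sum>x\<in>{a..b}. w x powr (- 1 / (p - 1))) / card {a..b}) powr (p - 1) \<le> K)"

lemma muckenhoupt_imp_Ap_bound:
  assumes "muckenhoupt p w"
  shows "\<exists>K. Ap_bound p w K"
proof -
  from assms obtain K where
    K: "\<And>y. y \<in> (\<lambda>I. ((\<Sum>x\<in>I. w x) / real (card I)) *
                     ((\<Sum>x\<in>I. w x powr (- 1 / (p - 1))) / real (card I)) powr (p - 1))
       ` {{a..b} | a b. a \<le> b} \<Longrightarrow> y \<le> K"
    unfolding muckenhoupt_def bdd_above_def by blast
  show ?thesis
    unfolding Ap_bound_def by (intro exI[of _ K] allI impI K image_eqI[OF refl]) blast
qed

text \<open>
  The way in which the \<open>A\<^sub>p\<close> condition is used: a subset of an interval with a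
  positive proportion of its points carries a positive proportion of its mass. It is Hoelder's
  inequality for \<open>1 = w powr (1/p) * w powr (-1/p)\<close> on \<open>F\<close>.
\<close>
lemma Ap_lower_mass:
  assumes p: "1 < p" and w: "\<And>x. 0 < w x" and K: "Ap_bound p w K"
    and ab: "a \<le> b" and F: "F \<subseteq> {a..b}"
  shows "(card F / card {a..b}) powr p * sum w {a..b} \<le> K * sum w F"
proof (cases "F = {}")
  case False
  define \<sigma> where "\<sigma> x = w x powr (- 1 / (p - 1))" for x
  define I where "I = {a..b}"
  have fin: "finite F" "finite I" using F finite_subset unfolding I_def by auto
  have I0: "real (card I) > 0" unfolding I_def using ab by simp
  have sp: "\<And>x. 0 < \<sigma> x" unfolding \<sigma>_def using w[THEN less_imp_neq] by auto
  have wI: "sum w I > 0" unfolding I_def using ab w by (intro sum_pos) auto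
  have wF: "sum w F > 0" using False fin w by (intro sum_pos) auto
  have sF: "sum \<sigma> F > 0" using False fin sp by (intro sum_pos) auto
  have sI: "sum \<sigma> I > 0" unfolding I_def using ab sp by (intro sum_pos) auto
  have sFI: "sum \<sigma> F \<le> sum \<sigma> I" using F fin sp unfolding I_def by (intro sum_mono2) (auto intro: less_imp_le)
  have one: "w x powr (1/p) * \<sigma> x powr ((p-1)/p) = 1" for x
    unfolding \<sigma>_def powr_powr using p w[of x] by (simp add: powr_add[symmetric])
  have "real (card F) = (\<Sum>x\<in>F. w x powr (1/p) * \<sigma> x powr ((p-1)/p))"
    by (simp add: one)
  also have "\<dots> \<le> sum w F powr (1/p) * sum \<sigma> F powr ((p-1)/p)"
    using fin w sp p by (intro Holder_sum_powr) (auto simp: field_simps)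
  finally have "real (card F) powr p \<le> (sum w F powr (1/p) * sum \<sigma> F powr ((p-1)/p)) powr p"
    using p by (intro powr_mono2) auto
  also have "\<dots> = sum w F * sum \<sigma> F powr (p-1)"
    using p wF sF by (simp add: powr_mult powr_powr)
  also have "\<dots> \<le> sum w F * sum \<sigma> I powr (p-1)"
    using wF sF sFI p by (intro mult_left_mono powr_mono2) auto
  finally have 1: "real (card F) powr p \<le> sum w F * sum \<sigma> I powr (p-1)" .
  have "(sum w I / card I) * (sum \<sigma> I / card I) powr (p - 1) \<le> K"
    using K ab unfolding Ap_bound_def I_def \<sigma>_def by blast
  also have "(sum w I / card I) * (sum \<sigma> I / card I) powr (p - 1)
     = sum w I * sum \<sigma> I powr (p-1) / card I powr p"
    using I0 sI by (simp add: powr_divide powr_diff)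
  finally have 2: "sum w I * sum \<sigma> I powr (p-1) / card I powr p \<le> K" .
  have "(card F / card I) powr p * sum w I = real (card F) powr p * (sum w I / card I powr p)"
    using I0 by (simp add: powr_divide)
  also have "\<dots> \<le> (sum w F * sum \<sigma> I powr (p-1)) * (sum w I / card I powr p)"
    using 1 wI by (intro mult_right_mono) auto
  also have "\<dots> = sum w F * (sum w I * sum \<sigma> I powr (p-1) / card I powr p)" by simp
  also have "\<dots> \<le> sum w F * K" using 2 wF by (intro mult_left_mono) auto
  finally show ?thesis unfolding I_def by (simp add: mult.commute)
qed (use p in auto)

lemma Ap_bound_ge_1:
  assumes p: "1 < p" and w: "\<And>x. 0 < w x" and K: "Ap_bound p w K"
  shows "1 \<le> K"
  using Ap_lower_mass[OF assms, of 0 0 "{0}"] w[of 0] by simp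

text \<open>
  The quantitative absolute continuity that drives the reverse Hoelder inequality; it is the only
  trace of \<open>A\<^sub>p\<close> left in its proof.
\<close>
definition A_infty :: "real \<Rightarrow> (int \<Rightarrow> real) \<Rightarrow> bool" where
  "A_infty \<beta> w \<longleftrightarrow> (\<forall>a b F. a \<le> b \<longrightarrow> F \<subseteq> {a..b} \<longrightarrow> 2 * card F \<le> card {a..b} \<longrightarrow>
     sum w F \<le> \<beta> * sum w {a..b})"

text \<open>
  The complement of a small set is large, so it has a fixed share of the mass.
\<close>
lemma Ap_imp_A_infty:
  assumes p: "1 < p" and w: "\<And>x. 0 < w x" and K: "Ap_bound p w K"
  shows "A_infty (1 - (1/2) powr p / K) w"
  unfolding A_infty_def
proof (intro allI impI)
  fix a b :: int and F assume ab: "a \<le> b" and F: "F \<subseteq> {a..b}" and c: "2 * card F \<le> card {a..b}"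
  have K1: "1 \<le> K" by (rule Ap_bound_ge_1[OF assms])
  let ?G = "{a..b} - F"
  have fin: "finite F" using F finite_subset by auto
  have I0: "real (card {a..b}) > 0" using ab by simp
  have "card ?G = card {a..b} - card F" using F fin by (simp add: card_Diff_subset)
  hence "real (card ?G) \<ge> card {a..b} / 2" using c by linarith
  hence "1/2 \<le> card ?G / card {a..b}" using I0 by (simp add: field_simps)
  hence "(1/2) powr p \<le> (card ?G / card {a..b}) powr p" using p by (intro powr_mono2) auto
  hence "(1/2) powr p * sum w {a..b} \<le> (card ?G / card {a..b}) powr p * sum w {a..b}"
    by (intro mult_right_mono sum_nonneg) (auto intro: less_imp_le w)
  also have "\<dots> \<le> K * sum w ?G" using Ap_lower_mass[OF p w K ab, of ?G] by auto
  finally have "(1/2) powr p / K * sum w {a..b} \<le> sum w ?G" using K1 by (simp add: field_simps)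
  moreover have "sum w ?G = sum w {a..b} - sum w F" using F fin by (simp add: sum_diff)
  ultimately show "sum w F \<le> (1 - (1/2) powr p / K) * sum w {a..b}" by (simp add: algebra_simps)
qed

text \<open>
  A Calderon-Zygmund decomposition at height \<open>t\<close>. The set \<open>\<Omega>\<close> is
  the union of the maximal intervals of mean above \<open>t\<close> in repeated halving; such an
  interval has at least a third of the length of its parent, hence mean at most
  \<open>3 * t\<close>. The family of intervals is not recorded: an estimate
  \<open>sum g \<le> \<gamma> * sum w\<close> valid on intervals of mean at most
  \<open>3 * t\<close> is carried over to \<open>\<Omega>\<close> directly, since it is additive
  over disjoint unions.
\<close>
lemma stopping_set:
  fixes w g :: "int \<Rightarrow> real" and t :: real
  assumes w: "\<And>x. 0 \<le> w x"
    and g: "\<And>c d. c \<le> d \<Longrightarrow> sum w {c..d} \<le> 3 * t * card {c..d} \<Longrightarrow> sum g {c..d} \<le> \<gamma> * sum w {c..d}"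
    and ab: "a \<le> b" and avg: "sum w {a..b} \<le> t * card {a..b}"
  shows "\<exists>\<Omega>\<subseteq>{a..b}. t * card \<Omega> \<le> sum w \<Omega> \<and> sum g \<Omega> \<le> \<gamma> * sum w \<Omega> \<and> (\<forall>x\<in>{a..b} - \<Omega>. w x \<le> t)"
  using ab avg
proof (induction "nat (b - a)" arbitrary: a b rule: less_induct)
  case less
  show ?case
  proof (cases "a = b")
    case True
    thus ?thesis using less.prems by (intro exI[of _ "{}"]) auto
  next
    case False
    hence ab: "a < b" using less.prems by simp
    define m where "m = (a + b) div 2"
    have m: "a \<le> m" "m < b" "m + 1 \<le> b" unfolding m_def using ab by auto
    have len: "b - a + 1 \<le> 3 * (m - a + 1)" "b - a + 1 \<le> 3 * (b - (m + 1) + 1)"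
      unfolding m_def using ab by presburger+
    have t0: "0 \<le> t"
    proof -
      have "0 \<le> t * card {a..b}" using less.prems(2) sum_nonneg[of "{a..b}" w] w by (meson order_trans)
      moreover have "0 < real (card {a..b})" using ab by simp
      ultimately show ?thesis using zero_le_mult_iff[of t "real (card {a..b})"] by linarith
    qed
    have half: "\<exists>\<Omega>\<subseteq>{c..d}. t * card \<Omega> \<le> sum w \<Omega> \<and> sum g \<Omega> \<le> \<gamma> * sum w \<Omega> \<and> (\<forall>x\<in>{c..d} - \<Omega>. w x \<le> t)"
      if cd: "a \<le> c" "c \<le> d" "d \<le> b" "d - c < b - a" "b - a + 1 \<le> 3 * (d - c + 1)" for c d
    proof (cases "sum w {c..d} \<le> t * card {c..d}")
      case True
      thus ?thesis using less.hyps[of d c] cd by auto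
    next
      case False
      have "sum w {c..d} \<le> sum w {a..b}" using cd w by (intro sum_mono2) auto
      also have "\<dots> \<le> t * card {a..b}" by fact
      also have "\<dots> \<le> t * (3 * card {c..d})" using t0 cd by (intro mult_left_mono) auto
      finally have "sum w {c..d} \<le> 3 * t * card {c..d}" by (simp add: algebra_simps)
      hence "sum g {c..d} \<le> \<gamma> * sum w {c..d}" using g cd by blast
      thus ?thesis using False by (intro exI[of _ "{c..d}"]) auto
    qed
    obtain \<Omega>1 where 1: "\<Omega>1\<subseteq>{a..m}" "t * card \<Omega>1 \<le> sum w \<Omega>1" "sum g \<Omega>1 \<le> \<gamma> * sum w \<Omega>1" "\<forall>x\<in>{a..m} - \<Omega>1. w x \<le> t"
      using half[of a m] m len by auto
    obtain \<Omega>2 where 2: "\<Omega>2\<subseteq>{m+1..b}" "t * card \<Omega>2 \<le> sum w \<Omega>2" "sum g \<Omega>2 \<le> \<gamma> * sum w \<Omega>2" "\<forall>x\<in>{m+1..b} - \<Omega>2. w x \<le> t"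
      using half[of "m+1" b] m len by auto
    have fin: "finite \<Omega>1" "finite \<Omega>2" using 1(1) 2(1) finite_subset by auto
    have dj: "\<Omega>1 \<inter> \<Omega>2 = {}" using 1(1) 2(1) by fastforce
    show ?thesis
    proof (intro exI[of _ "\<Omega>1 \<union> \<Omega>2"] conjI ballI)
      show "\<Omega>1 \<union> \<Omega>2 \<subseteq> {a..b}" using 1(1) 2(1) m by fastforce
      show "t * card (\<Omega>1 \<union> \<Omega>2) \<le> sum w (\<Omega>1 \<union> \<Omega>2)"
        using 1(2) 2(2) by (simp add: card_Un_disjoint sum.union_disjoint fin dj algebra_simps)
      show "sum g (\<Omega>1 \<union> \<Omega>2) \<le> \<gamma> * sum w (\<Omega>1 \<union> \<Omega>2)"
        using 1(3) 2(3) by (simp add: sum.union_disjoint fin dj algebra_simps)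
      fix x assume x: "x \<in> {a..b} - (\<Omega>1 \<union> \<Omega>2)"
      show "w x \<le> t" using x 1(4) 2(4) by (cases "x \<le> m") auto
    qed
  qed
qed

text \<open>
  Iterated stopping at heights growing by the factor six: with height \<open>2 * t\<close> the
  stopping set has at most half of the points, hence at most the share \<open>\<beta>\<close> of the
  mass, and on each stopping interval the mean is at most \<open>6 * t\<close>.
\<close>
lemma A_infty_level_decay:
  fixes w :: "int \<Rightarrow> real" and t :: real
  assumes w: "\<And>x. 0 \<le> w x" and A: "A_infty \<beta> w" and \<beta>: "0 \<le> \<beta>"
    and ab: "a \<le> b" and t: "0 < t" and avg: "sum w {a..b} \<le> t * card {a..b}"
  shows "(\<Sum>x\<in>{a..b}. if w x > 6^k * t then w x else 0) \<le> \<beta>^k * sum w {a..b}"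
  using ab t avg
proof (induction k arbitrary: a b t)
  case 0
  thus ?case using w by (auto intro!: sum_mono)
next
  case (Suc k)
  define g where "g x = (if w x > 6^(Suc k) * t then w x else 0)" for x
  have "\<exists>\<Omega>\<subseteq>{a..b}. 2*t * card \<Omega> \<le> sum w \<Omega> \<and> sum g \<Omega> \<le> \<beta>^k * sum w \<Omega> \<and> (\<forall>x\<in>{a..b} - \<Omega>. w x \<le> 2*t)"
  proof (rule stopping_set[OF w])
    show "sum w {a..b} \<le> 2*t * card {a..b}" using Suc.prems mult_nonneg_nonneg[of t "real (card {a..b})"] by linarith
    fix c d :: int assume "c \<le> d" "sum w {c..d} \<le> 3 * (2*t) * card {c..d}"
    thus "sum g {c..d} \<le> \<beta>^k * sum w {c..d}"
      unfolding g_def using Suc.IH[of c d "6*t"] Suc.prems by (simp add: mult_ac)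
  qed fact
  then obtain \<Omega> where \<Omega>: "\<Omega> \<subseteq> {a..b}" "2*t * card \<Omega> \<le> sum w \<Omega>" "sum g \<Omega> \<le> \<beta>^k * sum w \<Omega>"
     "\<forall>x\<in>{a..b} - \<Omega>. w x \<le> 2*t" by blast
  have "2 * t * card \<Omega> \<le> sum w {a..b}" using \<Omega>(1,2) sum_mono2[of "{a..b}" \<Omega> w] w by fastforce
  also have "\<dots> \<le> t * card {a..b}" by fact
  finally have "t * (2 * real (card \<Omega>)) \<le> t * real (card {a..b})" by (simp add: mult_ac)
  hence "2 * real (card \<Omega>) \<le> real (card {a..b})" using Suc.prems(2) by (simp only: mult_le_cancel_left_pos)
  hence c: "2 * card \<Omega> \<le> card {a..b}" by linarith
  have "(1::real) \<le> 6 ^ k" by simp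
  hence "(2::real) \<le> 6 ^ Suc k" unfolding power_Suc by linarith
  hence "2 * t \<le> 6 ^ Suc k * t" using Suc.prems(2) by (intro mult_right_mono) auto
  hence "\<forall>x\<in>{a..b} - \<Omega>. g x = 0"
    using \<Omega>(4) unfolding g_def by (intro ballI if_not_P) (meson not_less order_trans)
  hence "sum g {a..b} = sum g \<Omega>" using \<Omega>(1) by (intro sum.mono_neutral_right) auto
  also have "\<dots> \<le> \<beta>^k * sum w \<Omega>" by fact
  also have "\<dots> \<le> \<beta>^k * (\<beta> * sum w {a..b})"
    using A c \<Omega>(1) Suc.prems(1) \<beta> unfolding A_infty_def by (intro mult_left_mono) auto
  finally show ?case unfolding g_def by (simp add: mult_ac)
qed

text \<open>
  The layers \<open>6 ^ k * t < w \<le> 6 ^ (k + 1) * t\<close> have mass at most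
  \<open>\<beta> ^ k\<close> times the total, which beats the growth
  \<open>6 powr (\<epsilon> * k)\<close> of \<open>w powr \<epsilon>\<close> on them for small
  \<open>\<epsilon>\<close>.
\<close>
lemma reverse_Holder:
  fixes w :: "int \<Rightarrow> real"
  assumes w: "\<And>x. 0 < w x" and A: "A_infty \<beta> w" and \<beta>: "0 \<le> \<beta>"
    and \<epsilon>: "0 \<le> \<epsilon>" "6 powr \<epsilon> * \<beta> < 1"
    and ab: "a \<le> b"
  shows "(\<Sum>x\<in>{a..b}. w x powr (1 + \<epsilon>)) / card {a..b}
    \<le> (1 + 6 powr \<epsilon> / (1 - 6 powr \<epsilon> * \<beta>)) * (sum w {a..b} / card {a..b}) powr (1 + \<epsilon>)"
proof -
  define I where "I = {a..b}"
  define t where "t = sum w I / card I"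
  have I0: "real (card I) > 0" unfolding I_def using ab by simp
  have wI: "sum w I > 0" unfolding I_def using ab w by (intro sum_pos) auto
  have t: "0 < t" unfolding t_def using I0 wI by simp
  define c where "c = 6 powr \<epsilon>"
  have c: "1 \<le> c" "c * \<beta> < 1" unfolding c_def using \<epsilon> by (auto simp: ge_one_powr_ge_zero)
  obtain K where K: "Max (w ` I) / t < 6 ^ K" using real_arch_pow[of 6] by auto
  have pt: "(w x / t) powr \<epsilon> \<le> 1 + (\<Sum>k<K. c^(Suc k) * (if w x > 6^k * t then 1 else 0))" (is "_ \<le> 1 + ?S")
    if x: "x \<in> I" for x
  proof (cases "w x \<le> t")
    case True
    hence "(w x / t) powr \<epsilon> \<le> 1" using t w[of x] \<epsilon> by (intro powr_le1) auto
    moreover have "0 \<le> ?S" using c by (intro sum_nonneg) auto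
    ultimately show ?thesis by linarith
  next
    case False
    define P where "P k \<longleftrightarrow> w x \<le> 6^k * t" for k
    have "w x \<le> Max (w ` I)" using x unfolding I_def by (intro Max_ge) auto
    also have "\<dots> \<le> 6 ^ K * t" using K t by (simp add: field_simps)
    finally have PK: "P K" unfolding P_def .
    define k where "k = (LEAST k. P k)"
    have k: "P k" unfolding k_def using PK by (rule LeastI)
    have k0: "k \<noteq> 0" using k False unfolding P_def by (cases k) auto
    have km: "\<not> P (k - 1)" unfolding k_def using k0 k_def not_less_Least by (metis diff_less gr0I zero_less_one)
    have kK: "k - 1 < K" using k0 Least_le[of P K] PK unfolding k_def by simp
    have "(w x / t) powr \<epsilon> \<le> (6^k) powr \<epsilon>"
      using k t w[of x] \<epsilon> unfolding P_def by (intro powr_mono2) (auto simp: field_simps)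
    also have "\<dots> = c^k" unfolding c_def by (simp add: powr_realpow[symmetric] powr_powr powr_power mult.commute)
    also have "\<dots> = c^(Suc (k-1)) * (if w x > 6^(k-1) * t then 1 else 0)"
      using k0 km unfolding P_def by simp
    also have "\<dots> \<le> ?S"
      using kK c by (intro member_le_sum) auto
    finally show ?thesis by simp
  qed
  have "(\<Sum>x\<in>I. w x powr (1 + \<epsilon>)) = t powr \<epsilon> * (\<Sum>x\<in>I. w x * (w x / t) powr \<epsilon>)"
    unfolding sum_distrib_left using w t by (intro sum.cong) (auto simp: powr_add powr_divide less_imp_le)
  also have "(\<Sum>x\<in>I. w x * (w x / t) powr \<epsilon>) \<le> (\<Sum>x\<in>I. w x * (1 + (\<Sum>k<K. c^(Suc k) * (if w x > 6^k * t then 1 else 0))))"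
    using pt w by (intro sum_mono mult_left_mono) (auto intro: less_imp_le)
  also have "\<dots> = sum w I + (\<Sum>k<K. c^(Suc k) * (\<Sum>x\<in>I. if w x > 6^k * t then w x else 0))"
    unfolding distrib_left sum.distrib sum_distrib_left
    by (subst (2) sum.swap) (auto intro!: sum.cong)
  also have "\<dots> \<le> sum w I + (\<Sum>k<K. c^(Suc k) * (\<beta>^k * sum w I))"
  proof -
    have "sum w {a..b} \<le> t * card {a..b}" using I0 unfolding t_def I_def by simp
    thus ?thesis unfolding I_def using c
      by (intro add_left_mono sum_mono mult_left_mono A_infty_level_decay[OF _ A \<beta> ab t] less_imp_le[OF w]) auto
  qed
  also have "(\<Sum>k<K. c^(Suc k) * (\<beta>^k * sum w I)) = c * sum w I * (\<Sum>k<K. (c * \<beta>)^k)"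
    unfolding sum_distrib_left[of "c * sum w I"] by (intro sum.cong) (auto simp: power_mult_distrib)
  also have "\<dots> \<le> c * sum w I * (1 / (1 - c * \<beta>))"
  proof (intro mult_left_mono)
    have "(\<Sum>k<K. (c * \<beta>)^k) \<le> (\<Sum>k. (c * \<beta>)^k)"
      using c \<beta> by (intro sum_le_suminf summable_geometric) auto
    thus "(\<Sum>k<K. (c * \<beta>)^k) \<le> 1 / (1 - c * \<beta>)" using c \<beta> by (simp add: suminf_geometric)
  qed (use c wI in auto)
  finally have "(\<Sum>x\<in>I. w x powr (1 + \<epsilon>)) \<le> t powr \<epsilon> * (sum w I * (1 + c / (1 - c * \<beta>)))"
    using t by (simp add: algebra_simps)
  also have "\<dots> = (1 + c / (1 - c * \<beta>)) * t powr (1 + \<epsilon>) * card I"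
    using t I0 wI by (simp add: powr_add t_def)
  finally show ?thesis using I0 unfolding I_def c_def t_def by (simp add: field_simps)
qed

lemma small_exponent_exists:
  assumes "0 \<le> \<beta>" "\<beta> < (1::real)"
  shows "\<exists>\<epsilon>>0. \<forall>\<epsilon>'. 0 \<le> \<epsilon>' \<longrightarrow> \<epsilon>' \<le> \<epsilon> \<longrightarrow> 6 powr \<epsilon>' * \<beta> < 1"
proof -
  have "((\<lambda>e. 6 powr e * \<beta>) \<longlongrightarrow> 6 powr 0 * \<beta>) (at_right 0)"
    by (intro tendsto_intros) auto
  hence "eventually (\<lambda>e. 6 powr e * \<beta> < 1) (at_right 0)"
    using assms by (intro order_tendstoD(2)) auto
  then obtain e where e: "e > 0" "\<And>y. 0 < y \<Longrightarrow> y < e \<Longrightarrow> 6 powr y * \<beta> < 1"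
    unfolding eventually_at_right_field by auto
  show ?thesis
  proof (intro exI[of _ "e/2"] conjI allI impI)
    fix y assume "0 \<le> y" "y \<le> e/2"
    thus "6 powr y * \<beta> < 1" using e assms by (cases "y = 0") auto
  qed (use e in auto)
qed

text \<open>
  The \<open>A\<^sub>p\<close> condition is symmetric in a weight and its dual weight up to
  exponents; this makes the reverse Hoelder inequality available for the dual weight as well.
\<close>
lemma Ap_dual:
  assumes p: "1 < p" and w: "\<And>x. 0 < w x" and K: "Ap_bound p w K"
  shows "Ap_bound (p / (p - 1)) (\<lambda>x. w x powr (- 1 / (p - 1))) (K powr (1 / (p - 1)))"
  unfolding Ap_bound_def
proof (intro allI impI)
  fix a b :: int assume ab: "a \<le> b"
  define n where "n = real (card {a..b})"
  have n: "n > 0" unfolding n_def using ab by simp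
  have w0: "w x \<noteq> 0" for x using w[of x] by simp
  define \<sigma> where "\<sigma> x = w x powr (- 1 / (p - 1))" for x
  define P Q where "P = sum w {a..b} / n" and "Q = sum \<sigma> {a..b} / n"
  have P: "P > 0" unfolding P_def using n ab w by (intro divide_pos_pos sum_pos) auto
  have Q: "Q > 0" unfolding Q_def using n ab w by (intro divide_pos_pos sum_pos) (auto simp: \<sigma>_def w0)
  have p': "p / (p - 1) - 1 = 1 / (p - 1)" using p by (simp add: field_simps)
  have inv: "\<sigma> x powr (- 1 / (p / (p - 1) - 1)) = w x" for x
    proof -
    have "- 1 / (p - 1) * (- 1 / (1 / (p - 1))) = 1" using p by (simp add: field_simps)
    thus ?thesis unfolding p' \<sigma>_def powr_powr using w[of x] by simp
  qed
  have "P * Q powr (p - 1) \<le> K" using K ab unfolding Ap_bound_def P_def Q_def n_def \<sigma>_def by blast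
  hence "(P * Q powr (p - 1)) powr (1 / (p - 1)) \<le> K powr (1 / (p - 1))"
    using p P Q by (intro powr_mono2) auto
  moreover have "(P * Q powr (p - 1)) powr (1 / (p - 1)) = Q * P powr (1 / (p - 1))"
    using p P Q by (simp add: powr_mult powr_powr)
  ultimately have "Q * P powr (1 / (p - 1)) \<le> K powr (1 / (p - 1))" by simp
  thus "sum (\<lambda>x. w x powr (- 1 / (p - 1))) {a..b} / card {a..b} *
     ((\<Sum>x\<in>{a..b}. (w x powr (- 1 / (p - 1))) powr (- 1 / (p / (p - 1) - 1))) / card {a..b}) powr (p / (p - 1) - 1)
     \<le> K powr (1 / (p - 1))"
    using inv unfolding P_def Q_def n_def \<sigma>_def p' by simp
qed

text \<open>
  The reverse Hoelder inequality for both the weight and its dual weight, with a common exponent.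
\<close>
lemma Ap_power_bump:
  assumes p: "1 < p" and w: "\<And>x. 0 < w x" and K: "Ap_bound p w K"
  shows "\<exists>b>1. \<exists>K'. Ap_bound p (\<lambda>x. w x powr b) K'"
proof -
  define \<sigma> where "\<sigma> x = w x powr (- 1 / (p - 1))" for x
  have w0: "w x \<noteq> 0" for x using w[of x] by simp
  have sp: "\<And>x. 0 < \<sigma> x" unfolding \<sigma>_def using w0 by simp
  define p' where "p' = p / (p - 1)"
  have p': "1 < p'" unfolding p'_def using p by (simp add: field_simps)
  define K2 where "K2 = K powr (1 / (p - 1))"
  have K2: "Ap_bound p' \<sigma> K2" unfolding p'_def \<sigma>_def K2_def by (rule Ap_dual[OF assms])
  have K1: "1 \<le> K" "1 \<le> K2" using Ap_bound_ge_1[OF assms] Ap_bound_ge_1[OF p' sp K2] by auto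
  define \<beta>1 \<beta>2 where "\<beta>1 = 1 - (1/2) powr p / K" and "\<beta>2 = 1 - (1/2) powr p' / K2"
  have half: "(1/2::real) powr r \<le> 1" if "r > 1" for r using that by (intro powr_le1) auto
  have \<beta>: "0 \<le> \<beta>1" "\<beta>1 < 1" "0 \<le> \<beta>2" "\<beta>2 < 1"
    unfolding \<beta>1_def \<beta>2_def using K1 half[OF p] half[OF p'] by (auto simp: field_simps)
  obtain e1 where e1: "e1 > 0" "\<And>e. 0 \<le> e \<Longrightarrow> e \<le> e1 \<Longrightarrow> 6 powr e * \<beta>1 < 1"
    using small_exponent_exists[OF \<beta>(1,2)] by auto
  obtain e2 where e2: "e2 > 0" "\<And>e. 0 \<le> e \<Longrightarrow> e \<le> e2 \<Longrightarrow> 6 powr e * \<beta>2 < 1"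
    using small_exponent_exists[OF \<beta>(3,4)] by auto
  define e where "e = min e1 e2"
  have e: "e > 0" "6 powr e * \<beta>1 < 1" "6 powr e * \<beta>2 < 1"
    using e1 e2 unfolding e_def by auto
  define C1 C2 where "C1 = 1 + 6 powr e / (1 - 6 powr e * \<beta>1)" and "C2 = 1 + 6 powr e / (1 - 6 powr e * \<beta>2)"
  have C: "C1 > 0" "C2 > 0" unfolding C1_def C2_def using e by (auto intro!: add_pos_nonneg)
  have "Ap_bound p (\<lambda>x. w x powr (1 + e)) (C1 * C2 powr (p - 1) * K powr (1 + e))"
    unfolding Ap_bound_def
  proof (intro allI impI)
    fix a b :: int assume ab: "a \<le> b"
    define n where "n = real (card {a..b})"
    have n: "n > 0" unfolding n_def using ab by simp
    define P Q where "P = sum w {a..b} / n" and "Q = sum \<sigma> {a..b} / n"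
    have P: "P > 0" unfolding P_def using n ab w by (intro divide_pos_pos sum_pos) auto
    have Q: "Q > 0" unfolding Q_def using n ab sp by (intro divide_pos_pos sum_pos) auto
    have 1: "(\<Sum>x\<in>{a..b}. w x powr (1 + e)) / n \<le> C1 * P powr (1 + e)"
      unfolding n_def P_def C1_def
      using Ap_imp_A_infty[OF assms] \<beta> e ab unfolding \<beta>1_def by (intro reverse_Holder[OF w]) auto
    have 2: "(\<Sum>x\<in>{a..b}. \<sigma> x powr (1 + e)) / n \<le> C2 * Q powr (1 + e)"
      unfolding n_def Q_def C2_def
      using Ap_imp_A_infty[OF p' sp K2] \<beta> e ab unfolding \<beta>2_def by (intro reverse_Holder[OF sp]) auto
    have eq: "(w x powr (1 + e)) powr (- 1 / (p - 1)) = \<sigma> x powr (1 + e)" for x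
      unfolding \<sigma>_def powr_powr by (simp add: mult.commute)
    have "(\<Sum>x\<in>{a..b}. w x powr (1 + e)) / n * ((\<Sum>x\<in>{a..b}. \<sigma> x powr (1 + e)) / n) powr (p - 1)
      \<le> (C1 * P powr (1 + e)) * (C2 * Q powr (1 + e)) powr (p - 1)"
      using 1 2 p n C P by (intro mult_mono powr_mono2) (auto intro!: divide_nonneg_pos sum_nonneg)
    also have "\<dots> = C1 * C2 powr (p - 1) * (P * Q powr (p - 1)) powr (1 + e)"
      using C P Q by (simp add: powr_mult powr_powr mult_ac)
    also have "\<dots> \<le> C1 * C2 powr (p - 1) * K powr (1 + e)"
    proof (intro mult_left_mono powr_mono2)
      show "P * Q powr (p - 1) \<le> K" using K ab unfolding Ap_bound_def P_def Q_def n_def \<sigma>_def by blast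
    qed (use C P Q e in auto)
    finally show "sum (\<lambda>x. w x powr (1 + e)) {a..b} / card {a..b} *
        ((\<Sum>x\<in>{a..b}. (w x powr (1 + e)) powr (- 1 / (p - 1))) / card {a..b}) powr (p - 1)
        \<le> C1 * C2 powr (p - 1) * K powr (1 + e)"
      unfolding eq n_def .
  qed
  thus ?thesis using e by (intro exI[of _ "1 + e"]) auto
qed

text \<open>
  Once \<open>w powr b\<close> is an \<open>A\<^sub>p\<close> weight for some
  \<open>b > 1\<close>, splitting the gain evenly as \<open>sqrt b\<close> between the power of
  the weight and the index \<open>p\<close> lowers \<open>p\<close> to
  \<open>1 + (p - 1) / sqrt b\<close> for all powers up to \<open>sqrt b\<close>. A uniform
  constant results because smaller powers follow from the power mean inequality.
\<close>
lemma Ap_open: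
  assumes p: "1 < p" and w: "\<And>x. 0 < w x" and K: "Ap_bound p w K"
  shows "\<exists>p0 b K'. 1 < p0 \<and> p0 < p \<and> 1 < b \<and> (\<forall>b'. 0 < b' \<longrightarrow> b' \<le> b \<longrightarrow> Ap_bound p0 (\<lambda>x. w x powr b') K')"
proof -
  obtain b K' where b: "b > 1" and K': "Ap_bound p (\<lambda>x. w x powr b) K'"
    using Ap_power_bump[OF assms] by blast
  define p0 where "p0 = 1 + (p - 1) / sqrt b"
  have w0: "w x \<noteq> 0" for x using w[of x] by simp
  have sb: "1 < sqrt b" "sqrt b * sqrt b = b" using b by auto
  have "(p - 1) / sqrt b < (p - 1) / 1" using p sb by (intro divide_strict_left_mono) auto
  hence p0: "1 < p0" "p0 < p" unfolding p0_def using p sb by auto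
  have K1: "1 \<le> K'" using Ap_bound_ge_1[OF p _ K'] w0 by simp
  have "Ap_bound p0 (\<lambda>x. w x powr b') K'" if b': "0 < b'" "b' \<le> sqrt b" for b'
    unfolding Ap_bound_def
  proof (intro allI impI)
    fix a d :: int assume ab: "a \<le> d"
    define n where "n = real (card {a..d})"
    have n: "n > 0" unfolding n_def using ab by simp
    define s where "s = b' / b"
    have bb: "b' \<le> b" using b' sb b by (smt (verit) mult_left_le real_sqrt_ge_zero mult_le_cancel_left1)
    have s: "0 \<le> s" "s \<le> 1" unfolding s_def using b' b bb by auto
    define s2 where "s2 = s * sqrt b"
    have s2: "0 \<le> s2" "s2 \<le> 1"
    proof -
      show "0 \<le> s2" unfolding s2_def using s sb by auto
      have "s2 = b' / sqrt b" unfolding s2_def s_def using sb b by (simp add: field_simps)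
      also have "\<dots> \<le> 1" using b' sb by (simp add: divide_le_eq)
      finally show "s2 \<le> 1" .
    qed
    define u v where "u x = w x powr b" and "v x = u x powr (- 1 / (p - 1))" for x
    have uv: "\<And>x. 0 < u x" "\<And>x. 0 < v x" unfolding u_def v_def using w0 by auto
    define P Q where "P = sum u {a..d} / n" and "Q = sum v {a..d} / n"
    have P: "P > 0" unfolding P_def using n ab uv by (intro divide_pos_pos sum_pos) auto
    have Q: "Q > 0" unfolding Q_def using n ab uv by (intro divide_pos_pos sum_pos) auto
    have e1: "w x powr b' = u x powr s" for x unfolding u_def powr_powr s_def using b by simp
    have q0: "p0 - 1 = (p - 1) / sqrt b" unfolding p0_def by simp
    have e2: "(w x powr b') powr (- 1 / (p0 - 1)) = v x powr s2" for x
    proof -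
      have "b' * (- 1 / (p0 - 1)) = b * (- 1 / (p - 1)) * s2"
        unfolding s2_def s_def q0 using b sb p by simp
      thus ?thesis unfolding v_def u_def powr_powr by simp
    qed
    have 1: "(\<Sum>x\<in>{a..d}. u x powr s) / n \<le> P powr s"
      unfolding n_def P_def using ab uv s by (intro power_mean_le) auto
    have 2: "(\<Sum>x\<in>{a..d}. v x powr s2) / n \<le> Q powr s2"
      unfolding n_def Q_def using ab uv s2 by (intro power_mean_le) auto
    have "(\<Sum>x\<in>{a..d}. u x powr s) / n * ((\<Sum>x\<in>{a..d}. v x powr s2) / n) powr (p0 - 1)
       \<le> P powr s * (Q powr s2) powr (p0 - 1)"
      using 1 2 p0 n P by (intro mult_mono powr_mono2) (auto intro!: divide_nonneg_pos sum_nonneg)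
    also have "\<dots> = (P * Q powr (p - 1)) powr s"
      using P Q sb b unfolding q0 s2_def by (simp add: powr_mult powr_powr mult_ac)
    also have "\<dots> \<le> K' powr s"
    proof (intro powr_mono2)
      show "P * Q powr (p - 1) \<le> K'" using K' ab unfolding Ap_bound_def P_def Q_def n_def u_def v_def by blast
    qed (use P s in auto)
    also have "\<dots> \<le> K' powr 1" using K1 s by (intro powr_mono) auto
    also have "\<dots> = K'" using K1 by simp
    finally show "sum (\<lambda>x. w x powr b') {a..d} / card {a..d} *
       ((\<Sum>x\<in>{a..d}. (w x powr b') powr (- 1 / (p0 - 1))) / card {a..d}) powr (p0 - 1) \<le> K'"
      unfolding e2 unfolding e1 n_def .
  qed
  thus ?thesis using p0 sb by (intro exI[of _ p0] exI[of _ "sqrt b"] exI[of _ K']) auto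
qed

section \<open>Restricted estimates for the one-sided maximal function\<close>

text \<open>
  The one-sided average along the progression \<open>x + d, x + 2 d, \<dots>\<close>; the
  point \<open>x\<close> itself is left out, as in the divisor averages.
\<close>
definition step_avg :: "int \<Rightarrow> nat \<Rightarrow> (int \<Rightarrow> real) \<Rightarrow> int \<Rightarrow> real" where
  "step_avg d N g x = (\<Sum>m=1..N. g (x + d * int m)) / N"

text \<open>
  Only lengths up to \<open>R\<close> occur, so that the supremum is a maximum; the bounds are
  uniform in \<open>R\<close>.
\<close>
definition step_max :: "int \<Rightarrow> nat \<Rightarrow> (int \<Rightarrow> real) \<Rightarrow> int \<Rightarrow> real" where
  "step_max d R g x = Max ((\<lambda>N. step_avg d N g x) ` {1..R})"

lemma step_avg_le_max: "1 \<le> N \<Longrightarrow> N \<le> R \<Longrightarrow> step_avg d N g x \<le> step_max d R g x"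
  unfolding step_max_def by (intro Max_ge) auto

lemma step_max_attained:
  assumes "1 \<le> R"
  obtains N where "1 \<le> N" "N \<le> R" "step_max d R g x = step_avg d N g x"
proof -
  have "step_max d R g x \<in> (\<lambda>N. step_avg d N g x) ` {1..R}"
    unfolding step_max_def using assms by (intro Max_in) auto
  thus ?thesis using that by auto
qed

text \<open>
  Taking the leftmost uncovered point of \<open>A\<close> with its interval and repeating gives
  disjoint intervals that cover \<open>A\<close>. The bound \<open>l\<close> keeps track of the part
  of \<open>E\<close> that is still free.
\<close>
lemma greedy_cover:
  fixes u :: "int \<Rightarrow> real"
  assumes u: "\<And>x. 0 \<le> u x" and "0 \<le> c" "finite E"
    and A: "finite A" "\<And>x. x \<in> A \<Longrightarrow> \<exists>N::nat. sum u {x..x + int N} \<le> c * sum u (E \<inter> {x..x + int N})"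
    and lb: "\<And>x. x \<in> A \<Longrightarrow> l \<le> x"
  shows "sum u A \<le> c * sum u (E \<inter> {l..})"
  using A lb
proof (induction "card A" arbitrary: A l rule: less_induct)
  case less
  show ?case
  proof (cases "A = {}")
    case True
    thus ?thesis using u assms(2) by (auto intro!: mult_nonneg_nonneg sum_nonneg)
  next
    case False
    define x where "x = Min A"
    have x: "x \<in> A" "\<And>y. y \<in> A \<Longrightarrow> x \<le> y" unfolding x_def using False less.prems by auto
    obtain N :: nat where N: "sum u {x..x + int N} \<le> c * sum u (E \<inter> {x..x + int N})"
      using less.prems(2) x by blast
    define A' where "A' = A \<inter> {x + int N + 1..}"
    have "x \<notin> A'" "A' \<subseteq> A" unfolding A'_def by auto
    hence "A' \<subset> A" using x by blast
    hence "card A' < card A" using less.prems by (intro psubset_card_mono)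
    hence IH: "sum u A' \<le> c * sum u (E \<inter> {x + int N + 1..})"
      using less.prems by (intro less.hyps) (auto simp: A'_def)
    have "A \<subseteq> {x..x + int N} \<union> A'" unfolding A'_def using x(2) by force
    hence "sum u A \<le> sum u ({x..x + int N} \<union> A')"
      using u less.prems by (intro sum_mono2) (auto simp: A'_def)
    also have "\<dots> = sum u {x..x + int N} + sum u A'"
      using less.prems by (intro sum.union_disjoint) (auto simp: A'_def)
    also have "\<dots> \<le> c * sum u (E \<inter> {x..x + int N}) + c * sum u (E \<inter> {x + int N + 1..})"
      using N IH by linarith
    also have "\<dots> = c * sum u ((E \<inter> {x..x + int N}) \<union> (E \<inter> {x + int N + 1..}))"
      using assms by (subst sum.union_disjoint) (auto simp: distrib_left)
    also have "\<dots> \<le> c * sum u (E \<inter> {l..})"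
      using less.prems(3)[OF x(1)] assms by (intro mult_left_mono sum_mono2) auto
    finally show ?thesis .
  qed
qed

lemma step_avg_indicator:
  "step_avg 1 N (indicator E) x = card (E \<inter> {x+1..x + int N}) / N"
proof -
  have "(\<Sum>m=1..N. indicator E (x + 1 * int m)) = (\<Sum>y\<in>{x+1..x+int N}. indicator E y :: real)"
    by (rule sum.reindex_bij_witness[of _ "\<lambda>y. nat (y - x)" "\<lambda>m. x + 1 * int m"]) auto
  also have "\<dots> = (\<Sum>y\<in>{x+1..x+int N} \<inter> E. 1)"
    by (subst sum.inter_restrict) (auto simp: indicator_def of_bool_def intro!: sum.cong)
  finally show ?thesis unfolding step_avg_def by (simp add: Int_commute)
qed

lemma step_max_indicator_bounds:
  assumes "1 \<le> R"
  shows "0 \<le> step_max d R (indicator E) x" "step_max d R (indicator E) x \<le> 1"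
proof -
  obtain N where N: "1 \<le> N" "step_max d R (indicator E) x = step_avg d N (indicator E) x"
    using step_max_attained[OF assms] by metis
  show "0 \<le> step_max d R (indicator E) x"
    unfolding N step_avg_def by (intro divide_nonneg_nonneg sum_nonneg) auto
  have "(\<Sum>m=1..N. indicator E (x + d * int m)) \<le> (\<Sum>m=1..N. 1::real)"
    by (intro sum_mono) (auto simp: indicator_def)
  thus "step_max d R (indicator E) x \<le> 1" unfolding N(2) step_avg_def using N(1) by simp
qed

text \<open>
  If \<open>E\<close> occupies the proportion \<open>\<alpha>\<close> of an interval starting next
  to \<open>x\<close>, then it occupies at least \<open>\<alpha> / 2\<close> of that interval with
  \<open>x\<close> added, and \<open>Ap_lower_mass\<close> compares the weights.
\<close>
lemma restricted_weak_type:
  assumes p: "1 < p" and u: "\<And>x. 0 < u x" and K: "Ap_bound p u K"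
    and E: "finite E" and X: "finite X" and R: "1 \<le> R" and \<alpha>: "0 < \<alpha>"
  shows "sum u {x\<in>X. \<alpha> \<le> step_max 1 R (indicator E) x} \<le> K * (2 / \<alpha>) powr p * sum u E"
proof -
  have K1: "1 \<le> K" by (rule Ap_bound_ge_1[OF p u K])
  have "sum u {x\<in>X. \<alpha> \<le> step_max 1 R (indicator E) x}
      \<le> K * (2 / \<alpha>) powr p * sum u (E \<inter> {Min (insert 0 X)..})"
  proof (rule greedy_cover)
    fix x assume "x \<in> {x\<in>X. \<alpha> \<le> step_max 1 R (indicator E) x}"
    then obtain N where N: "1 \<le> N" "\<alpha> \<le> step_avg 1 N (indicator E) x"
      using step_max_attained[OF R] by (metis (no_types, lifting) mem_Collect_eq)
    define F where "F = E \<inter> {x..x + int N}"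
    have "\<alpha> * N \<le> card (E \<inter> {x+1..x + int N})"
      using N by (simp add: step_avg_indicator field_simps)
    also have "\<dots> \<le> card F" unfolding F_def using E by (intro of_nat_mono card_mono) auto
    finally have "\<alpha> * N \<le> card F" .
    moreover have "\<alpha> * 1 \<le> \<alpha> * N" using \<alpha> N by (intro mult_left_mono) auto
    ultimately have "\<alpha> / 2 * (N + 1) \<le> card F" by (simp add: algebra_simps)
    hence "\<alpha> / 2 \<le> card F / card {x..x + int N}" by (simp add: field_simps)
    hence "(\<alpha> / 2) powr p \<le> (card F / card {x..x + int N}) powr p"
      using \<alpha> p by (intro powr_mono2) auto
    hence "(\<alpha> / 2) powr p * sum u {x..x + int N} \<le> (card F / card {x..x + int N}) powr p * sum u {x..x + int N}"
      by (intro mult_right_mono sum_nonneg less_imp_le[OF u])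
    also have "\<dots> \<le> K * sum u F"
      using Ap_lower_mass[OF p u K, of x "x + int N" F] by (auto simp: F_def)
    finally have "sum u {x..x + int N} \<le> K * (2 / \<alpha>) powr p * sum u F"
      using \<alpha> by (simp add: powr_divide field_simps)
    thus "\<exists>N::nat. sum u {x..x + int N} \<le> K * (2 / \<alpha>) powr p * sum u (E \<inter> {x..x + int N})"
      unfolding F_def by blast
  qed (use X E K1 in \<open>auto intro: less_imp_le[OF u]\<close>)
  also have "\<dots> \<le> K * (2 / \<alpha>) powr p * sum u E"
    using K1 E by (intro mult_left_mono sum_mono2) (auto intro: less_imp_le[OF u])
  finally show ?thesis .
qed

text \<open>
  Summation of the weak-type bounds over the dyadic levels \<open>2 ^ - k\<close>; since the
  maximal function of an indicator is at most one, only levels below one occur and any exponent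
  \<open>r > p\<close> gives a convergent series.
\<close>
lemma restricted_strong_type:
  assumes p: "1 < p" and u: "\<And>x. 0 < u x" and K: "Ap_bound p u K" and pr: "p < r"
    and E: "finite E" and X: "finite X" and R: "1 \<le> R"
  shows "(\<Sum>x\<in>X. step_max 1 R (indicator E) x powr r * u x)
    \<le> K * 4 powr p / (1 - 2 powr (p - r)) * sum u E"
proof -
  define M where "M x = step_max 1 R (indicator E) x" for x
  have M: "0 \<le> M x" "M x \<le> 1" for x unfolding M_def using step_max_indicator_bounds[OF R] by auto
  have K1: "1 \<le> K" by (rule Ap_bound_ge_1[OF p u K])
  have sE: "0 \<le> sum u E" by (intro sum_nonneg less_imp_le[OF u])
  obtain n :: nat where n: "\<And>x. x \<in> X \<Longrightarrow> M x \<noteq> 0 \<Longrightarrow> (1/2)^n < M x"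
  proof (cases "{M x | x. x \<in> X \<and> M x \<noteq> 0} = {}")
    case True
    thus ?thesis using that[of 0] by blast
  next
    case False
    define m where "m = Min {M x | x. x \<in> X \<and> M x \<noteq> 0}"
    have fin: "finite {M x | x. x \<in> X \<and> M x \<noteq> 0}" using X by auto
    have "m \<in> {M x | x. x \<in> X \<and> M x \<noteq> 0}" unfolding m_def by (rule Min_in[OF fin False])
    then obtain x0 where "m = M x0" "M x0 \<noteq> 0" by blast
    hence "0 < m" using M(1)[of x0] by simp
    then obtain n where "(1/2)^n < m" using real_arch_pow_inv[of m "1/2"] by auto
    moreover have "m \<le> M x" if "x \<in> X" "M x \<noteq> 0" for x
      unfolding m_def using that fin by (intro Min_le) auto
    ultimately show ?thesis using that[of n] by fastforce
  qed
  define q where "q = 2 powr (p - r)"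
  have q: "0 < q" "q < 1" unfolding q_def using pr powr_less_one[of 2 "p - r"] by auto
  have pt: "M x powr r \<le> (\<Sum>k<Suc n. ((1/2)^k) powr r * (if (1/2)^(Suc k) \<le> M x then 1 else 0))" (is "_ \<le> ?S")
    if x: "x \<in> X" for x
  proof (cases "M x = 0")
    case True
    have "0 \<le> ?S" by (intro sum_nonneg) auto
    thus ?thesis using True by simp
  next
    case False
    define k where "k = (LEAST k. (1/2)^(Suc k) \<le> M x)"
    have "(1/2::real)^(Suc n) \<le> (1/2)^n" by simp
    hence nn: "(1/2)^(Suc n) \<le> M x" using n[OF x False] by linarith
    have k: "(1/2)^(Suc k) \<le> M x" unfolding k_def by (rule LeastI[of _ n]) (rule nn)
    have kn: "k \<le> n" unfolding k_def using nn by (rule Least_le)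
    have ub: "M x \<le> (1/2)^k"
    proof (cases k)
      case (Suc j)
      hence "j < k" by simp
      hence "\<not> (1/2)^(Suc j) \<le> M x" unfolding k_def by (rule not_less_Least)
      thus ?thesis using Suc by simp
    qed (use M in auto)
    have "M x powr r \<le> ((1/2)^k) powr r" using ub M p pr by (intro powr_mono2) auto
    also have "\<dots> = ((1/2)^k) powr r * (if (1/2)^(Suc k) \<le> M x then 1 else 0)" using k by simp
    also have "\<dots> \<le> ?S" using kn
      by (intro member_le_sum[of k "{..<Suc n}" "\<lambda>k. ((1/2)^k) powr r * (if (1/2)^(Suc k) \<le> M x then 1 else 0)"]) auto
    finally show ?thesis .
  qed
  have "(\<Sum>x\<in>X. M x powr r * u x)
     \<le> (\<Sum>x\<in>X. (\<Sum>k<Suc n. ((1/2)^k) powr r * (if (1/2)^(Suc k) \<le> M x then 1 else 0)) * u x)"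
    using pt by (intro sum_mono mult_right_mono less_imp_le[OF u])
  also have "\<dots> = (\<Sum>k<Suc n. ((1/2)^k) powr r * (\<Sum>x\<in>X. if (1/2)^(Suc k) \<le> M x then u x else 0))"
    unfolding sum_distrib_right sum_distrib_left by (subst sum.swap) (intro sum.cong, auto)
  also have "\<dots> \<le> (\<Sum>k<Suc n. ((1/2)^k) powr r * (K * (2 / (1/2)^(Suc k)) powr p * sum u E))"
  proof (intro sum_mono mult_left_mono)
    fix k
    have "(\<Sum>x\<in>X. if (1/2)^(Suc k) \<le> M x then u x else 0) = sum u {x\<in>X. (1/2)^(Suc k) \<le> M x}"
      using X by (simp add: sum.inter_filter)
    also have "\<dots> \<le> K * (2 / (1/2)^(Suc k)) powr p * sum u E"
      unfolding M_def by (intro restricted_weak_type assms) auto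
    finally show "(\<Sum>x\<in>X. if (1/2)^(Suc k) \<le> M x then u x else 0) \<le> K * (2 / (1/2)^(Suc k)) powr p * sum u E" .
  qed auto
  also have "\<dots> = K * 4 powr p * sum u E * (\<Sum>k<Suc n. q^k)"
    unfolding sum_distrib_left[of "K * 4 powr p * sum u E"]
  proof (intro sum.cong refl)
    fix k
    have h: "((1/2)^k) = (2::real) powr (- real k)" by (simp add: powr_minus powr_realpow power_one_over field_simps)
    have "(2::real) / (1/2)^(Suc k) = 4 * 2 powr (real k)" by (simp add: powr_realpow power_one_over)
    hence "((1/2)^k) powr r * (2 / (1/2)^(Suc k)) powr p = 4 powr p * (2 powr (- real k * r) * 2 powr (real k * p))"
      unfolding h by (simp add: powr_mult powr_powr)
    also have "2 powr (- real k * r) * 2 powr (real k * p) = (2::real) powr ((p - r) * real k)"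
      by (simp add: powr_add[symmetric] algebra_simps)
    also have "\<dots> = q^k" unfolding q_def by (simp add: powr_powr[symmetric] powr_realpow)
    finally have e: "((1/2)^k) powr r * (2 / (1/2)^(Suc k)) powr p = 4 powr p * q^k" .
    have "((1/2)^k) powr r * (K * (2 / (1/2)^(Suc k)) powr p * sum u E)
       = (((1/2)^k) powr r * (2 / (1/2)^(Suc k)) powr p) * (K * sum u E)" by (simp only: mult_ac)
    also have "\<dots> = K * 4 powr p * sum u E * q^k" unfolding e by (simp only: mult_ac)
    finally show "((1/2)^k) powr r * (K * (2 / (1/2)^(Suc k)) powr p * sum u E) = K * 4 powr p * sum u E * q^k" .
  qed
  also have "\<dots> \<le> K * 4 powr p * sum u E * (1 / (1 - q))"
  proof (intro mult_left_mono)
    have "(\<Sum>k<Suc n. q^k) \<le> (\<Sum>k. q^k)"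
      using q by (intro sum_le_suminf summable_geometric) auto
    thus "(\<Sum>k<Suc n. q^k) \<le> 1 / (1 - q)" using q by (simp add: suminf_geometric)
  qed (use K1 sE in auto)
  finally show ?thesis unfolding M_def q_def by (simp add: mult_ac)
qed

section \<open>Interpolation from level sets of the function and of the weight\<close>

text \<open>
  The offset \<open>y\<close> is real because it will be a logarithm of an output value or of a
  weight.
\<close>
lemma sum_geometric_int_le:
  fixes q :: real and y :: real
  assumes q: "0 < q" "q < 1" and "finite I"
  shows "(\<Sum>i\<in>I. q powr \<bar>real_of_int i - y\<bar>) \<le> 2 / (1 - q)"
proof -
  define g where "g m = (\<Sum>k<m. q^k)" for m :: nat
  have gb: "g m \<le> 1 / (1 - q)" for m
  proof -
    have "g m \<le> (\<Sum>k. q^k)" unfolding g_def using q by (intro sum_le_suminf summable_geometric) auto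
    thus ?thesis using q by (simp add: suminf_geometric)
  qed
  have pos: "(\<Sum>i\<in>J. q powr \<bar>real_of_int i - y\<bar>) \<le> 1 / (1 - q)"
    if J: "finite J" and h: "inj_on h J" "\<And>i. i \<in> J \<Longrightarrow> real (h i) \<le> \<bar>real_of_int i - y\<bar>" for J and h :: "int \<Rightarrow> nat"
  proof -
    define m where "m = Suc (Max (insert 0 (h ` J)))"
    have "(\<Sum>i\<in>J. q powr \<bar>real_of_int i - y\<bar>) \<le> (\<Sum>i\<in>J. q ^ (h i))"
    proof (intro sum_mono)
      fix i assume "i \<in> J"
      hence "q powr \<bar>real_of_int i - y\<bar> \<le> q powr real (h i)"
        using h q by (intro powr_mono') auto
      thus "q powr \<bar>real_of_int i - y\<bar> \<le> q ^ h i" using q by (simp add: powr_realpow)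
    qed
    also have "\<dots> = sum ((^) q) (h ` J)" using h by (simp add: sum.reindex)
    also have "\<dots> \<le> g m" unfolding g_def
      using q J by (intro sum_mono2) (auto simp: m_def less_Suc_eq_le)
    finally show ?thesis using gb[of m] by linarith
  qed
  define c where "c = \<lceil>y\<rceil>"
  have "(\<Sum>i\<in>I. q powr \<bar>real_of_int i - y\<bar>)
     = (\<Sum>i\<in>I \<inter> {c..}. q powr \<bar>real_of_int i - y\<bar>) + (\<Sum>i\<in>I \<inter> {..<c}. q powr \<bar>real_of_int i - y\<bar>)"
    using assms by (subst sum.union_disjoint[symmetric]) (auto intro!: sum.cong)
  also have "\<dots> \<le> 1 / (1 - q) + 1 / (1 - q)"
  proof (intro add_mono)
    show "(\<Sum>i\<in>I \<inter> {c..}. q powr \<bar>real_of_int i - y\<bar>) \<le> 1 / (1 - q)"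
    proof (rule pos[of _ "\<lambda>i. nat (i - c)"])
      fix i assume i: "i \<in> I \<inter> {c..}"
      have "y \<le> of_int c" unfolding c_def by simp
      thus "real (nat (i - c)) \<le> \<bar>real_of_int i - y\<bar>" using i by auto
    qed (use assms in \<open>auto simp: inj_on_def\<close>)
    show "(\<Sum>i\<in>I \<inter> {..<c}. q powr \<bar>real_of_int i - y\<bar>) \<le> 1 / (1 - q)"
    proof (rule pos[of _ "\<lambda>i. nat (c - 1 - i)"])
      fix i assume i: "i \<in> I \<inter> {..<c}"
      have "of_int c - 1 < y" unfolding c_def by linarith
      thus "real (nat (c - 1 - i)) \<le> \<bar>real_of_int i - y\<bar>" using i by auto
    qed (use assms in \<open>auto simp: inj_on_def\<close>)
  qed
  finally show ?thesis by simp
qed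

text \<open>
  A sum with prescribed summable proportions has a term that is at least as large as its proportion;
  used to replace a sum over levels by a single level at the price of a slowly growing factor.
\<close>
lemma exists_dominant_term:
  fixes a \<rho> :: "'a \<Rightarrow> real"
  assumes "finite I" "I \<noteq> {}" "\<And>i. i \<in> I \<Longrightarrow> 0 < \<rho> i" "sum \<rho> I \<le> C" "0 \<le> L" "L \<le> sum a I"
  shows "\<exists>i\<in>I. L * \<rho> i \<le> C * a i"
proof (rule ccontr)
  assume "\<not> ?thesis"
  hence h: "\<And>i. i \<in> I \<Longrightarrow> C * a i < L * \<rho> i" by force
  have "sum \<rho> I > 0" using assms by (intro sum_pos) auto
  hence C: "C > 0" using assms by linarith
  have "C * sum a I < L * sum \<rho> I"
    unfolding sum_distrib_left using h assms by (intro sum_strict_mono) auto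
  also have "\<dots> \<le> L * C" using assms by (intro mult_left_mono) auto
  also have "\<dots> \<le> C * sum a I" using C assms by (simp add: mult.commute mult_left_mono)
  finally show False by simp
qed

text \<open>
  The hypothesis bounds \<open>y\<close> by \<open>t\<close> up to small powers of \<open>y\<close>
  and \<open>v\<close> or of their inverses. The power of \<open>y\<close> on the right is absorbed
  on the left, which changes the exponent of \<open>t\<close> from \<open>p\<close> to
  \<open>p / (1 + \<sigma>)\<close>; the signs \<open>\<sigma>\<close> and \<open>\<tau>\<close>
  depend on whether \<open>y\<close> and \<open>v\<close> exceed one, and summing over all four
  choices avoids the distinction.
\<close>
lemma absorb_self_powers:
  fixes y t v C \<epsilon> p :: real
  assumes y: "0 < y" and t: "0 \<le> t" and v: "0 < v" and C: "1 \<le> C" and \<epsilon>: "0 < \<epsilon>" "\<epsilon> \<le> 1/2" and p: "0 < p"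
    and le: "y * 2 powr (- \<epsilon> * \<bar>log 2 y\<bar>) * 2 powr (- \<epsilon> * \<bar>log 2 v\<bar>) \<le> C * t"
  shows "y powr p \<le> C powr (2 * p) * (\<Sum>\<sigma>\<in>{\<epsilon>,-\<epsilon>}. \<Sum>\<tau>\<in>{\<epsilon>,-\<epsilon>}. t powr (p / (1 + \<sigma>)) * v powr (\<tau> * p / (1 + \<sigma>)))"
proof -
  have y2: "y = 2 powr log 2 y" and v2: "v = 2 powr log 2 v" using y v by auto
  define \<sigma> where "\<sigma> = (if 1 \<le> y then - \<epsilon> else \<epsilon>)"
  define \<tau> where "\<tau> = (if 1 \<le> v then \<epsilon> else - \<epsilon>)"
  have \<sigma>: "\<sigma> \<in> {\<epsilon>,-\<epsilon>}" and \<tau>: "\<tau> \<in> {\<epsilon>,-\<epsilon>}" unfolding \<sigma>_def \<tau>_def by auto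
  have s1: "1/2 \<le> 1 + \<sigma>" unfolding \<sigma>_def using \<epsilon> by auto
  have ly: "1 \<le> y \<longleftrightarrow> 0 \<le> log 2 y" and lv: "1 \<le> v \<longleftrightarrow> 0 \<le> log 2 v" using y v by auto
  have "- \<epsilon> * \<bar>log 2 y\<bar> = \<sigma> * log 2 y" unfolding \<sigma>_def ly by auto
  hence e1: "2 powr (- \<epsilon> * \<bar>log 2 y\<bar>) = y powr \<sigma>" using y by (simp add: powr_def log_def)
  have "- \<epsilon> * \<bar>log 2 v\<bar> = - (\<tau> * log 2 v)" unfolding \<tau>_def lv by auto
  hence e2: "2 powr (- \<epsilon> * \<bar>log 2 v\<bar>) = v powr (- \<tau>)" using v by (simp add: powr_def log_def)
  have "y powr (1 + \<sigma>) * v powr (- \<tau>) \<le> C * t"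
    using le unfolding e1 e2 using y by (simp add: powr_add)
  hence "y powr (1 + \<sigma>) \<le> C * (t * v powr \<tau>)"
    using v by (simp add: powr_minus field_simps)
  hence "(y powr (1 + \<sigma>)) powr (p / (1 + \<sigma>)) \<le> (C * (t * v powr \<tau>)) powr (p / (1 + \<sigma>))"
    using p s1 by (intro powr_mono2) auto
  hence "y powr p \<le> C powr (p / (1 + \<sigma>)) * (t powr (p / (1 + \<sigma>)) * v powr (\<tau> * p / (1 + \<sigma>)))"
    using s1 C t by (simp add: powr_powr powr_mult)
  also have "\<dots> \<le> C powr (2 * p) * (t powr (p / (1 + \<sigma>)) * v powr (\<tau> * p / (1 + \<sigma>)))"
  proof (intro mult_right_mono powr_mono)
    have "p / (1 + \<sigma>) \<le> p / (1/2)" using s1 p by (intro divide_left_mono) auto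
    thus "p / (1 + \<sigma>) \<le> 2 * p" by simp
  qed (use C in auto)
  also have "\<dots> \<le> C powr (2 * p) * (\<Sum>\<sigma>\<in>{\<epsilon>,-\<epsilon>}. \<Sum>\<tau>\<in>{\<epsilon>,-\<epsilon>}. t powr (p / (1 + \<sigma>)) * v powr (\<tau> * p / (1 + \<sigma>)))"
  proof (intro mult_left_mono)
    have "t powr (p / (1 + \<sigma>)) * v powr (\<tau> * p / (1 + \<sigma>)) \<le> (\<Sum>\<tau>\<in>{\<epsilon>,-\<epsilon>}. t powr (p / (1 + \<sigma>)) * v powr (\<tau> * p / (1 + \<sigma>)))"
      by (rule member_le_sum[OF \<tau>]) auto
    also have "\<dots> \<le> (\<Sum>\<sigma>\<in>{\<epsilon>,-\<epsilon>}. \<Sum>\<tau>\<in>{\<epsilon>,-\<epsilon>}. t powr (p / (1 + \<sigma>)) * v powr (\<tau> * p / (1 + \<sigma>)))"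
      by (rule member_le_sum[OF \<sigma>]) (auto intro!: sum_nonneg)
    finally show "t powr (p / (1 + \<sigma>)) * v powr (\<tau> * p / (1 + \<sigma>)) \<le> (\<Sum>\<sigma>\<in>{\<epsilon>,-\<epsilon>}. \<Sum>\<tau>\<in>{\<epsilon>,-\<epsilon>}. t powr (p / (1 + \<sigma>)) * v powr (\<tau> * p / (1 + \<sigma>)))" .
  qed auto
  finally show ?thesis .
qed

definition interp_const :: "real \<Rightarrow> real \<Rightarrow> real" where
  "interp_const p \<epsilon> = ((2 / (1 - 2 powr (-\<epsilon>)))^2) powr (2 * p) * (4 * 2 powr p)"

text \<open>
  A Marcinkiewicz and Stein-Weiss theorem in one step. The function is cut along
  \<open>\<bar>f\<bar> \<approx> 2 ^ j\<close> and \<open>w \<approx> 2 ^ i\<close>. At a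
  point \<open>x\<close> with output \<open>L = T f x\<close>, some piece \<open>(j, i)\<close>
  contributes, up to a constant, at least the share
  \<open>2 powr (- \<epsilon> * (\<bar>j - log L\<bar> + \<bar>i - log (w x)\<bar>))\<close>
  of \<open>L\<close>. Solving this for \<open>L\<close> bounds \<open>L powr p * w x\<close>
  by the four perturbed expressions for that piece, and summing these over all pieces and all
  \<open>x\<close> the restricted hypotheses reproduce
  \<open>2 powr (j * p) * 2 powr i * card E\<close> up to a constant.
\<close>
lemma interpolation_from_level_sets:
  fixes T :: "(int \<Rightarrow> real) \<Rightarrow> int \<Rightarrow> real" and w :: "int \<Rightarrow> real" and B :: real
  assumes p: "0 < p" and \<epsilon>: "0 < \<epsilon>" "\<epsilon> \<le> 1/2" and w: "\<And>x. 0 < w x" and B: "0 \<le> B"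
    and nonneg: "\<And>f x. 0 \<le> T f x"
    and hom: "\<And>c f x. 0 < c \<Longrightarrow> T (\<lambda>y. c * f y) x = c * T f x"
    and sub: "\<And>I F x. finite (I :: (int \<times> int) set) \<Longrightarrow> T (\<lambda>y. \<Sum>k\<in>I. F k y) x \<le> (\<Sum>k\<in>I. T (F k) x)"
    and restr: "\<And>E h i \<sigma> \<tau>. finite E \<Longrightarrow> \<forall>y\<in>E. 2 powr of_int i \<le> w y \<and> w y \<le> 2 * 2 powr of_int i
        \<Longrightarrow> \<forall>y. \<bar>h y\<bar> \<le> indicator E y \<Longrightarrow> \<sigma> \<in> {\<epsilon>,-\<epsilon>} \<Longrightarrow> \<tau> \<in> {\<epsilon>,-\<epsilon>} \<Longrightarrow>
        (\<Sum>x\<in>X. T h x powr (p / (1 + \<sigma>)) * w x powr (1 + \<tau> * p / (1 + \<sigma>)))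
          \<le> B * card E * (2 powr of_int i) powr (1 + \<tau> * p / (1 + \<sigma>))"
    and X: "finite X" and S: "finite S" and f: "\<And>y. y \<notin> S \<Longrightarrow> f y = 0"
  shows "(\<Sum>x\<in>X. T f x powr p * w x) \<le> interp_const p \<epsilon> * B * (\<Sum>y\<in>S. \<bar>f y\<bar> powr p * w y)"
proof -
  define q where "q = 2 powr (-\<epsilon>)"
  have q: "0 < q" "q < 1" unfolding q_def using \<epsilon> powr_less_one[of 2 "-\<epsilon>"] by auto
  define C where "C = (2 / (1 - q))^2"
  have C: "1 \<le> C" unfolding C_def using q by (intro one_le_power) (simp add: field_simps)
  define SG where "SG = {\<epsilon>,-\<epsilon>}"
  define S' where "S' = {y\<in>S. f y \<noteq> 0}"
  \<comment> \<open>The levels of \<open>f\<close> are rounded up, so that \<open>f\<close> divided by its level is at most one in modulus.\<close>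
  define jj where "jj y = \<lceil>log 2 \<bar>f y\<bar>\<rceil>" for y
  define ii where "ii y = \<lfloor>log 2 (w y)\<rfloor>" for y
  define I where "I = (\<lambda>y. (jj y, ii y)) ` S'"
  define E where "E k = {y\<in>S'. (jj y, ii y) = k}" for k
  define h where "h k y = (if y \<in> E k then f y / 2 powr of_int (fst k) else 0)" for k y
  have fin: "finite S'" "finite I" "finite (E k)" for k
    unfolding S'_def I_def E_def using S by auto
  have jb: "2 powr of_int (jj y) \<le> 2 * \<bar>f y\<bar>" "\<bar>f y\<bar> \<le> 2 powr of_int (jj y)" if "y \<in> S'" for y
  proof -
    have f0: "\<bar>f y\<bar> = 2 powr log 2 \<bar>f y\<bar>" using that unfolding S'_def by simp
    have "of_int (jj y) \<le> 1 + log 2 \<bar>f y\<bar>" unfolding jj_def by linarith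
    hence "2 powr of_int (jj y) \<le> 2 powr (1 + log 2 \<bar>f y\<bar>)" by (intro powr_mono) auto
    also have "\<dots> = 2 * \<bar>f y\<bar>" using f0 by (simp add: powr_add)
    finally show "2 powr of_int (jj y) \<le> 2 * \<bar>f y\<bar>" .
    have "2 powr log 2 \<bar>f y\<bar> \<le> 2 powr of_int (jj y)" unfolding jj_def by (intro powr_mono) auto
    thus "\<bar>f y\<bar> \<le> 2 powr of_int (jj y)" using f0 by simp
  qed
  have ib: "2 powr of_int (ii y) \<le> w y" "w y \<le> 2 * 2 powr of_int (ii y)" for y
  proof -
    have w0: "w y = 2 powr log 2 (w y)" using w[of y] by simp
    have "2 powr of_int (ii y) \<le> 2 powr log 2 (w y)" unfolding ii_def by (intro powr_mono) auto
    thus "2 powr of_int (ii y) \<le> w y" using w0 by simp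
    have "log 2 (w y) \<le> 1 + of_int (ii y)" unfolding ii_def by linarith
    hence "2 powr log 2 (w y) \<le> 2 powr (1 + of_int (ii y))" by (intro powr_mono) auto
    thus "w y \<le> 2 * 2 powr of_int (ii y)" using w0 by (simp add: powr_add)
  qed
  have fsum: "f = (\<lambda>y. \<Sum>k\<in>I. 2 powr of_int (fst k) * h k y)"
  proof
    fix y
    show "f y = (\<Sum>k\<in>I. 2 powr of_int (fst k) * h k y)"
    proof (cases "y \<in> S'")
      case True
      hence "(\<Sum>k\<in>I. 2 powr of_int (fst k) * h k y) = (\<Sum>k\<in>{(jj y, ii y)}. 2 powr of_int (fst k) * h k y)"
        using fin by (intro sum.mono_neutral_right) (auto simp: I_def h_def E_def)
      also have "\<dots> = f y" using True by (simp add: h_def E_def)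
      finally show ?thesis by simp
    next
      case False
      hence "f y = 0" using f unfolding S'_def by auto
      thus ?thesis using False by (simp add: h_def E_def)
    qed
  qed
  have hb: "\<bar>h k y\<bar> \<le> indicator (E k) y" for k y
  proof (cases "y \<in> E k")
    case True
    hence "y \<in> S'" "fst k = jj y" unfolding E_def by auto
    thus ?thesis using jb(2)[of y] True by (simp add: h_def)
  qed (simp add: h_def)
  define b where "b \<sigma> \<tau> = 1 + \<tau> * p / (1 + \<sigma>)" for \<sigma> \<tau> :: real
  have pt: "T f x powr p * w x \<le> C powr (2 * p) * (\<Sum>k\<in>I. (2 powr of_int (fst k)) powr p *
       (\<Sum>\<sigma>\<in>SG. \<Sum>\<tau>\<in>SG. T (h k) x powr (p / (1 + \<sigma>)) * w x powr b \<sigma> \<tau> * (2 powr of_int (snd k)) powr (1 - b \<sigma> \<tau>)))"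
      (is "_ \<le> _ * (\<Sum>k\<in>I. ?G k)")
    for x
  proof (cases "T f x = 0")
    case True
    have "0 \<le> (\<Sum>k\<in>I. ?G k)" by (intro sum_nonneg mult_nonneg_nonneg) auto
    thus ?thesis using True p C by simp
  next
    case False
    define L where "L = T f x"
    have L: "0 < L" unfolding L_def using False nonneg[of f x] by simp
    \<comment> \<open>The share of the output allotted to a level decreases with its distance from \<open>log 2 L\<close> and \<open>log 2 (w x)\<close>.\<close>
    define \<rho> where "\<rho> k = q powr \<bar>of_int (fst k) - log 2 L\<bar> * q powr \<bar>of_int (snd k) - log 2 (w x)\<bar>" for k :: "int \<times> int"
    have "L \<le> (\<Sum>k\<in>I. T (\<lambda>y. 2 powr of_int (fst k) * h k y) x)"
      unfolding L_def by (subst fsum) (rule sub[OF fin(2)])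
    also have "\<dots> = (\<Sum>k\<in>I. 2 powr of_int (fst k) * T (h k) x)" by (simp add: hom)
    finally have Lle: "L \<le> (\<Sum>k\<in>I. 2 powr of_int (fst k) * T (h k) x)" .
    hence I0: "I \<noteq> {}" using L by auto
    have "sum \<rho> I \<le> sum \<rho> (fst ` I \<times> snd ` I)"
      using fin q by (intro sum_mono2) (auto simp: \<rho>_def intro: rev_image_eqI)
    also have "\<dots> = (\<Sum>j\<in>fst ` I. q powr \<bar>of_int j - log 2 L\<bar>) * (\<Sum>i\<in>snd ` I. q powr \<bar>of_int i - log 2 (w x)\<bar>)"
      unfolding sum_product sum.cartesian_product \<rho>_def by (intro sum.cong) auto
    also have "\<dots> \<le> (2 / (1 - q)) * (2 / (1 - q))"
      using fin q by (intro mult_mono sum_geometric_int_le) (auto intro!: sum_nonneg)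
    finally have \<rho>: "sum \<rho> I \<le> C" unfolding C_def by (simp add: power2_eq_square)
    have "\<exists>k\<in>I. L * \<rho> k \<le> C * (2 powr of_int (fst k) * T (h k) x)"
      using fin I0 \<rho> L Lle q by (intro exists_dominant_term) (auto simp: \<rho>_def)
    then obtain k where k: "k \<in> I" "L * \<rho> k \<le> C * (2 powr of_int (fst k) * T (h k) x)" by blast
    define J where "J = (2::real) powr of_int (fst k)"
    define W where "W = (2::real) powr of_int (snd k)"
    have JW: "0 < J" "0 < W" unfolding J_def W_def by auto
    have qp: "q powr \<bar>a\<bar> = 2 powr (- \<epsilon> * \<bar>a\<bar>)" for a unfolding q_def powr_powr by simp
    have r1: "\<bar>of_int (fst k) - log 2 L\<bar> = \<bar>log 2 (L / J)\<bar>"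
      using L JW by (simp add: log_divide J_def)
    have r2: "\<bar>of_int (snd k) - log 2 (w x)\<bar> = \<bar>log 2 (w x / W)\<bar>"
      using w[of x] JW by (simp add: log_divide W_def)
    have "L / J * 2 powr (- \<epsilon> * \<bar>log 2 (L / J)\<bar>) * 2 powr (- \<epsilon> * \<bar>log 2 (w x / W)\<bar>) = L * \<rho> k / J"
      unfolding \<rho>_def qp r1 r2 by simp
    also have "\<dots> \<le> C * T (h k) x"
      using k(2) JW unfolding J_def[symmetric] by (simp add: field_simps)
    finally have "(L / J) powr p \<le> C powr (2 * p) *
       (\<Sum>\<sigma>\<in>SG. \<Sum>\<tau>\<in>SG. T (h k) x powr (p / (1 + \<sigma>)) * (w x / W) powr (\<tau> * p / (1 + \<sigma>)))"
      unfolding SG_def using L JW w[of x] nonneg C \<epsilon> p by (intro absorb_self_powers) auto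
    hence "(L / J) powr p * (J powr p * w x) \<le> C powr (2 * p) *
       (\<Sum>\<sigma>\<in>SG. \<Sum>\<tau>\<in>SG. T (h k) x powr (p / (1 + \<sigma>)) * (w x / W) powr (\<tau> * p / (1 + \<sigma>))) * (J powr p * w x)"
      using JW w[of x] by (intro mult_right_mono) auto
    also have "(L / J) powr p * (J powr p * w x) = L powr p * w x"
      using L JW by (simp add: powr_divide)
    also have "C powr (2 * p) *
       (\<Sum>\<sigma>\<in>SG. \<Sum>\<tau>\<in>SG. T (h k) x powr (p / (1 + \<sigma>)) * (w x / W) powr (\<tau> * p / (1 + \<sigma>))) * (J powr p * w x)
       = C powr (2 * p) * ?G k"
    proof -
      have e: "(w x / W) powr (\<tau> * p / (1 + \<sigma>)) * w x = w x powr b \<sigma> \<tau> * W powr (1 - b \<sigma> \<tau>)" for \<sigma> \<tau>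
        unfolding b_def using w[of x] JW by (simp add: powr_divide powr_add powr_minus_divide)
      define A A' where "A = (\<Sum>\<sigma>\<in>SG. \<Sum>\<tau>\<in>SG. T (h k) x powr (p / (1 + \<sigma>)) * (w x / W) powr (\<tau> * p / (1 + \<sigma>)))"
        and "A' = (\<Sum>\<sigma>\<in>SG. \<Sum>\<tau>\<in>SG. T (h k) x powr (p / (1 + \<sigma>)) * w x powr b \<sigma> \<tau> * W powr (1 - b \<sigma> \<tau>))"
      have "A * w x = A'"
        unfolding A_def A'_def sum_distrib_right by (intro sum.cong refl) (simp only: mult.assoc e)
      hence "C powr (2 * p) * A * (J powr p * w x) = C powr (2 * p) * (J powr p * A')"
        by (metis mult.assoc mult.commute)
      thus ?thesis unfolding A_def A'_def J_def W_def .
    qed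
    also have "\<dots> \<le> C powr (2 * p) * (\<Sum>k\<in>I. ?G k)"
    proof (intro mult_left_mono)
      show "?G k \<le> (\<Sum>k\<in>I. ?G k)"
        using k fin by (intro member_le_sum[where f = ?G] mult_nonneg_nonneg sum_nonneg) auto
    qed auto
    finally show ?thesis unfolding L_def .
  qed
  have level: "(\<Sum>x\<in>X. (2 powr of_int (fst k)) powr p *
       (\<Sum>\<sigma>\<in>SG. \<Sum>\<tau>\<in>SG. T (h k) x powr (p / (1 + \<sigma>)) * w x powr b \<sigma> \<tau> * (2 powr of_int (snd k)) powr (1 - b \<sigma> \<tau>)))
       \<le> 4 * 2 powr p * B * (\<Sum>y\<in>E k. \<bar>f y\<bar> powr p * w y)" for k
  proof -
    define J where "J = (2::real) powr of_int (fst k)"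
    define W where "W = (2::real) powr of_int (snd k)"
    have JW: "0 < J" "0 < W" unfolding J_def W_def by auto
    have "(\<Sum>x\<in>X. J powr p * (\<Sum>\<sigma>\<in>SG. \<Sum>\<tau>\<in>SG. T (h k) x powr (p / (1 + \<sigma>)) * w x powr b \<sigma> \<tau> * W powr (1 - b \<sigma> \<tau>)))
       = J powr p * (\<Sum>\<sigma>\<in>SG. \<Sum>\<tau>\<in>SG. W powr (1 - b \<sigma> \<tau>) * (\<Sum>x\<in>X. T (h k) x powr (p / (1 + \<sigma>)) * w x powr b \<sigma> \<tau>))"
    proof -
      have "(\<Sum>x\<in>X. \<Sum>\<sigma>\<in>SG. \<Sum>\<tau>\<in>SG. T (h k) x powr (p / (1 + \<sigma>)) * w x powr b \<sigma> \<tau> * W powr (1 - b \<sigma> \<tau>))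
        = (\<Sum>\<sigma>\<in>SG. \<Sum>x\<in>X. \<Sum>\<tau>\<in>SG. T (h k) x powr (p / (1 + \<sigma>)) * w x powr b \<sigma> \<tau> * W powr (1 - b \<sigma> \<tau>))"
        by (rule sum.swap)
      also have "\<dots> = (\<Sum>\<sigma>\<in>SG. \<Sum>\<tau>\<in>SG. \<Sum>x\<in>X. T (h k) x powr (p / (1 + \<sigma>)) * w x powr b \<sigma> \<tau> * W powr (1 - b \<sigma> \<tau>))"
        by (intro sum.cong refl sum.swap)
      also have "\<dots> = (\<Sum>\<sigma>\<in>SG. \<Sum>\<tau>\<in>SG. W powr (1 - b \<sigma> \<tau>) * (\<Sum>x\<in>X. T (h k) x powr (p / (1 + \<sigma>)) * w x powr b \<sigma> \<tau>))"
        by (intro sum.cong refl) (simp add: sum_distrib_left mult_ac)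
      finally show ?thesis by (simp only: sum_distrib_left[of "J powr p", symmetric])
    qed
    also have "\<dots> \<le> J powr p * (\<Sum>\<sigma>\<in>SG. \<Sum>\<tau>\<in>SG. B * card (E k) * W)"
    proof (intro mult_left_mono sum_mono)
      fix \<sigma> \<tau> assume st: "\<sigma> \<in> SG" "\<tau> \<in> SG"
      have "W powr (1 - b \<sigma> \<tau>) * (\<Sum>x\<in>X. T (h k) x powr (p / (1 + \<sigma>)) * w x powr b \<sigma> \<tau>)
          \<le> W powr (1 - b \<sigma> \<tau>) * (B * card (E k) * W powr b \<sigma> \<tau>)"
        unfolding b_def W_def using st
      proof (intro mult_left_mono restr[OF fin(3)] ballI)
        fix y assume "y \<in> E k"
        hence "snd k = ii y" unfolding E_def by auto
        thus "2 powr of_int (snd k) \<le> w y \<and> w y \<le> 2 * 2 powr of_int (snd k)" using ib[of y] by simp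
      qed (auto simp: SG_def hb)
      also have "\<dots> = B * card (E k) * W" using JW by (simp add: powr_diff)
      finally show "W powr (1 - b \<sigma> \<tau>) * (\<Sum>x\<in>X. T (h k) x powr (p / (1 + \<sigma>)) * w x powr b \<sigma> \<tau>)
          \<le> B * card (E k) * W" .
    qed auto
    also have "\<dots> = 4 * B * (\<Sum>y\<in>E k. J powr p * W)"
      using \<epsilon> unfolding SG_def by simp
    also have "\<dots> \<le> 4 * B * (\<Sum>y\<in>E k. (2 powr p * \<bar>f y\<bar> powr p) * w y)"
    proof (intro mult_left_mono sum_mono mult_mono)
      fix y assume "y \<in> E k"
      hence y: "y \<in> S'" "jj y = fst k" "ii y = snd k" unfolding E_def by auto
      have "J powr p \<le> (2 * \<bar>f y\<bar>) powr p"
        unfolding J_def using jb(1)[OF y(1)] y p by (intro powr_mono2) auto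
      thus "J powr p \<le> 2 powr p * \<bar>f y\<bar> powr p" by (simp add: powr_mult)
      show "W \<le> w y" unfolding W_def using ib(1)[of y] y by simp
    qed (use JW B in auto)
    also have "\<dots> = 4 * 2 powr p * B * (\<Sum>y\<in>E k. \<bar>f y\<bar> powr p * w y)"
      by (simp add: sum_distrib_left mult_ac)
    finally show ?thesis unfolding J_def W_def .
  qed
  have "(\<Sum>x\<in>X. T f x powr p * w x) \<le> (\<Sum>x\<in>X. C powr (2 * p) * (\<Sum>k\<in>I. (2 powr of_int (fst k)) powr p *
       (\<Sum>\<sigma>\<in>SG. \<Sum>\<tau>\<in>SG. T (h k) x powr (p / (1 + \<sigma>)) * w x powr b \<sigma> \<tau> * (2 powr of_int (snd k)) powr (1 - b \<sigma> \<tau>))))"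
    by (intro sum_mono pt)
  also have "\<dots> = C powr (2 * p) * (\<Sum>k\<in>I. \<Sum>x\<in>X. (2 powr of_int (fst k)) powr p *
       (\<Sum>\<sigma>\<in>SG. \<Sum>\<tau>\<in>SG. T (h k) x powr (p / (1 + \<sigma>)) * w x powr b \<sigma> \<tau> * (2 powr of_int (snd k)) powr (1 - b \<sigma> \<tau>)))"
    unfolding sum_distrib_left[of "C powr (2 * p)", symmetric] by (subst sum.swap) (rule refl)
  also have "\<dots> \<le> C powr (2 * p) * (\<Sum>k\<in>I. 4 * 2 powr p * B * (\<Sum>y\<in>E k. \<bar>f y\<bar> powr p * w y))"
    by (intro mult_left_mono sum_mono level) auto
  also have "(\<Sum>k\<in>I. 4 * 2 powr p * B * (\<Sum>y\<in>E k. \<bar>f y\<bar> powr p * w y))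
      = 4 * 2 powr p * B * (\<Sum>k\<in>I. \<Sum>y\<in>E k. \<bar>f y\<bar> powr p * w y)"
    by (simp only: sum_distrib_left)
  also have "(\<Sum>k\<in>I. \<Sum>y\<in>E k. \<bar>f y\<bar> powr p * w y) = (\<Sum>y\<in>S'. \<bar>f y\<bar> powr p * w y)"
    unfolding E_def using fin by (intro sum.group) (auto simp: I_def)
  also have "(\<Sum>y\<in>S'. \<bar>f y\<bar> powr p * w y) = (\<Sum>y\<in>S. \<bar>f y\<bar> powr p * w y)"
    unfolding S'_def using S p by (intro sum.mono_neutral_left) auto
  finally show ?thesis unfolding interp_const_def C_def q_def by (simp only: mult_ac)
qed

section \<open>The square-summable maximal theorem along progressions\<close>

lemma step_avg_mono: "(\<And>y. g y \<le> h y) \<Longrightarrow> step_avg d N g x \<le> step_avg d N h x"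
  unfolding step_avg_def by (intro divide_right_mono sum_mono) auto

lemma step_max_mono:
  assumes "\<And>y. g y \<le> h y" "1 \<le> R"
  shows "step_max d R g x \<le> step_max d R h x"
proof -
  obtain N where N: "1 \<le> N" "N \<le> R" "step_max d R g x = step_avg d N g x"
    using step_max_attained[OF assms(2)] by blast
  have "step_avg d N g x \<le> step_avg d N h x" by (rule step_avg_mono[OF assms(1)])
  also have "\<dots> \<le> step_max d R h x" using N by (intro step_avg_le_max)
  finally show ?thesis using N by simp
qed

lemma step_max_nonneg:
  assumes "\<And>y. 0 \<le> g y" "1 \<le> R"
  shows "0 \<le> step_max d R g x"
proof -
  have "0 \<le> step_avg d 1 g x" unfolding step_avg_def using assms by simp
  also have "\<dots> \<le> step_max d R g x" using assms by (intro step_avg_le_max) auto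
  finally show ?thesis .
qed

lemma Ap_bound_one:
  assumes "1 < p" shows "Ap_bound p (\<lambda>_. 1) 1"
  unfolding Ap_bound_def by auto

text \<open>
  The exponents \<open>3/2 < 8/5 = 2 / (1 + 1/4)\<close> place a weak-type index below all
  exponents that the interpolation around \<open>2\<close> with \<open>\<epsilon> = 1/4\<close>
  asks for. The factor four covers the level \<open>i = -1\<close> of the constant weight.
\<close>
definition HL_const :: real where
  "HL_const = interp_const 2 (1/4) * (4 * (4 powr (3/2) / (1 - 2 powr (3/2 - 8/5))))"

text \<open>
  The interpolation lemma applied to the constant weight; the restricted bounds come from
  \<open>restricted_strong_type\<close>.
\<close>
lemma Hardy_Littlewood_l2:
  assumes S: "finite S" "\<And>y. y \<notin> S \<Longrightarrow> f y = 0" and X: "finite X" and R: "1 \<le> R"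
  shows "(\<Sum>x\<in>X. (step_max 1 R (\<lambda>y. \<bar>f y\<bar>) x)\<^sup>2) \<le> HL_const * (\<Sum>y\<in>S. (f y)\<^sup>2)"
proof -
  define T where "T f = step_max 1 R (\<lambda>y. \<bar>f y\<bar>)" for f
  have T0: "0 \<le> T f x" for f x unfolding T_def by (intro step_max_nonneg R) auto
  have "(\<Sum>x\<in>X. T f x powr 2 * 1)
      \<le> interp_const 2 (1/4) * (4 * (4 powr (3/2) / (1 - 2 powr (3/2 - 8/5)))) * (\<Sum>y\<in>S. \<bar>f y\<bar> powr 2 * 1)"
  proof (rule interpolation_from_level_sets[where w = "\<lambda>_. 1" and T = T])
    show "0 \<le> T f x" for f x by (rule T0)
    have "(2::real) powr (3/2 - 8/5) < 1" by (intro powr_less_one) auto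
    thus "0 \<le> 4 * (4 powr (3/2) / (1 - 2 powr (3/2 - 8/5 :: real)))" by simp
    show "T (\<lambda>y. c * f y) x = c * T f x" if c: "0 < c" for c f x
    proof (rule antisym)
      have e: "step_avg 1 N (\<lambda>y. \<bar>c * f y\<bar>) x = c * step_avg 1 N (\<lambda>y. \<bar>f y\<bar>) x" for N
        unfolding step_avg_def using c by (simp add: abs_mult sum_distrib_left)
      obtain N where N: "1 \<le> N" "N \<le> R" "step_max 1 R (\<lambda>y. \<bar>c * f y\<bar>) x = step_avg 1 N (\<lambda>y. \<bar>c * f y\<bar>) x"
        using step_max_attained[OF R] by blast
      show "T (\<lambda>y. c * f y) x \<le> c * T f x"
        unfolding T_def N e using c N by (intro mult_left_mono step_avg_le_max) auto
      obtain N where N: "1 \<le> N" "N \<le> R" "step_max 1 R (\<lambda>y. \<bar>f y\<bar>) x = step_avg 1 N (\<lambda>y. \<bar>f y\<bar>) x"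
        using step_max_attained[OF R] by blast
      show "c * T f x \<le> T (\<lambda>y. c * f y) x"
        unfolding T_def N e[symmetric] using N by (intro step_avg_le_max) auto
    qed
    show "T (\<lambda>y. \<Sum>k\<in>I. F k y) x \<le> (\<Sum>k\<in>I. T (F k) x)" for I :: "(int \<times> int) set" and F x
    proof -
      obtain N where N: "1 \<le> N" "N \<le> R" "step_max 1 R (\<lambda>y. \<bar>\<Sum>k\<in>I. F k y\<bar>) x = step_avg 1 N (\<lambda>y. \<bar>\<Sum>k\<in>I. F k y\<bar>) x"
        using step_max_attained[OF R] by blast
      have "step_avg 1 N (\<lambda>y. \<bar>\<Sum>k\<in>I. F k y\<bar>) x \<le> step_avg 1 N (\<lambda>y. \<Sum>k\<in>I. \<bar>F k y\<bar>) x"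
        by (intro step_avg_mono sum_abs)
      also have "\<dots> = (\<Sum>k\<in>I. step_avg 1 N (\<lambda>y. \<bar>F k y\<bar>) x)"
        unfolding step_avg_def sum_divide_distrib by (rule sum.swap)
      also have "\<dots> \<le> (\<Sum>k\<in>I. T (F k) x)"
        unfolding T_def using N by (intro sum_mono step_avg_le_max) auto
      finally show ?thesis unfolding T_def N .
    qed
    fix E :: "int set" and h :: "int \<Rightarrow> real" and i :: int and \<sigma> \<tau> :: real
    assume E: "finite E" and h: "\<forall>y. \<bar>h y\<bar> \<le> indicator E y"
      and \<sigma>: "\<sigma> \<in> {1/4, -(1/4)}" and \<tau>: "\<tau> \<in> {1/4, -(1/4)}"
      and lev: "\<forall>y\<in>E. 2 powr of_int i \<le> (1::real) \<and> 1 \<le> 2 * (2::real) powr of_int i"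
    have Tb: "T h x \<le> step_max 1 R (indicator E) x" for x
      unfolding T_def using h by (intro step_max_mono R) auto
    have T1: "T h x \<le> 1" for x using Tb[of x] step_max_indicator_bounds(2)[OF R, of 1 E x] by linarith
    define K where "K = 4 powr (3/2) / (1 - 2 powr (3/2 - 8/5 :: real))"
    have "(2::real) powr (3/2 - 8/5) < 1" by (intro powr_less_one) auto
    hence K: "0 \<le> K" unfolding K_def by simp
    have pw: "T h x powr (2 / (1 + \<sigma>)) \<le> step_max 1 R (indicator E) x powr (8/5)" for x
    proof -
      have "8/5 \<le> 2 / (1 + \<sigma>)"
      proof (cases "\<sigma> = 1/4")
        case True
        show ?thesis unfolding True by simp
      next
        case False
        hence "\<sigma> = -(1/4)" using \<sigma> by auto
        thus ?thesis by simp
      qed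
      hence "T h x powr (2 / (1 + \<sigma>)) \<le> T h x powr (8/5)"
        using T0 T1 by (intro powr_mono') auto
      also have "\<dots> \<le> step_max 1 R (indicator E) x powr (8/5)"
        using T0 Tb by (intro powr_mono2) auto
      finally show ?thesis .
    qed
    have "(\<Sum>x\<in>X. T h x powr (2 / (1 + \<sigma>)) * 1 powr (1 + \<tau> * 2 / (1 + \<sigma>)))
       \<le> (\<Sum>x\<in>X. step_max 1 R (indicator E) x powr (8/5) * 1)"
      using pw by (intro sum_mono) simp
    also have "\<dots> \<le> 1 * 4 powr (3/2) / (1 - 2 powr (3/2 - 8/5)) * sum (\<lambda>_. 1) E"
      by (rule restricted_strong_type[OF _ _ Ap_bound_one _ E X R]) auto
    also have "\<dots> = K * card E" unfolding K_def by simp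
    also have "\<dots> \<le> 4 * K * card E * (2 powr of_int i) powr (1 + \<tau> * 2 / (1 + \<sigma>))"
    proof (cases "E = {}")
      case False
      then obtain y where "y \<in> E" by blast
      hence i: "1/2 \<le> (2::real) powr of_int i" "(2::real) powr of_int i \<le> 1" using lev by auto
      have "(1/2::real) powr 2 \<le> (2 powr of_int i) powr 2" using i by (intro powr_mono2) auto
      also have "\<dots> \<le> (2 powr of_int i) powr (1 + \<tau> * 2 / (1 + \<sigma>))"
      proof (rule powr_mono')
        have "3/4 \<le> 1 + \<sigma>" "\<tau> \<le> 1/4" using \<sigma> \<tau> by auto
        hence "\<tau> * 2 / (1 + \<sigma>) \<le> 1" by (simp add: divide_le_eq)
        thus "1 + \<tau> * 2 / (1 + \<sigma>) \<le> 2" by simp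
      qed (use i in auto)
      finally have "1 \<le> 4 * (2 powr of_int i) powr (1 + \<tau> * 2 / (1 + \<sigma>))" by (simp add: power_divide)
      hence "K * card E * 1 \<le> K * card E * (4 * (2 powr of_int i) powr (1 + \<tau> * 2 / (1 + \<sigma>)))"
        using K by (intro mult_left_mono) auto
      thus ?thesis by (simp only: mult_ac mult_1)
    qed simp
    finally show "(\<Sum>x\<in>X. T h x powr (2 / (1 + \<sigma>)) * 1 powr (1 + \<tau> * 2 / (1 + \<sigma>)))
       \<le> 4 * (4 powr (3/2) / (1 - 2 powr (3/2 - 8/5))) * card E * (2 powr of_int i) powr (1 + \<tau> * 2 / (1 + \<sigma>))"
      unfolding K_def .
  qed (use S X in auto)
  thus ?thesis unfolding HL_const_def T_def using T0 by (simp add: T_def)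
qed

lemma HL_const_nonneg: "0 \<le> HL_const"
proof -
  have "(2::real) powr (3/2 - 8/5) < 1" by (intro powr_less_one) auto
  thus ?thesis unfolding HL_const_def interp_const_def by simp
qed

lemma sum_residue_classes:
  fixes F :: "int \<Rightarrow> real" and d :: int
  assumes "0 < d" "finite X"
  shows "sum F X = (\<Sum>\<rho>\<in>{0..<d}. \<Sum>m\<in>(\<lambda>x. x div d) ` {x\<in>X. x mod d = \<rho>}. F (\<rho> + d * m))"
proof -
  have "sum F X = (\<Sum>\<rho>\<in>{0..<d}. sum F {x\<in>X. x mod d = \<rho>})"
    using assms by (intro sum.group[symmetric]) auto
  also have "\<dots> = (\<Sum>\<rho>\<in>{0..<d}. \<Sum>m\<in>(\<lambda>x. x div d) ` {x\<in>X. x mod d = \<rho>}. F (\<rho> + d * m))"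
  proof (rule sum.cong[OF refl])
    fix \<rho>
    have "inj_on (\<lambda>x. x div d) {x\<in>X. x mod d = \<rho>}"
      by (rule inj_onI) (metis (mono_tags, lifting) div_mult_mod_eq mem_Collect_eq)
    hence "(\<Sum>m\<in>(\<lambda>x. x div d) ` {x\<in>X. x mod d = \<rho>}. F (\<rho> + d * m))
       = (\<Sum>x\<in>{x\<in>X. x mod d = \<rho>}. F (\<rho> + d * (x div d)))"
      by (simp add: sum.reindex)
    also have "\<dots> = sum F {x\<in>X. x mod d = \<rho>}"
      by (intro sum.cong refl arg_cong[where f = F]) (auto simp: mod_mult_div_eq)
    finally show "sum F {x\<in>X. x mod d = \<rho>} = (\<Sum>m\<in>(\<lambda>x. x div d) ` {x\<in>X. x mod d = \<rho>}. F (\<rho> + d * m))" ..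
  qed
  finally show ?thesis .
qed

text \<open>
  A progression of step \<open>d\<close> stays in a residue class, and each class is a copy of the
  integers with step one, so the constant does not depend on \<open>d\<close>.
\<close>
lemma Hardy_Littlewood_l2_step:
  assumes S: "finite S" "\<And>y. y \<notin> S \<Longrightarrow> f y = 0" and X: "finite X" and R: "1 \<le> R" and d: "0 < d"
  shows "(\<Sum>x\<in>X. (step_max d R (\<lambda>y. \<bar>f y\<bar>) x)\<^sup>2) \<le> HL_const * (\<Sum>y\<in>S. (f y)\<^sup>2)"
proof -
  define Q where "Q Z \<rho> = (\<lambda>x. x div d) ` {x\<in>Z. x mod d = \<rho>}" for Z \<rho>
  have shift: "step_max d R (\<lambda>y. \<bar>f y\<bar>) (\<rho> + d * m) = step_max 1 R (\<lambda>k. \<bar>f (\<rho> + d * k)\<bar>) m" for \<rho> m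
    unfolding step_max_def step_avg_def by (simp add: algebra_simps)
  have "(\<Sum>x\<in>X. (step_max d R (\<lambda>y. \<bar>f y\<bar>) x)\<^sup>2)
      = (\<Sum>\<rho>\<in>{0..<d}. \<Sum>m\<in>Q X \<rho>. (step_max 1 R (\<lambda>k. \<bar>f (\<rho> + d * k)\<bar>) m)\<^sup>2)"
    unfolding Q_def shift[symmetric] by (rule sum_residue_classes[OF d X])
  also have "\<dots> \<le> (\<Sum>\<rho>\<in>{0..<d}. HL_const * (\<Sum>m\<in>Q S \<rho>. (f (\<rho> + d * m))\<^sup>2))"
  proof (intro sum_mono Hardy_Littlewood_l2 R)
    fix \<rho> y assume r: "\<rho> \<in> {0..<d}" and y: "y \<notin> Q S \<rho>"
    have "\<rho> + d * y \<notin> S"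
    proof
      assume "\<rho> + d * y \<in> S"
      hence "(\<rho> + d * y) div d \<in> Q S \<rho>" unfolding Q_def using r by (intro imageI) auto
      thus False using y r d by simp
    qed
    thus "f (\<rho> + d * y) = 0" by (rule S(2))
  qed (use S X in \<open>auto simp: Q_def\<close>)
  also have "\<dots> = HL_const * (\<Sum>y\<in>S. (f y)\<^sup>2)"
    unfolding sum_distrib_left[symmetric] Q_def
    by (subst sum_residue_classes[OF d S(1), where F = "\<lambda>y. (f y)\<^sup>2"]) (rule refl)
  finally show ?thesis .
qed

section \<open>Divisor moments and Ramanujan sums\<close>

definition tau :: "nat \<Rightarrow> nat" where "tau n = card {k. k dvd n}"

definition small_divisors :: "nat \<Rightarrow> nat \<Rightarrow> nat" where
  "small_divisors Q n = card {k\<in>{1..Q}. k dvd n}"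

lemma divisors_subset: "0 < n \<Longrightarrow> {k. k dvd n} \<subseteq> {1..n::nat}"
  by (auto intro: dvd_imp_le simp: Suc_le_eq dvd_pos_nat)

lemma finite_divisors [simp]: "0 < n \<Longrightarrow> finite {k. k dvd (n::nat)}"
  by simp

text \<open>
  A divisor \<open>k\<close> of \<open>d * j\<close> is determined by \<open>gcd k d\<close> and
  the cofactor, which divides \<open>j\<close> and does not exceed \<open>k\<close>.
\<close>
lemma small_divisors_mult_le:
  assumes "0 < d"
  shows "small_divisors Q (d * j) \<le> tau d * small_divisors Q j"
proof -
  define \<phi> where "\<phi> k = (gcd k d, k div gcd k d)" for k
  have "inj_on \<phi> {k\<in>{1..Q}. k dvd d * j}"
    unfolding \<phi>_def by (intro inj_onI) (metis Pair_inject dvd_mult_div_cancel gcd_dvd1)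
  moreover have "\<phi> ` {k\<in>{1..Q}. k dvd d * j} \<subseteq> {k. k dvd d} \<times> {k\<in>{1..Q}. k dvd j}"
  proof
    fix y assume "y \<in> \<phi> ` {k\<in>{1..Q}. k dvd d * j}"
    then obtain k where k: "y = \<phi> k" "1 \<le> k" "k \<le> Q" "k dvd d * j" by auto
    have g: "0 < gcd k d" using assms by simp
    have "k div gcd k d dvd (d div gcd k d) * j"
      using k(4) g by (metis dvd_div_mult gcd_dvd1 gcd_dvd2 div_dvd_div dvd_mult2)
    moreover have "coprime (k div gcd k d) (d div gcd k d)"
      using assms by (intro div_gcd_coprime) auto
    ultimately have "k div gcd k d dvd j" by (metis coprime_dvd_mult_right_iff)
    moreover have "1 \<le> k div gcd k d"
      using k(2) by (metis One_nat_def Suc_leI div_greater_zero_iff dvd_imp_le gcd_dvd1 g less_eq_Suc_le)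
    moreover have "k div gcd k d \<le> Q" using k(3) div_le_dividend le_trans by blast
    ultimately show "y \<in> {k. k dvd d} \<times> {k\<in>{1..Q}. k dvd j}" unfolding k(1) \<phi>_def by auto
  qed
  ultimately have "card {k\<in>{1..Q}. k dvd d * j} \<le> card ({k. k dvd d} \<times> {k\<in>{1..Q}. k dvd j})"
    using assms by (intro card_inj_on_le[of \<phi>]) auto
  thus ?thesis unfolding small_divisors_def tau_def by (simp add: card_cartesian_product)
qed

lemma small_divisors_eq_tau: "0 < n \<Longrightarrow> n \<le> Q \<Longrightarrow> small_divisors Q n = tau n"
  unfolding small_divisors_def tau_def using divisors_subset[of n]
  by (intro arg_cong[where f = card]) auto

lemma tau_mult_le:
  assumes "0 < a" "0 < b"
  shows "tau (a * b) \<le> tau a * tau b"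
proof -
  have "b \<le> a * b" using assms by simp
  thus ?thesis
    using small_divisors_mult_le[of a "a * b" b] assms by (simp add: small_divisors_eq_tau)
qed

lemma sum_multiples:
  fixes f :: "nat \<Rightarrow> 'a::comm_monoid_add"
  assumes "0 < d"
  shows "(\<Sum>n\<in>{n\<in>{1..N}. d dvd n}. f n) = (\<Sum>j=1..N div d. f (d * j))"
  using assms
  by (intro sum.reindex_bij_witness[of _ "\<lambda>j. d * j" "\<lambda>n. n div d"])
     (auto simp: less_eq_div_iff_mult_less_eq mult.commute div_le_mono Suc_le_eq elim!: dvdE)

lemma sum_divisors_swap:
  fixes f :: "nat \<Rightarrow> nat \<Rightarrow> 'a::comm_monoid_add"
  shows "(\<Sum>n=1..N. \<Sum>d\<in>{d\<in>{1..Q}. d dvd n}. f d n) = (\<Sum>d=1..Q. \<Sum>j=1..N div d. f d (d * j))"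
proof -
  have "(\<Sum>n=1..N. \<Sum>d\<in>{d\<in>{1..Q}. d dvd n}. f d n) = (\<Sum>d=1..Q. \<Sum>n\<in>{n\<in>{1..N}. d dvd n}. f d n)"
    by (rule sum.swap_restrict) auto
  also have "\<dots> = (\<Sum>d=1..Q. \<Sum>j=1..N div d. f d (d * j))"
    by (intro sum.cong refl sum_multiples) auto
  finally show ?thesis .
qed

text \<open>
  One factor \<open>tau d\<close> is written as a sum over factorisations
  \<open>d = a * b\<close>; submultiplicativity decouples \<open>a\<close> from \<open>b\<close>
  and squares the bound for the previous power.
\<close>
lemma sum_tau_power_le: "(\<Sum>d=1..Q. real (tau d) ^ m / d) \<le> harm Q ^ (2 ^ m)"
proof (induction m)
  case 0
  show ?case by (simp add: harm_def field_simps)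
next
  case (Suc m)
  have "(\<Sum>d=1..Q. real (tau d) ^ Suc m / d) = (\<Sum>d=1..Q. \<Sum>a\<in>{a\<in>{1..Q}. a dvd d}. real (tau d) ^ m / d)"
  proof (intro sum.cong refl)
    fix d assume d: "d \<in> {1..Q}"
    hence "real (tau d) = card {a\<in>{1..Q}. a dvd d}"
      using small_divisors_eq_tau[of d Q] unfolding small_divisors_def by simp
    thus "real (tau d) ^ Suc m / d = (\<Sum>a\<in>{a\<in>{1..Q}. a dvd d}. real (tau d) ^ m / d)" by simp
  qed
  also have "\<dots> = (\<Sum>a=1..Q. \<Sum>b=1..Q div a. real (tau (a * b)) ^ m / (a * b))"
    by (subst sum_divisors_swap) simp
  also have "\<dots> \<le> (\<Sum>a=1..Q. \<Sum>b=1..Q. (real (tau a) ^ m / a) * (real (tau b) ^ m / b))"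
  proof (intro sum_mono)
    fix a assume a: "a \<in> {1..Q}"
    have "(\<Sum>b=1..Q div a. real (tau (a * b)) ^ m / (a * b)) \<le> (\<Sum>b=1..Q div a. (real (tau a) ^ m / a) * (real (tau b) ^ m / b))"
    proof (intro sum_mono)
      fix b assume b: "b \<in> {1..Q div a}"
      have "real (tau (a * b)) \<le> real (tau a) * real (tau b)"
        using tau_mult_le[of a b] a b by (simp flip: of_nat_mult)
      hence "real (tau (a * b)) ^ m \<le> real (tau a) ^ m * real (tau b) ^ m"
        unfolding power_mult_distrib[symmetric] by (intro power_mono) auto
      hence "real (tau (a * b)) ^ m / (real a * real b) \<le> real (tau a) ^ m * real (tau b) ^ m / (real a * real b)"
        by (intro divide_right_mono) auto
      thus "real (tau (a * b)) ^ m / (a * b) \<le> (real (tau a) ^ m / a) * (real (tau b) ^ m / b)" by simp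
    qed
    also have "\<dots> \<le> (\<Sum>b=1..Q. (real (tau a) ^ m / a) * (real (tau b) ^ m / b))"
      by (intro sum_mono2) (auto intro: order_trans[OF _ div_le_dividend])
    finally show "(\<Sum>b=1..Q div a. real (tau (a * b)) ^ m / (a * b)) \<le> (\<Sum>b=1..Q. (real (tau a) ^ m / a) * (real (tau b) ^ m / b))" .
  qed
  also have "\<dots> = (\<Sum>d=1..Q. real (tau d) ^ m / d)\<^sup>2"
    by (simp only: sum_product[symmetric] power2_eq_square)
  also have "\<dots> \<le> (harm Q ^ (2 ^ m))\<^sup>2"
    by (intro power_mono Suc.IH sum_nonneg) auto
  also have "\<dots> = harm Q ^ (2 ^ Suc m)" by (simp add: power_mult[symmetric] mult.commute)
  finally show ?case .
qed

text \<open>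
  Induction on the moment: one factor is opened as a sum over \<open>d\<close>, the remaining ones
  are evaluated at multiples \<open>d * j\<close> and bounded by
  \<open>small_divisors_mult_le\<close>. The bound is linear in \<open>N\<close>, and
  \<open>Q\<close> enters only through a power of its harmonic number.
\<close>
lemma small_divisors_moment:
  "(\<Sum>n=1..N. real (small_divisors Q n) ^ m) \<le> N * harm Q ^ (2 ^ m - 1)"
proof (induction m arbitrary: N)
  case (Suc m)
  have "(\<Sum>n=1..N. real (small_divisors Q n) ^ Suc m)
      = (\<Sum>n=1..N. \<Sum>d\<in>{d\<in>{1..Q}. d dvd n}. real (small_divisors Q n) ^ m)"
    by (intro sum.cong refl) (simp add: small_divisors_def)
  also have "\<dots> = (\<Sum>d=1..Q. \<Sum>j=1..N div d. real (small_divisors Q (d * j)) ^ m)"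
    by (rule sum_divisors_swap)
  also have "\<dots> \<le> (\<Sum>d=1..Q. real (tau d) ^ m / d * (N * harm Q ^ (2 ^ m - 1)))"
  proof (intro sum_mono)
    fix d assume d: "d \<in> {1..Q}"
    have "(\<Sum>j=1..N div d. real (small_divisors Q (d * j)) ^ m)
        \<le> (\<Sum>j=1..N div d. real (tau d) ^ m * real (small_divisors Q j) ^ m)"
    proof (intro sum_mono)
      fix j
      have "real (small_divisors Q (d * j)) \<le> real (tau d) * real (small_divisors Q j)"
        using small_divisors_mult_le[of d Q j] d by (simp flip: of_nat_mult)
      thus "real (small_divisors Q (d * j)) ^ m \<le> real (tau d) ^ m * real (small_divisors Q j) ^ m"
        unfolding power_mult_distrib[symmetric] by (intro power_mono) auto
    qed
    also have "\<dots> \<le> real (tau d) ^ m * (real (N div d) * harm Q ^ (2 ^ m - 1))"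
      unfolding sum_distrib_left[symmetric] by (intro mult_left_mono Suc.IH) auto
    also have "\<dots> \<le> real (tau d) ^ m * ((N / d) * harm Q ^ (2 ^ m - 1))"
      by (intro mult_left_mono mult_right_mono of_nat_div_le_of_nat zero_le_power harm_nonneg) auto
    finally show "(\<Sum>j=1..N div d. real (small_divisors Q (d * j)) ^ m)
        \<le> real (tau d) ^ m / d * (N * harm Q ^ (2 ^ m - 1))" by simp
  qed
  also have "\<dots> = (\<Sum>d=1..Q. real (tau d) ^ m / d) * (N * harm Q ^ (2 ^ m - 1))"
    by (simp only: sum_distrib_right)
  also have "\<dots> \<le> harm Q ^ (2 ^ m) * (N * harm Q ^ (2 ^ m - 1))"
    by (intro mult_right_mono sum_tau_power_le mult_nonneg_nonneg zero_le_power harm_nonneg) auto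
  also have "\<dots> = N * harm Q ^ (2 ^ m + (2 ^ m - 1))" unfolding power_add by (simp only: mult_ac)
  also have "(2::nat) ^ m + (2 ^ m - 1) = 2 ^ Suc m - 1"
  proof -
    have "(1::nat) \<le> 2 ^ m" by simp
    thus ?thesis by (simp only: power_Suc)
  qed
  finally show ?case .
qed simp

lemma harm_pow2_le: "harm (2 ^ m) \<le> real m + 1"
proof (induction m)
  case (Suc m)
  have "harm (2 ^ Suc m) = harm (2 ^ m) + (\<Sum>k\<in>{2^m<..2^Suc m}. inverse (real k))"
  proof -
    have eq: "{1..2 ^ Suc m} = {1..2^m} \<union> {2^m<..2^Suc m::nat}" by auto
    show ?thesis unfolding harm_def eq by (subst sum.union_disjoint) auto
  qed
  also have "(\<Sum>k\<in>{2^m<..2^Suc m}. inverse (real k)) \<le> (\<Sum>k\<in>{(2::nat)^m<..2^Suc m}. inverse (2 ^ m))"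
  proof (intro sum_mono le_imp_inverse_le)
    fix k :: nat assume "k \<in> {2^m<..2^Suc m}"
    hence "2 ^ m \<le> k" by auto
    thus "2 ^ m \<le> real k" by (metis of_nat_le_iff of_nat_numeral of_nat_power)
  qed auto
  also have "\<dots> = 1" by (simp add: field_simps)
  finally show ?case using Suc by simp
qed (simp add: harm_def)

lemma harm_pow2_ge: "real m / 2 + 1 \<le> harm (2 ^ m)"
proof (induction m)
  case (Suc m)
  define S where "S = (\<Sum>k\<in>{2^m<..2^Suc m}. inverse (real k))"
  have 1: "harm (2 ^ Suc m) = harm (2 ^ m) + S"
  proof -
    have eq: "{1..2 ^ Suc m} = {1..2^m} \<union> {2^m<..2^Suc m::nat}" by auto
    show ?thesis unfolding harm_def eq S_def by (subst sum.union_disjoint) auto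
  qed
  have "(\<Sum>k\<in>{(2::nat)^m<..2^Suc m}. inverse (2 ^ Suc m)) \<le> S"
    unfolding S_def
  proof (intro sum_mono le_imp_inverse_le)
    fix k :: nat assume "k \<in> {2^m<..2^Suc m}"
    hence k: "k \<le> 2 ^ Suc m" "0 < k" by auto
    show "real k \<le> 2 ^ Suc m" using k(1) by (metis of_nat_le_iff of_nat_numeral of_nat_power)
    show "0 < real k" using k(2) by simp
  qed
  moreover have "(\<Sum>k\<in>{(2::nat)^m<..2^Suc m}. inverse (2 ^ Suc m)) = (1/2::real)" by (simp add: field_simps)
  ultimately have "1/2 \<le> S" by simp
  thus ?case using Suc.IH 1 by (simp add: add_divide_distrib)
qed (simp add: harm_def)

text \<open>
  In each pair of complementary divisors one has square at most \<open>n\<close>.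
\<close>
lemma tau_le_twice_small:
  assumes "0 < n"
  shows "tau n \<le> 2 * card {k. k dvd n \<and> k * k \<le> n}"
proof -
  define A where "A = {k. k dvd n \<and> k * k \<le> n}"
  have fin: "finite A" unfolding A_def using finite_divisors[OF assms] by (rule rev_finite_subset) auto
  have "{k. k dvd n} \<subseteq> A \<union> (\<lambda>k. n div k) ` A"
  proof
    fix k assume "k \<in> {k. k dvd n}"
    hence k: "k dvd n" by simp
    then obtain m where m: "n = k * m" by (elim dvdE)
    show "k \<in> A \<union> (\<lambda>k. n div k) ` A"
    proof (cases "k * k \<le> n")
      case False
      hence "m < k" using m assms by auto
      hence "m \<in> A" unfolding A_def m by auto
      moreover have "k = n div m" using m assms by auto
      ultimately show ?thesis by blast
    qed (use k in \<open>auto simp: A_def\<close>)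
  qed
  hence "tau n \<le> card (A \<union> (\<lambda>k. n div k) ` A)" unfolding tau_def using fin by (intro card_mono) auto
  also have "\<dots> \<le> card A + card ((\<lambda>k. n div k) ` A)" by (rule card_Un_le)
  also have "\<dots> \<le> card A + card A" using fin card_image_le by auto
  finally show ?thesis unfolding A_def by simp
qed

lemma tau_le_small_divisors:
  assumes "0 < n" "n \<le> M * M"
  shows "tau n \<le> 2 * small_divisors M n"
proof -
  have "card {k. k dvd n \<and> k * k \<le> n} \<le> small_divisors M n"
    unfolding small_divisors_def
  proof (intro card_mono)
    show "{k. k dvd n \<and> k * k \<le> n} \<subseteq> {k \<in> {1..M}. k dvd n}"
    proof safe
      fix k assume k: "k dvd n" "k * k \<le> n"
      have "k * k \<le> M * M" using k assms by linarith
      hence "k \<le> M" by (meson linorder_not_le mult_strict_mono' zero_le)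
      moreover have "1 \<le> k" using k assms by (auto simp: Suc_le_eq intro: dvd_pos_nat)
      ultimately show "k \<in> {1..M}" by simp
    qed
  qed auto
  thus ?thesis using tau_le_twice_small[OF assms(1)] by linarith
qed

lemma tau_le_sqrt:
  assumes "0 < n" shows "real (tau n) \<le> 2 * sqrt n"
proof -
  have "{k. k dvd n \<and> k * k \<le> n} \<subseteq> {1..nat \<lfloor>sqrt n\<rfloor>}"
  proof safe
    fix k assume k: "k dvd n" "k * k \<le> n"
    have "real k * real k \<le> n" using k(2) by (metis of_nat_le_iff of_nat_mult)
    hence "real k \<le> sqrt n" by (intro real_le_rsqrt) (simp add: power2_eq_square)
    moreover have "1 \<le> k" using k assms by (auto simp: Suc_le_eq intro: dvd_pos_nat)
    ultimately show "k \<in> {1..nat \<lfloor>sqrt n\<rfloor>}" by (auto simp: le_nat_floor)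
  qed
  hence "card {k. k dvd n \<and> k * k \<le> n} \<le> card {1..nat \<lfloor>sqrt n\<rfloor>}" by (intro card_mono) auto
  also have "\<dots> = nat \<lfloor>sqrt n\<rfloor>" by simp
  finally have "real (card {k. k dvd n \<and> k * k \<le> n}) \<le> real (nat \<lfloor>sqrt n\<rfloor>)" by linarith
  also have "\<dots> \<le> sqrt n" by (intro of_nat_floor) auto
  finally have "real (card {k. k dvd n \<and> k * k \<le> n}) \<le> sqrt n" .
  moreover have "real (tau n) \<le> 2 * real (card {k. k dvd n \<and> k * k \<le> n})"
    using tau_le_twice_small[OF assms] by linarith
  ultimately show ?thesis by linarith
qed

lemma divisor_fun_eq_tau: "divisor_fun n = tau n"
  unfolding divisor_fun_def tau_def by simp

lemma divisor_sum_ge: "real (divisor_sum N) \<ge> N * harm N / 2"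
proof -
  have "divisor_sum N = (\<Sum>n=1..N. \<Sum>d\<in>{d\<in>{1..N}. d dvd n}. 1)"
    unfolding divisor_sum_def divisor_fun_eq_tau
  proof (intro sum.cong refl)
    fix n assume "n \<in> {1..N}"
    thus "tau n = (\<Sum>d\<in>{d\<in>{1..N}. d dvd n}. 1)"
      using small_divisors_eq_tau[of n N] unfolding small_divisors_def by simp
  qed
  also have "\<dots> = (\<Sum>d=1..N. N div d)" by (subst sum_divisors_swap) simp
  finally have "real (divisor_sum N) = (\<Sum>d=1..N. real (N div d))" by simp
  also have "\<dots> \<ge> (\<Sum>d=1..N. N * inverse (real d) / 2)"
  proof (intro sum_mono)
    fix d assume d: "d \<in> {1..N}"
    have "N < d * (N div d) + d" using d by (metis atLeastAtMost_iff dividend_less_times_div mult.commute add.commute less_eq_Suc_le One_nat_def)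
    moreover have "d \<le> d * (N div d)" using d by (simp add: div_greater_zero_iff Suc_le_eq)
    ultimately have "N \<le> 2 * (d * (N div d))" by linarith
    hence "real N \<le> 2 * (real d * real (N div d))" by (metis of_nat_le_iff of_nat_mult of_nat_numeral)
    thus "N * inverse (real d) / 2 \<le> real (N div d)" using d by (simp add: field_simps)
  qed
  finally show ?thesis by (simp add: harm_def sum_distrib_left sum_divide_distrib)
qed

definition moebius :: "nat \<Rightarrow> int" where
  "moebius n = (if squarefree n then (-1) ^ card (prime_factors n) else 0)"

lemma moebius_abs: "\<bar>moebius n\<bar> \<le> 1"
  unfolding moebius_def by auto

text \<open>
  Squarefree divisors are paired as \<open>d\<close> and \<open>p * d\<close> for a prime
  \<open>p\<close> dividing \<open>n\<close>; the two have opposite signs.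
\<close>
lemma sum_moebius:
  assumes "0 < n"
  shows "(\<Sum>d | d dvd n. moebius d) = (if n = 1 then 1 else 0)"
proof (cases "n = 1")
  case True
  thus ?thesis by (simp add: moebius_def)
next
  case False
  then obtain p where p: "prime p" "p dvd n" using prime_factor_nat[of n] by blast
  define D where "D = {d. d dvd n \<and> squarefree d \<and> \<not> p dvd d}"
  have fin: "finite D" unfolding D_def using finite_divisors[OF assms] by (rule rev_finite_subset) auto
  have inj: "inj_on (\<lambda>d. p * d) D" using p by (auto simp: inj_on_def)
  have cop: "coprime p d" if "\<not> p dvd d" for d using p that by (metis prime_imp_coprime)
  have split: "{d. d dvd n \<and> squarefree d} = D \<union> (\<lambda>d. p * d) ` D"
  proof (intro equalityI subsetI)
    fix d assume d: "d \<in> {d. d dvd n \<and> squarefree d}"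
    show "d \<in> D \<union> (\<lambda>d. p * d) ` D"
    proof (cases "p dvd d")
      case True
      then obtain k where k: "d = p * k" by (elim dvdE)
      have "squarefree k" using d k squarefree_multD(2) by auto
      moreover have "\<not> p dvd k"
      proof
        assume "p dvd k"
        hence "p\<^sup>2 dvd d" unfolding k power2_eq_square by auto
        thus False using d p unfolding squarefree_def by auto
      qed
      moreover have "k dvd n" using d k dvd_mult_right by auto
      ultimately show ?thesis unfolding k D_def by auto
    qed (use d in \<open>auto simp: D_def\<close>)
  next
    fix d assume "d \<in> D \<union> (\<lambda>d. p * d) ` D"
    thus "d \<in> {d. d dvd n \<and> squarefree d}"
      using p cop squarefree_mult_coprime[OF _ squarefree_prime[OF p(1)]]
      by (auto simp: D_def intro: divides_mult)
  qed
  have neg: "moebius (p * d) = - moebius d" if d: "d \<in> D" for d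
  proof -
    have d0: "d \<noteq> 0" using d assms unfolding D_def by auto
    have "p * d \<in> {d. d dvd n \<and> squarefree d}" using split d by blast
    hence sq: "squarefree (p * d)" by simp
    have "prime_factors (p * d) = insert p (prime_factors d)"
      using p d0 by (simp add: prime_factors_product prime_prime_factors)
    moreover have "p \<notin> prime_factors d" using d unfolding D_def by auto
    ultimately show ?thesis using sq d unfolding moebius_def D_def by simp
  qed
  have "(\<Sum>d | d dvd n. moebius d) = (\<Sum>d\<in>{d. d dvd n \<and> squarefree d}. moebius d)"
    using finite_divisors[OF assms] by (intro sum.mono_neutral_right) (auto simp: moebius_def)
  also have "\<dots> = sum moebius D + sum moebius ((\<lambda>d. p * d) ` D)"
    unfolding split using fin by (intro sum.union_disjoint) (auto simp: D_def)
  also have "sum moebius ((\<lambda>d. p * d) ` D) = (\<Sum>d\<in>D. - moebius d)"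
    using inj neg by (simp add: sum.reindex)
  finally show ?thesis using False by (simp add: sum_negf)
qed

text \<open>
  The divisor form of the Ramanujan sum is taken as the definition because it shows the size at
  once; the exponential form is \<open>ramanujan_sum_echar\<close>.
\<close>
definition ramanujan_sum :: "nat \<Rightarrow> int \<Rightarrow> real" where
  "ramanujan_sum q n = (\<Sum>d | d dvd q \<and> int d dvd n. real d * of_int (moebius (q div d)))"

lemma ramanujan_sum_bound:
  assumes "0 < q"
  shows "\<bar>ramanujan_sum q n\<bar> \<le> (\<Sum>d | d dvd q \<and> int d dvd n. real d)"
proof -
  have "\<bar>ramanujan_sum q n\<bar> \<le> (\<Sum>d | d dvd q \<and> int d dvd n. \<bar>real d * of_int (moebius (q div d))\<bar>)"
    unfolding ramanujan_sum_def by (rule sum_abs)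
  also have "\<dots> \<le> (\<Sum>d | d dvd q \<and> int d dvd n. real d)"
  proof (intro sum_mono)
    fix d
    have "real_of_int \<bar>moebius (q div d)\<bar> \<le> real_of_int 1" using moebius_abs by (intro of_int_le_iff[THEN iffD2])
    thus "\<bar>real d * of_int (moebius (q div d))\<bar> \<le> real d" by (simp add: abs_mult mult_left_le)
  qed
  finally show ?thesis .
qed

lemma sum_ramanujan_sum:
  assumes "0 < k"
  shows "(\<Sum>q | q dvd k. ramanujan_sum q n) = (if int k dvd n then real k else 0)"
proof -
  have fin: "finite {q. q dvd k}" by (rule finite_divisors[OF assms])
  have "(\<Sum>q | q dvd k. ramanujan_sum q n)
     = (\<Sum>q | q dvd k. \<Sum>d\<in>{d. d dvd k \<and> d dvd q \<and> int d dvd n}. real d * of_int (moebius (q div d)))"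
    unfolding ramanujan_sum_def by (intro sum.cong refl) (auto intro: dvd_trans)
  also have "\<dots> = (\<Sum>q\<in>{q. q dvd k}. \<Sum>d\<in>{d\<in>{d. d dvd k \<and> int d dvd n}. d dvd q}. real d * of_int (moebius (q div d)))"
    by (intro sum.cong refl) auto
  also have "\<dots> = (\<Sum>d\<in>{d. d dvd k \<and> int d dvd n}. \<Sum>q\<in>{q\<in>{q. q dvd k}. d dvd q}. real d * of_int (moebius (q div d)))"
    using fin by (intro sum.swap_restrict) (auto intro: rev_finite_subset)
  also have "\<dots> = (\<Sum>d\<in>{d. d dvd k \<and> int d dvd n}. real d * of_int (\<Sum>e | e dvd k div d. moebius e))"
  proof (intro sum.cong refl)
    fix d assume "d \<in> {d. d dvd k \<and> int d dvd n}"
    hence d: "d dvd k" "0 < d" using assms by (auto intro: dvd_pos_nat)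
    have "(\<Sum>q\<in>{q\<in>{q. q dvd k}. d dvd q}. moebius (q div d)) = (\<Sum>e | e dvd k div d. moebius e)"
      using d by (intro sum.reindex_bij_witness[of _ "\<lambda>e. d * e" "\<lambda>q. q div d"])
        (auto simp: div_dvd_div dvd_div_iff_mult mult.commute)
    thus "(\<Sum>q\<in>{q\<in>{q. q dvd k}. d dvd q}. real d * of_int (moebius (q div d))) = real d * of_int (\<Sum>e | e dvd k div d. moebius e)"
      by (simp add: sum_distrib_left[symmetric] flip: of_int_sum)
  qed
  also have "\<dots> = (\<Sum>d\<in>{d. d dvd k \<and> int d dvd n}. if d = k then real d else 0)"
  proof (intro sum.cong refl)
    fix d assume "d \<in> {d. d dvd k \<and> int d dvd n}"
    hence d: "d dvd k" "0 < d" using assms by (auto intro: dvd_pos_nat)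
    have "0 < k div d" using d assms by (simp add: dvd_imp_le div_greater_zero_iff)
    moreover have "k div d = 1 \<longleftrightarrow> d = k" using d assms by (auto elim!: dvdE)
    ultimately show "real d * of_int (\<Sum>e | e dvd k div d. moebius e) = (if d = k then real d else 0)"
      by (simp add: sum_moebius)
  qed
  also have "\<dots> = (if int k dvd n then real k else 0)"
    using fin by (subst sum.delta) (auto intro: rev_finite_subset)
  finally show ?thesis .
qed

text \<open>
  The indicator of \<open>k dvd n\<close> is \<open>1 / k\<close> times the sum of the Ramanujan
  sums of the divisors of \<open>k\<close>; collecting the coefficient of each modulus gives
  harmonic numbers.
\<close>
lemma small_divisors_ramanujan:
  "real (small_divisors M n) = (\<Sum>q=1..M. ramanujan_sum q (int n) / q * harm (M div q))"
proof -
  have "real (small_divisors M n) = (\<Sum>k=1..M. if k dvd n then 1 else 0)"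
    unfolding small_divisors_def by (simp add: sum.If_cases Int_def)
  also have "\<dots> = (\<Sum>k=1..M. \<Sum>q\<in>{q\<in>{1..M}. q dvd k}. ramanujan_sum q (int n) / k)"
  proof (intro sum.cong refl)
    fix k assume k: "k \<in> {1..M}"
    hence "{q\<in>{1..M}. q dvd k} = {q. q dvd k}" using divisors_subset[of k] by auto
    thus "(if k dvd n then 1 else 0) = (\<Sum>q\<in>{q\<in>{1..M}. q dvd k}. ramanujan_sum q (int n) / k)"
      using k sum_ramanujan_sum[of k "int n"] by (simp flip: sum_divide_distrib)
  qed
  also have "\<dots> = (\<Sum>q=1..M. \<Sum>j=1..M div q. ramanujan_sum q (int n) / (q * j))"
    by (subst sum_divisors_swap) simp
  also have "\<dots> = (\<Sum>q=1..M. ramanujan_sum q (int n) / q * harm (M div q))"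
    by (simp add: harm_def sum_distrib_left divide_inverse mult_ac)
  finally show ?thesis .
qed

text \<open>
  Each \<open>\<bar>c\<^sub>q(n)\<bar>\<close> is at most the sum of the common divisors of
  \<open>q\<close> and \<open>n\<close>, and a given \<open>d\<close> divides at most
  \<open>2 ^ (s + 1) / d\<close> moduli of the block, which compensates the factor
  \<open>d / 2 ^ s\<close>.
\<close>
lemma ramanujan_block_bound:
  assumes \<gamma>: "\<And>q. \<bar>\<gamma> q\<bar> \<le> 1"
  shows "\<bar>\<Sum>q\<in>{2^s..<2^Suc s}. \<gamma> q * ramanujan_sum q (int n) / q\<bar> \<le> 2 * small_divisors (2 ^ Suc s) n"
proof -
  define Q where "Q = {(2::nat)^s..<2^Suc s}"
  have Q: "0 < q" "2 ^ s \<le> real q" "q \<le> 2 ^ Suc s" if "q \<in> Q" for q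
  proof -
    have q: "2 ^ s \<le> q" "q \<le> 2 ^ Suc s" using that unfolding Q_def by auto
    have "(0::nat) < 2 ^ s" by simp
    thus "0 < q" using q(1) by linarith
    show "2 ^ s \<le> real q" using q(1) by (metis of_nat_le_iff of_nat_numeral of_nat_power)
  qed (use that in \<open>auto simp: Q_def\<close>)
  have "\<bar>\<Sum>q\<in>Q. \<gamma> q * ramanujan_sum q (int n) / q\<bar> \<le> (\<Sum>q\<in>Q. \<bar>\<gamma> q * ramanujan_sum q (int n) / q\<bar>)"
    by (rule sum_abs)
  also have "\<dots> \<le> (\<Sum>q\<in>Q. \<Sum>d\<in>{d\<in>{d\<in>{1..2^Suc s}. d dvd n}. d dvd q}. real d / 2 ^ s)"
  proof (intro sum_mono)
    fix q assume q: "q \<in> Q"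
    have "\<bar>\<gamma> q * ramanujan_sum q (int n) / q\<bar> \<le> 1 * \<bar>ramanujan_sum q (int n)\<bar> / 2 ^ s"
    proof -
      have 1: "\<bar>\<gamma> q\<bar> * \<bar>ramanujan_sum q (int n)\<bar> \<le> 1 * \<bar>ramanujan_sum q (int n)\<bar>"
        by (rule mult_right_mono[OF \<gamma>]) simp
      have 2: "(0::real) \<le> 1 * \<bar>ramanujan_sum q (int n)\<bar>" by simp
      have 3: "(0::real) < 2 ^ s" by simp
      show ?thesis
        using frac_le[OF 2 1 3 Q(2)[OF q]] by (simp only: abs_mult abs_divide abs_of_nat)
    qed
    also have "\<dots> \<le> (\<Sum>d\<in>{d\<in>{d\<in>{1..2^Suc s}. d dvd n}. d dvd q}. real d) / 2 ^ s"
    proof (intro divide_right_mono)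
      have "d \<in> {1..2^Suc s}" if "d dvd q" for d
      proof -
        have "d \<in> {1..q}" using that divisors_subset[OF Q(1)[OF q]] by blast
        thus ?thesis using Q(3)[OF q] by simp
      qed
      hence "{d. d dvd q \<and> int d dvd int n} = {d\<in>{d\<in>{1..2^Suc s}. d dvd n}. d dvd q}"
        by (auto simp del: atLeastAtMost_iff)
      thus "1 * \<bar>ramanujan_sum q (int n)\<bar> \<le> (\<Sum>d\<in>{d\<in>{d\<in>{1..2^Suc s}. d dvd n}. d dvd q}. real d)"
        using ramanujan_sum_bound[OF Q(1)[OF q], of "int n"] by (simp only: mult_1)
    qed auto
    finally show "\<bar>\<gamma> q * ramanujan_sum q (int n) / q\<bar> \<le> (\<Sum>d\<in>{d\<in>{d\<in>{1..2^Suc s}. d dvd n}. d dvd q}. real d / 2 ^ s)"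
      by (simp only: sum_divide_distrib)
  qed
  also have "\<dots> = (\<Sum>d\<in>{d\<in>{1..2^Suc s}. d dvd n}. \<Sum>q\<in>{q\<in>Q. d dvd q}. real d / 2 ^ s)"
    by (rule sum.swap_restrict) (auto simp: Q_def)
  also have "\<dots> \<le> (\<Sum>d\<in>{d\<in>{1..2^Suc s}. d dvd n}. 2)"
  proof (intro sum_mono)
    fix d assume "d \<in> {d\<in>{1..2^Suc s}. d dvd n}"
    hence d: "0 < d" by auto
    have "card {q\<in>Q. d dvd q} \<le> card {q\<in>{1..2^Suc s}. d dvd q}"
      using Q(1,3) by (intro card_mono) (auto simp: Suc_le_eq)
    also have "\<dots> = 2^Suc s div d" using sum_multiples[OF d, where N = "2^Suc s" and f = "\<lambda>_. 1::nat"] by simp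
    finally have "real (card {q\<in>Q. d dvd q}) \<le> real (2^Suc s div d)" by linarith
    also have "\<dots> \<le> real (2 ^ Suc s) / d" by (rule of_nat_div_le_of_nat)
    finally have "real (card {q\<in>Q. d dvd q}) * (real d / 2 ^ s) \<le> real (2 ^ Suc s) / d * (real d / 2 ^ s)"
      by (intro mult_right_mono) auto
    thus "(\<Sum>q\<in>{q\<in>Q. d dvd q}. real d / 2 ^ s) \<le> 2" using d by simp
  qed
  also have "\<dots> = 2 * small_divisors (2 ^ Suc s) n" unfolding small_divisors_def by simp
  finally show ?thesis unfolding Q_def by simp
qed

section \<open>Fourier multipliers and separated frequencies\<close>

definition echar :: "real \<Rightarrow> complex" where "echar t = cis (2 * pi * t)"

lemma echar_add: "echar (s + t) = echar s * echar t"
  unfolding echar_def by (simp add: cis_mult distrib_left)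

lemma echar_0 [simp]: "echar 0 = 1"
  unfolding echar_def by simp

lemma norm_echar [simp]: "cmod (echar t) = 1"
  unfolding echar_def by simp

lemma cnj_echar: "cnj (echar t) = echar (- t)"
  unfolding echar_def by (simp add: cis_cnj)

lemma echar_power: "echar (real n * t) = echar t ^ n"
  by (simp only: echar_def Complex.DeMoivre mult_ac)

lemma echar_int [simp]: "echar (of_int k) = 1"
  unfolding echar_def by simp

lemma echar_eq_1_iff: "echar t = 1 \<longleftrightarrow> t \<in> \<int>"
proof
  assume "echar t = 1"
  then obtain n :: int where "2 * pi * t = of_int (2 * n) * pi"
    unfolding echar_def cis_conv_exp exp_eq_1 by auto
  hence "t = of_int n" by simp
  thus "t \<in> \<int>" by simp
qed (auto elim: Ints_cases)

lemma echar_frac: "echar (frac t) = echar t"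
proof -
  have "echar t = echar (frac t + of_int \<lfloor>t\<rfloor>)" by (simp add: frac_def)
  thus ?thesis by (simp add: echar_add)
qed

lemma sum_swap3:
  "(\<Sum>l\<in>L. \<Sum>a\<in>A. \<Sum>b\<in>B. f l a b) = (\<Sum>a\<in>A. \<Sum>b\<in>B. \<Sum>l\<in>L. f l a b)"
  by (rule trans[OF sum.swap]) (intro sum.cong refl sum.swap)

lemma sum_geometric_shift:
  fixes z :: complex
  shows "(\<Sum>l=1..N. z ^ l) * (z - 1) = z * (z ^ N - 1)"
  by (induction N) (auto simp: algebra_simps)

lemma sum_roots_of_unity:
  assumes "0 < q"
  shows "(\<Sum>l=1..q * k. echar (of_int n * real l / q)) = (if int q dvd n then of_nat (q * k) else 0)"
proof -
  define z where "z = echar (of_int n / q)"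
  have zl: "echar (of_int n * real l / q) = z ^ l" for l
    unfolding z_def echar_power[symmetric] by (simp add: mult.commute)
  have z1: "z = 1 \<longleftrightarrow> int q dvd n"
  proof -
    have "of_int n / real q \<in> \<int> \<longleftrightarrow> int q dvd n"
    proof
      assume "of_int n / real q \<in> \<int>"
      then obtain m where "of_int n / real q = of_int m" by (elim Ints_cases)
      hence "real_of_int n = real_of_int (int q * m)" using assms by (simp add: field_simps)
      hence "n = int q * m" by (simp only: of_int_eq_iff)
      thus "int q dvd n" by simp
    next
      assume "int q dvd n"
      then obtain m where "n = int q * m" by (elim dvdE)
      thus "of_int n / real q \<in> \<int>" using assms by simp
    qed
    thus ?thesis unfolding z_def echar_eq_1_iff .
  qed
  show ?thesis
  proof (cases "int q dvd n")
    case True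
    thus ?thesis unfolding zl using z1 by simp
  next
    case False
    have "z ^ q = 1" unfolding z_def echar_power[symmetric] using assms by simp
    hence "z ^ (q * k) = 1" by (simp add: power_mult)
    hence "(\<Sum>l=1..q * k. z ^ l) * (z - 1) = 0"
      by (simp only: sum_geometric_shift diff_self mult_zero_right)
    hence "(\<Sum>l=1..q * k. z ^ l) = 0" using False z1 by (simp only: mult_eq_0_iff) simp
    thus ?thesis unfolding zl using False by (simp only: if_False)
  qed
qed

lemma sum_roots_of_unity_lessThan:
  assumes "0 < q"
  shows "(\<Sum>b<q. echar (of_int n * real b / q)) = (if int q dvd n then of_nat q else 0)"
proof -
  have "(\<Sum>b<q. echar (of_int n * real b / q)) = (\<Sum>b=1..q * 1. echar (of_int n * real b / q))"
  proof (rule sum.reindex_bij_witness[of _ "\<lambda>b. if b = q then 0 else b" "\<lambda>b. if b = 0 then q else b"])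
    fix b assume "b \<in> {..<q}"
    show "echar (of_int n * real (if b = 0 then q else b) / q) = echar (of_int n * real b / q)"
      using assms by simp
  qed (use assms in auto)
  thus ?thesis using sum_roots_of_unity[OF assms, of n 1] by simp
qed

text \<open>
  Coprimality of \<open>a\<close> and \<open>q\<close> is detected by the Moebius function, and the
  inner sums over multiples are complete sums of roots of unity.
\<close>
lemma ramanujan_sum_echar:
  assumes "0 < q"
  shows "complex_of_real (ramanujan_sum q n) = (\<Sum>a\<in>{a\<in>{..<q}. coprime a q}. echar (of_int n * real a / q))"
proof -
  define t where "t a = echar (of_int n * real a / q)" for a :: nat
  have fin: "finite {d. d dvd q}" by (rule finite_divisors[OF assms])
  have "(\<Sum>a\<in>{a\<in>{..<q}. coprime a q}. t a) = (\<Sum>a<q. if coprime a q then t a else 0)"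
    by (subst sum.inter_filter) auto
  also have "\<dots> = (\<Sum>a<q. \<Sum>d\<in>{d\<in>{d. d dvd q}. d dvd a}. of_int (moebius d) * t a)"
  proof (intro sum.cong refl)
    fix a assume "a \<in> {..<q}"
    have "0 < gcd a q" using assms by simp
    have "{d\<in>{d. d dvd q}. d dvd a} = {d. d dvd gcd a q}" by auto
    hence "(\<Sum>d\<in>{d\<in>{d. d dvd q}. d dvd a}. of_int (moebius d) * t a) = of_int (\<Sum>d | d dvd gcd a q. moebius d) * t a"
      by (simp add: sum_distrib_right)
    also have "\<dots> = (if coprime a q then t a else 0)"
      using sum_moebius[OF \<open>0 < gcd a q\<close>] by (simp add: coprime_iff_gcd_eq_1)
    finally show "(if coprime a q then t a else 0) = (\<Sum>d\<in>{d\<in>{d. d dvd q}. d dvd a}. of_int (moebius d) * t a)" ..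
  qed
  also have "\<dots> = (\<Sum>d | d dvd q. \<Sum>a\<in>{a\<in>{..<q}. d dvd a}. of_int (moebius d) * t a)"
    using fin by (intro sum.swap_restrict) auto
  also have "\<dots> = (\<Sum>d | d dvd q. of_int (moebius d) * (if int (q div d) dvd n then of_nat (q div d) else 0))"
  proof (intro sum.cong refl)
    fix d assume "d \<in> {d. d dvd q}"
    then obtain m where m: "q = d * m" by (auto elim: dvdE)
    have dm: "0 < d" "0 < m" using assms m by auto
    have "(\<Sum>a\<in>{a\<in>{..<q}. d dvd a}. t a) = (\<Sum>b<m. t (d * b))"
      unfolding m using dm by (intro sum.reindex_bij_witness[of _ "\<lambda>b. d * b" "\<lambda>a. a div d"]) (auto elim!: dvdE)
    also have "\<dots> = (\<Sum>b<m. echar (of_int n * real b / m))"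
      unfolding t_def m using dm by (intro sum.cong refl arg_cong[where f = echar]) (simp add: field_simps)
    also have "\<dots> = (if int m dvd n then of_nat m else 0)" by (rule sum_roots_of_unity_lessThan[OF dm(2)])
    also have "m = q div d" using m dm by simp
    finally show "(\<Sum>a\<in>{a\<in>{..<q}. d dvd a}. of_int (moebius d) * t a)
       = of_int (moebius d) * (if int (q div d) dvd n then of_nat (q div d) else 0)"
      by (simp add: sum_distrib_left[symmetric])
  qed
  also have "\<dots> = (\<Sum>e | e dvd q. of_int (moebius (q div e)) * (if int e dvd n then of_nat e else 0))"
    using assms by (intro sum.reindex_bij_witness[of _ "\<lambda>e. q div e" "\<lambda>d. q div d"])
      (auto simp: div_dvd_iff_mult elim!: dvdE)
  also have "\<dots> = (\<Sum>e | e dvd q \<and> int e dvd n. of_int (moebius (q div e)) * of_nat e)"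
  proof -
    have "{e. e dvd q \<and> int e dvd n} = {e \<in> {e. e dvd q}. int e dvd n}" by auto
    thus ?thesis by (simp only: sum.inter_filter[OF fin]) (auto intro!: sum.cong)
  qed
  finally show ?thesis unfolding t_def ramanujan_sum_def by (simp add: mult.commute)
qed

text \<open>
  Convolution over full periods: distinct frequencies \<open>a / q\<close> and
  \<open>b / q\<close> are orthogonal, so the Ramanujan sum is idempotent up to the length.
\<close>
lemma ramanujan_sum_convolution:
  assumes "0 < q"
  shows "(\<Sum>l=1..q * k. ramanujan_sum q (int l) * ramanujan_sum q (m - int l)) = real (q * k) * ramanujan_sum q m"
proof -
  define R where "R = {a\<in>{..<q}. coprime a q}"
  have fR: "finite R" unfolding R_def by simp
  have "complex_of_real (\<Sum>l=1..q * k. ramanujan_sum q (int l) * ramanujan_sum q (m - int l))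
     = (\<Sum>l=1..q * k. \<Sum>a\<in>R. \<Sum>b\<in>R. echar (of_int m * real b / q) * echar (of_int (int a - int b) * real l / q))"
    unfolding of_real_sum of_real_mult ramanujan_sum_echar[OF assms] R_def[symmetric] sum_product
  proof (intro sum.cong refl)
    fix l a b
    show "echar (of_int (int l) * real a / q) * echar (of_int (m - int l) * real b / q)
       = echar (of_int m * real b / q) * echar (of_int (int a - int b) * real l / q)"
      unfolding echar_add[symmetric] using assms by (intro arg_cong[where f = echar]) (simp add: field_simps)
  qed
  also have "\<dots> = (\<Sum>a\<in>R. \<Sum>b\<in>R. \<Sum>l=1..q * k. echar (of_int m * real b / q) * echar (of_int (int a - int b) * real l / q))"
    by (rule sum_swap3)
  also have "\<dots> = (\<Sum>a\<in>R. \<Sum>b\<in>R. if a = b then echar (of_int m * real b / q) * of_nat (q * k) else 0)"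
  proof (intro sum.cong refl)
    fix a b assume ab: "a \<in> R" "b \<in> R"
    have "int q dvd int a - int b \<longleftrightarrow> a = b"
    proof
      assume "int q dvd int a - int b"
      moreover have "\<bar>int a - int b\<bar> < int q" using ab unfolding R_def by auto
      ultimately have "int a - int b = 0" by (metis abs_of_nat dvd_imp_le_int linorder_not_less)
      thus "a = b" by simp
    qed simp
    thus "(\<Sum>l=1..q * k. echar (of_int m * real b / q) * echar (of_int (int a - int b) * real l / q))
       = (if a = b then echar (of_int m * real b / q) * of_nat (q * k) else 0)"
      using sum_roots_of_unity[OF assms, of "int a - int b" k] by (simp add: sum_distrib_left[symmetric])
  qed
  also have "\<dots> = (\<Sum>a\<in>R. echar (of_int m * real a / q) * of_nat (q * k))"
    using fR by (simp add: sum.delta)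
  also have "\<dots> = complex_of_real (real (q * k) * ramanujan_sum q m)"
    unfolding of_real_mult ramanujan_sum_echar[OF assms] R_def[symmetric] by (simp add: sum_distrib_left sum_distrib_right mult_ac)
  finally show ?thesis by (simp only: of_real_eq_iff)
qed

lemma ramanujan_sum_abs_le:
  assumes "0 < q" shows "\<bar>ramanujan_sum q n\<bar> \<le> q"
proof -
  have "\<bar>ramanujan_sum q n\<bar> = cmod (complex_of_real (ramanujan_sum q n))" by simp
  also have "\<dots> \<le> (\<Sum>a\<in>{a\<in>{..<q}. coprime a q}. 1)"
    unfolding ramanujan_sum_echar[OF assms] by (intro sum_norm_le) simp
  also have "\<dots> = real (card {a\<in>{..<q}. coprime a q})" by simp
  also have "\<dots> \<le> card {..<q}" by (intro of_nat_mono card_mono) auto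
  finally show ?thesis by simp
qed

text \<open>
  Parseval for a sequence supported in an interval of at most \<open>M\<close> points, sampled at
  the \<open>M\<close>-th roots of unity.
\<close>
lemma Parseval_finite:
  fixes g :: "int \<Rightarrow> real" and A :: int
  assumes Y: "Y \<subseteq> {-A..A}" and M: "2 * A < int M"
  shows "(\<Sum>r<M. (cmod (\<Sum>y\<in>Y. of_real (g y) * echar (- (of_int y * (real r / M)))))\<^sup>2) = M * (\<Sum>y\<in>Y. (g y)\<^sup>2)"
proof (cases "Y = {}")
  case False
  hence A0: "0 \<le> A" using Y by fastforce
  hence M0: "0 < M" using M by linarith
  have finY: "finite Y" using Y finite_subset by auto
  define G where "G r = (\<Sum>y\<in>Y. of_real (g y) * echar (- (of_int y * (real r / M))))" for r :: nat
  have "complex_of_real (\<Sum>r<M. (cmod (G r))\<^sup>2) = (\<Sum>r<M. G r * cnj (G r))"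
    by (simp add: complex_norm_square del: of_real_power)
  also have "\<dots> = (\<Sum>r<M. \<Sum>y\<in>Y. \<Sum>y'\<in>Y. of_real (g y * g y') * echar (of_int (y' - y) * real r / M))"
    unfolding G_def cnj_sum sum_product
  proof (intro sum.cong refl)
    fix r y y'
    have "echar (- (of_int y * (real r / M))) * cnj (echar (- (of_int y' * (real r / M)))) = echar (of_int (y' - y) * real r / M)"
      unfolding cnj_echar echar_add[symmetric] by (intro arg_cong[where f = echar]) (simp add: algebra_simps diff_divide_distrib)
    thus "complex_of_real (g y) * echar (- (of_int y * (real r / M))) * cnj (complex_of_real (g y') * echar (- (of_int y' * (real r / M))))
       = of_real (g y * g y') * echar (of_int (y' - y) * real r / M)"
      by (simp add: mult_ac)
  qed
  also have "\<dots> = (\<Sum>y\<in>Y. \<Sum>y'\<in>Y. \<Sum>r<M. of_real (g y * g y') * echar (of_int (y' - y) * real r / M))"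
    by (rule sum_swap3)
  also have "\<dots> = (\<Sum>y\<in>Y. \<Sum>y'\<in>Y. if y = y' then of_real (g y * g y') * of_nat M else 0)"
  proof (intro sum.cong refl)
    fix y y' assume yy: "y \<in> Y" "y' \<in> Y"
    have "int M dvd y' - y \<longleftrightarrow> y = y'"
    proof
      assume d: "int M dvd y' - y"
      have "y \<in> {-A..A}" "y' \<in> {-A..A}" using yy Y by auto
      hence "\<bar>y' - y\<bar> < int M" using M by auto
      hence "y' - y = 0" using d by (metis abs_of_nat dvd_imp_le_int linorder_not_less)
      thus "y = y'" by simp
    qed simp
    thus "(\<Sum>r<M. of_real (g y * g y') * echar (of_int (y' - y) * real r / M))
       = (if y = y' then of_real (g y * g y') * of_nat M else 0)"
      using sum_roots_of_unity_lessThan[OF M0, of "y' - y"] by (simp add: sum_distrib_left[symmetric])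
  qed
  also have "\<dots> = complex_of_real (M * (\<Sum>y\<in>Y. (g y)\<^sup>2))"
    using finY by (simp add: sum.delta power2_eq_square sum_distrib_left mult_ac)
  finally show ?thesis unfolding G_def by (simp only: of_real_eq_iff)
qed auto

definition multiplier :: "nat \<Rightarrow> (nat \<Rightarrow> real) \<Rightarrow> real \<Rightarrow> complex" where
  "multiplier N K \<theta> = (\<Sum>n=1..N. of_real (K n) * echar (real n * \<theta>))"

text \<open>
  Parseval is applied to \<open>f\<close> and to all the convolutions with one common modulus, large
  enough that none of the supports wraps around. A family of kernels is treated at once because the
  moduli of a block are estimated through the sum of their squared multipliers.
\<close>
lemma l2_bound_by_multipliers:
  fixes f :: "int \<Rightarrow> real" and N :: "'j \<Rightarrow> nat" and K :: "'j \<Rightarrow> nat \<Rightarrow> real"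
  assumes S: "finite S" "\<And>y. y \<notin> S \<Longrightarrow> f y = 0" and X: "finite X" and J: "finite J"
    and B: "\<And>\<theta>. (\<Sum>j\<in>J. (cmod (multiplier (N j) (K j) \<theta>))\<^sup>2) \<le> B"
  shows "(\<Sum>j\<in>J. \<Sum>x\<in>X. (\<Sum>n=1..N j. K j n * f (x + int n))\<^sup>2) \<le> B * (\<Sum>y\<in>S. (f y)\<^sup>2)"
proof -
  define g where "g j x = (\<Sum>n=1..N j. K j n * f (x + int n))" for j x
  \<comment> \<open>All sequences are supported in \<open>{-A..A}\<close>, and \<open>M > 2 * A\<close> prevents wrap-around.\<close>
  define A0 where "A0 = Max (abs ` (insert 0 (S \<union> X)))"
  define L where "L = Max (insert 0 (N ` J))"
  define A where "A = A0 + int L"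
  have A0: "\<bar>y\<bar> \<le> A0" if "y \<in> S \<union> X" for y unfolding A0_def using S X that by (intro Max_ge) auto
  have A00: "0 \<le> A0" unfolding A0_def using S X by (intro Max_ge) auto
  have L: "N j \<le> L" if "j \<in> J" for j unfolding L_def using J that by (intro Max_ge) auto
  define Y where "Y = {-A..A}"
  define M where "M = nat (2 * A + 1)"
  have M: "2 * A < int M" "0 < M" unfolding M_def A_def using A00 by auto
  have SY: "S \<subseteq> Y" "X \<subseteq> Y" unfolding Y_def A_def using A0 by force+
  have finY: "finite Y" unfolding Y_def by simp
  define F where "F \<theta> = (\<Sum>y\<in>S. of_real (f y) * echar (- (of_int y * \<theta>)))" for \<theta>
  have ghat: "(\<Sum>x\<in>Y. of_real (g j x) * echar (- (of_int x * \<theta>))) = multiplier (N j) (K j) \<theta> * F \<theta>"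
    if j: "j \<in> J" for j \<theta>
  proof -
    have "(\<Sum>x\<in>Y. of_real (g j x) * echar (- (of_int x * \<theta>)))
       = (\<Sum>x\<in>Y. \<Sum>n=1..N j. of_real (K j n) * (of_real (f (x + int n)) * echar (- (of_int x * \<theta>))))"
      unfolding g_def by (simp add: sum_distrib_right sum_distrib_left mult_ac)
    also have "\<dots> = (\<Sum>n=1..N j. \<Sum>x\<in>Y. of_real (K j n) * (of_real (f (x + int n)) * echar (- (of_int x * \<theta>))))"
      by (rule sum.swap)
    also have "\<dots> = (\<Sum>n=1..N j. of_real (K j n) * echar (real n * \<theta>) * F \<theta>)"
    proof (intro sum.cong refl)
      fix n assume n: "n \<in> {1..N j}"
      have "(\<Sum>x\<in>Y. of_real (f (x + int n)) * echar (- (of_int x * \<theta>)))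
         = (\<Sum>x\<in>(\<lambda>y. y - int n) ` S. of_real (f (x + int n)) * echar (- (of_int x * \<theta>)))"
      proof (intro sum.mono_neutral_right finY ballI)
        show "(\<lambda>y. y - int n) ` S \<subseteq> Y" unfolding Y_def A_def using A0 L[OF j] n by fastforce
        fix x assume "x \<in> Y - (\<lambda>y. y - int n) ` S"
        hence "x + int n \<notin> S" by force
        thus "of_real (f (x + int n)) * echar (- (of_int x * \<theta>)) = 0" using S by simp
      qed
      also have "\<dots> = (\<Sum>y\<in>S. of_real (f y) * echar (- (of_int (y - int n) * \<theta>)))"
        by (subst sum.reindex) (auto simp: inj_on_def)
      also have "\<dots> = echar (real n * \<theta>) * F \<theta>"
        unfolding F_def sum_distrib_left
      proof (intro sum.cong refl)
        fix y
        have "echar (- (of_int (y - int n) * \<theta>)) = echar (real n * \<theta>) * echar (- (of_int y * \<theta>))"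
          unfolding echar_add[symmetric] by (intro arg_cong[where f = echar]) (simp add: algebra_simps)
        thus "of_real (f y) * echar (- (of_int (y - int n) * \<theta>)) = echar (real n * \<theta>) * (of_real (f y) * echar (- (of_int y * \<theta>)))"
          by (simp add: mult_ac)
      qed
      finally show "(\<Sum>x\<in>Y. of_real (K j n) * (of_real (f (x + int n)) * echar (- (of_int x * \<theta>))))
         = of_real (K j n) * echar (real n * \<theta>) * F \<theta>"
        by (simp add: sum_distrib_left[symmetric])
    qed
    also have "\<dots> = multiplier (N j) (K j) \<theta> * F \<theta>" unfolding multiplier_def sum_distrib_right ..
    finally show ?thesis .
  qed
  have "real M * (\<Sum>j\<in>J. \<Sum>x\<in>Y. (g j x)\<^sup>2) = (\<Sum>j\<in>J. \<Sum>r<M. (cmod (\<Sum>x\<in>Y. of_real (g j x) * echar (- (of_int x * (real r / M)))))\<^sup>2)"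
    unfolding sum_distrib_left[of "real M"] using Parseval_finite[of Y A M] M unfolding Y_def
    by (intro sum.cong refl) (simp add: sum_distrib_left)
  also have "\<dots> = (\<Sum>j\<in>J. \<Sum>r<M. (cmod (multiplier (N j) (K j) (real r / M)))\<^sup>2 * (cmod (F (real r / M)))\<^sup>2)"
    by (intro sum.cong refl) (simp only: ghat norm_mult power_mult_distrib)
  also have "\<dots> = (\<Sum>r<M. (\<Sum>j\<in>J. (cmod (multiplier (N j) (K j) (real r / M)))\<^sup>2) * (cmod (F (real r / M)))\<^sup>2)"
    unfolding sum_distrib_right by (rule sum.swap)
  also have "\<dots> \<le> (\<Sum>r<M. B * (cmod (F (real r / M)))\<^sup>2)"
    by (intro sum_mono mult_right_mono B) auto
  also have "\<dots> = B * (M * (\<Sum>y\<in>S. (f y)\<^sup>2))"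
    unfolding sum_distrib_left[symmetric] F_def using Parseval_finite[of S A M f] SY M unfolding Y_def by simp
  finally have "real M * (\<Sum>j\<in>J. \<Sum>x\<in>Y. (g j x)\<^sup>2) \<le> real M * (B * (\<Sum>y\<in>S. (f y)\<^sup>2))" by (simp only: mult_ac)
  hence 1: "(\<Sum>j\<in>J. \<Sum>x\<in>Y. (g j x)\<^sup>2) \<le> B * (\<Sum>y\<in>S. (f y)\<^sup>2)" using M by simp
  have "(\<Sum>j\<in>J. \<Sum>x\<in>X. (g j x)\<^sup>2) \<le> (\<Sum>j\<in>J. \<Sum>x\<in>Y. (g j x)\<^sup>2)"
    using SY finY by (intro sum_mono sum_mono2) auto
  thus ?thesis using 1 unfolding g_def by linarith
qed

text \<open>
  Up to \<open>1/4\<close> it follows from \<open>x \<le> tan x\<close>, beyond that from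
  monotonicity.
\<close>
lemma sin_pi_ge:
  assumes "0 \<le> y" "y \<le> 1/2"
  shows "y \<le> sin (pi * y)"
proof (cases "y \<le> 1/4")
  case True
  show ?thesis
  proof (cases "y = 0")
    case False
    define x where "x = pi * y"
    have x: "0 < x" "x \<le> pi / 4" unfolding x_def using True False assms by auto
    have c: "cos (pi/4) \<le> cos x" using x by (intro cos_monotone_0_pi_le) auto
    have c2: "1/2 \<le> cos (pi/4)" unfolding cos_45 using real_le_rsqrt[of 1 2] by simp
    have cp: "0 < cos x" using c c2 by linarith
    have "\<bar>x\<bar> \<le> \<bar>tan x\<bar>" using x pi_gt_zero by (intro abs_tan_ge) auto
    hence "x \<le> tan x" using x tan_gt_zero[of x] pi_gt_zero by auto
    hence "x * cos x \<le> sin x" using cp by (simp add: tan_def field_simps)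
    moreover have "x * (1/2) \<le> x * cos x" using x c c2 by (intro mult_left_mono) auto
    moreover have "2 * y \<le> x" unfolding x_def using assms pi_ge_two by (intro mult_right_mono) auto
    ultimately show ?thesis unfolding x_def by linarith
  qed auto
next
  case False
  have "sin (pi/4) \<le> sin (pi * y)" using False assms by (intro sin_monotone_2pi_le) auto
  moreover have "1/2 \<le> sin (pi/4)" unfolding sin_45 using real_le_rsqrt[of 1 2] by simp
  ultimately show ?thesis using assms by linarith
qed

lemma cmod_one_minus_echar: "cmod (echar y - 1) = 2 * \<bar>sin (pi * y)\<bar>"
proof -
  have "cmod (echar y - 1) = cmod (exp (\<i> * of_real (2 * pi * y)) - 1)"
    unfolding echar_def cis_conv_exp by simp
  also have "\<dots> = 2 * \<bar>sin (2 * pi * y / 2)\<bar>" by (rule dist_exp_i_1)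
  finally show ?thesis by simp
qed

text \<open>
  A majorant of the normalised Dirichlet kernel at distance \<open>y\<close> from the integers: one
  near zero and \<open>1 / (N * y)\<close> further out.
\<close>
definition peak :: "real \<Rightarrow> real \<Rightarrow> real" where "peak N y = 1 / max 1 (N * y)"

lemma Dirichlet_kernel_bound:
  assumes "1 \<le> N"
  shows "cmod (\<Sum>n=1..N. echar (real n * \<phi>)) \<le> N * (peak N (frac \<phi>) + peak N (1 - frac \<phi>))"
proof -
  define y where "y = frac \<phi>"
  have y: "0 \<le> y" "y < 1" unfolding y_def by (auto simp: frac_lt_1)
  define D where "D = (\<Sum>n=1..N. echar (real n * \<phi>))"
  define z where "z = echar y"
  have D: "D = (\<Sum>n=1..N. z ^ n)" unfolding D_def z_def y_def echar_frac echar_power ..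
  have DN: "cmod D \<le> N" unfolding D_def using sum_norm_le[of "{1..N}" "\<lambda>n. echar (real n * \<phi>)" "\<lambda>_. 1"] by simp
  have zn: "cmod z = 1" unfolding z_def by simp
  have "cmod D * cmod (z - 1) = cmod (z * (z ^ N - 1))"
    unfolding norm_mult[symmetric] D sum_geometric_shift ..
  also have "\<dots> \<le> 2" unfolding norm_mult zn using norm_triangle_ineq4[of "z ^ N" 1] zn by (simp add: norm_power)
  finally have Ds: "cmod D * \<bar>sin (pi * y)\<bar> \<le> 1" unfolding z_def cmod_one_minus_echar by simp
  have key: "cmod D \<le> N * peak N u" if u: "0 \<le> u" "u \<le> \<bar>sin (pi * y)\<bar>" for u
  proof -
    have "cmod D * u \<le> cmod D * \<bar>sin (pi * y)\<bar>" using u by (intro mult_left_mono) auto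
    hence "cmod D * u \<le> 1" using Ds by linarith
    hence "cmod D * (N * u) \<le> N" using mult_left_mono[of "cmod D * u" 1 "real N"] by (simp add: mult_ac)
    hence "cmod D * max 1 (N * u) \<le> N" using DN by (cases "N * u \<le> 1") (auto simp: max_def)
    thus ?thesis unfolding peak_def by (simp add: field_simps)
  qed
  have pk: "0 \<le> N * peak N u" for u unfolding peak_def by simp
  show ?thesis
  proof (cases "y \<le> 1/2")
    case True
    hence "y \<le> \<bar>sin (pi * y)\<bar>" using sin_pi_ge[of y] y by linarith
    thus ?thesis using key[of y] y pk[of "1 - y"] unfolding D_def y_def distrib_left by linarith
  next
    case False
    have "sin (pi * (1 - y)) = sin (pi * y)" by (simp add: right_diff_distrib)
    hence "1 - y \<le> \<bar>sin (pi * y)\<bar>" using sin_pi_ge[of "1 - y"] y False by linarith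
    thus ?thesis using key[of "1 - y"] y pk[of y] unfolding D_def y_def distrib_left by linarith
  qed
qed

text \<open>
  Separated points fall into distinct cells of length \<open>1 / D\<close>; the cell at zero
  contributes at most one and the \<open>k\<close>-th cell at most \<open>D / (N * k)\<close>.
\<close>
lemma sum_peak_separated:
  fixes y :: "'i \<Rightarrow> real"
  assumes P: "finite P" and y: "\<And>i. i \<in> P \<Longrightarrow> 0 \<le> y i" "\<And>i. i \<in> P \<Longrightarrow> y i \<le> 1" and N: "0 < N" and D: "0 < D"
    and sep: "\<And>i j. i \<in> P \<Longrightarrow> j \<in> P \<Longrightarrow> i \<noteq> j \<Longrightarrow> 1 / real D \<le> \<bar>y i - y j\<bar>"
  shows "(\<Sum>i\<in>P. peak N (y i)) \<le> 1 + D / N * harm D"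
proof -
  define k where "k i = nat \<lfloor>y i * D\<rfloor>" for i
  have k: "real (k i) \<le> y i * D" "y i * D < real (k i) + 1" if "i \<in> P" for i
    unfolding k_def using y(1)[OF that] by auto
  have inj: "inj_on k P"
  proof (rule inj_onI, rule ccontr)
    fix i j assume ij: "i \<in> P" "j \<in> P" "k i = k j" "i \<noteq> j"
    have "\<bar>y i * D - y j * D\<bar> < 1" using k[OF ij(1)] k[OF ij(2)] ij(3) by linarith
    hence "\<bar>y i - y j\<bar> * D < 1" by (simp add: abs_mult left_diff_distrib[symmetric])
    hence "\<bar>y i - y j\<bar> < 1 / D" using D by (simp add: field_simps)
    thus False using sep[OF ij(1,2,4)] by linarith
  qed
  have kD: "k ` P \<subseteq> {0..D}"
  proof safe
    fix i assume i: "i \<in> P"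
    have "y i * D \<le> 1 * real D" using y(2)[OF i] by (intro mult_right_mono) auto
    hence "real (k i) \<le> D" using k(1)[OF i] by linarith
    thus "k i \<in> {0..D}" by simp
  qed
  define t where "t m = (if m = 0 then 1 else D / N * inverse (real m))" for m :: nat
  have "(\<Sum>i\<in>P. peak N (y i)) \<le> (\<Sum>i\<in>P. t (k i))"
  proof (intro sum_mono)
    fix i assume i: "i \<in> P"
    show "peak N (y i) \<le> t (k i)"
    proof (cases "k i = 0")
      case False
      hence kp: "0 < real (k i)" by simp
      have "N * (real (k i) / D) \<le> N * y i" using k(1)[OF i] D N by (simp add: field_simps)
      hence "N * (real (k i) / D) \<le> max 1 (N * y i)" by simp
      hence "1 / max 1 (N * y i) \<le> 1 / (N * (real (k i) / D))"
        using kp N D by (intro divide_left_mono) auto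
      thus ?thesis using False unfolding peak_def t_def by (simp add: field_simps)
    qed (simp add: peak_def t_def)
  qed
  also have "\<dots> = sum t (k ` P)" using inj by (simp add: sum.reindex)
  also have "\<dots> \<le> sum t {0..D}" using kD N by (intro sum_mono2) (auto simp: t_def)
  also have "\<dots> = t 0 + sum t {1..D}" by (simp add: sum.atLeast_Suc_atMost)
  also have "sum t {1..D} = D / N * harm D" unfolding harm_def sum_distrib_left by (intro sum.cong) (auto simp: t_def)
  finally show ?thesis by (simp add: t_def)
qed

section \<open>Averages over a dyadic block of moduli\<close>

definition block :: "nat \<Rightarrow> nat set" where "block s = {2^s..<2^Suc s}"

definition numerators :: "nat \<Rightarrow> nat set" where "numerators q = {a\<in>{..<q}. coprime a q}"

lemma finite_block [simp]: "finite (block s)" and finite_numerators [simp]: "finite (numerators q)"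
  unfolding block_def numerators_def by auto

lemma block_pos: "q \<in> block s \<Longrightarrow> 0 < q"
proof -
  assume "q \<in> block s"
  hence "2 ^ s \<le> q" unfolding block_def by auto
  moreover have "(0::nat) < 2 ^ s" by simp
  ultimately show "0 < q" by linarith
qed

lemma block_bounds:
  assumes "q \<in> block s"
  shows "2 ^ s \<le> real q" "real q \<le> 2 * 2 ^ s"
proof -
  have q: "2 ^ s \<le> q" "q \<le> 2 * 2 ^ s" using assms unfolding block_def by auto
  show "2 ^ s \<le> real q" using q(1) by (metis of_nat_le_iff of_nat_numeral of_nat_power)
  show "real q \<le> 2 * 2 ^ s" using q(2) by (metis of_nat_le_iff of_nat_mult of_nat_numeral of_nat_power)
qed

lemma card_block: "card (block s) = 2 ^ s"
  unfolding block_def by simp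

text \<open>
  Distinct reduced fractions with denominators below \<open>2 ^ (s + 1)\<close> differ modulo
  one by at least the inverse of the product of the denominators.
\<close>
lemma fractions_separated:
  fixes m :: int
  assumes q: "q \<in> block s" "q' \<in> block s" and a: "a \<in> numerators q" "a' \<in> numerators q'"
    and ne: "(q, a) \<noteq> (q', a')"
  shows "1 / real (4 ^ Suc s) \<le> \<bar>real a / q - real a' / q' + of_int m\<bar>"
proof -
  have pos: "0 < q" "0 < q'" using q block_pos by auto
  have a': "a < q" "a' < q'" "coprime a q" "coprime a' q'" using a unfolding numerators_def by auto
  define u where "u = int a * int q' - int a' * int q + m * (int q * int q')"
  have eq: "real a / q - real a' / q' + of_int m = of_int u / (real q * real q')"
    unfolding u_def using pos by (simp add: field_simps)
  have "u \<noteq> 0"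
  proof
    assume "u = 0"
    hence e: "real a / q - real a' / q' = - of_int m" using eq by simp
    have "0 \<le> real a / q" "real a / q < 1" "0 \<le> real a' / q'" "real a' / q' < 1" using a' pos by auto
    hence "\<bar>real_of_int m\<bar> < 1" using e by linarith
    hence "m = 0" by linarith
    hence "int a * int q' = int a' * int q" using \<open>u = 0\<close> unfolding u_def by simp
    hence "a * q' = a' * q" by (metis of_nat_eq_iff of_nat_mult)
    hence "a = a' \<and> q = q'"
      using a'(3,4) coprime_crossproduct_nat[of a q a' q'] by (simp add: mult.commute coprime_commute)
    thus False using ne by simp
  qed
  hence "1 \<le> \<bar>real_of_int u\<bar>" by linarith
  moreover have "real q * real q' \<le> (2 * 2 ^ s) * (2 * 2 ^ s)"
    using block_bounds[OF q(1)] block_bounds[OF q(2)] by (intro mult_mono) auto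
  hence "real q * real q' \<le> real (4 ^ Suc s)"
    by (simp add: power_mult_distrib[symmetric] mult_ac flip: power_mult_distrib)
  ultimately have "1 / real (4 ^ Suc s) \<le> \<bar>real_of_int u\<bar> / (real q * real q')"
    using pos by (intro frac_le) auto
  thus ?thesis unfolding eq by (simp add: abs_divide)
qed

lemma peak_antimono: "N \<le> N' \<Longrightarrow> 0 \<le> y \<Longrightarrow> peak N' y \<le> peak N y"
  unfolding peak_def by (intro divide_left_mono max.mono mult_right_mono) auto

text \<open>
  Both halves of the kernel, to the right and to the left of an integer, are summed over the
  separated frequencies; for \<open>N \<ge> 4 ^ s\<close> the ratio of the inverse spacing to
  \<open>N\<close> is at most four, and the harmonic sum contributes \<open>2 * s + 3\<close>.
  The total \<open>2 * (1 + 4 * (2 * s + 3))\<close> is at most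
  \<open>26 * (s + 1)\<close>.
\<close>
lemma sum_peak_block:
  assumes N: "4 ^ s \<le> N"
  shows "(\<Sum>q\<in>block s. \<Sum>a\<in>numerators q. peak N (frac (\<theta> + a / q)) + peak N (1 - frac (\<theta> + a / q))) \<le> 26 * (real s + 1)"
proof -
  define P where "P = Sigma (block s) numerators"
  define y where "y i = frac (\<theta> + real (snd i) / real (fst i))" for i :: "nat \<times> nat"
  define D where "D = (4::nat) ^ Suc s"
  have N0: "0 < N" using N zero_less_power[of "4::real" s] by linarith
  have sep: "1 / real D \<le> \<bar>y i - y j\<bar>" if ij: "i \<in> P" "j \<in> P" "i \<noteq> j" for i j
  proof -
    obtain q a q' a' where i: "i = (q, a)" and j: "j = (q', a')" by (cases i, cases j)
    \<comment> \<open>Fractional parts differ from the fractions themselves by an integer.\<close>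
    define m where "m = \<lfloor>\<theta> + a' / q'\<rfloor> - \<lfloor>\<theta> + a / q\<rfloor>"
    have "y i - y j = real a / q - real a' / q' + of_int m"
      unfolding y_def i j m_def frac_def by simp
    thus ?thesis using fractions_separated[of q s q' a a' m] ij unfolding P_def i j D_def by auto
  qed
  have fin: "finite P" unfolding P_def by auto
  have y: "0 \<le> y i" "y i \<le> 1" for i unfolding y_def using frac_lt_1[of "\<theta> + real (snd i) / real (fst i)"] by auto
  have "harm D \<le> 2 * real s + 3"
  proof -
    have "(4::nat) ^ Suc s = 2 ^ (2 * Suc s)" by (simp add: power_mult)
    thus ?thesis unfolding D_def using harm_pow2_le[of "2 * Suc s"] by simp
  qed
  moreover have "D / N \<le> 4" unfolding D_def using N N0 by (simp add: field_simps)
  ultimately have b: "1 + D / N * harm D \<le> 1 + 4 * (2 * real s + 3)"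
    by (intro add_left_mono mult_mono harm_nonneg) auto
  have D0: "0 < D" unfolding D_def by simp
  have "(\<Sum>i\<in>P. peak N (y i)) \<le> 1 + D / N * harm D"
    by (rule sum_peak_separated) (use fin y N0 sep D0 in auto)
  hence 1: "(\<Sum>i\<in>P. peak N (y i)) \<le> 1 + 4 * (2 * real s + 3)" using b by linarith
  have sep': "1 / real D \<le> \<bar>(1 - y i) - (1 - y j)\<bar>" if ij: "i \<in> P" "j \<in> P" "i \<noteq> j" for i j
    using sep[OF ij] by linarith
  have "(\<Sum>i\<in>P. peak N (1 - y i)) \<le> 1 + D / N * harm D"
    by (rule sum_peak_separated) (use fin y N0 sep' D0 in auto)
  hence 2: "(\<Sum>i\<in>P. peak N (1 - y i)) \<le> 1 + 4 * (2 * real s + 3)" using b by linarith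
  have "(\<Sum>q\<in>block s. \<Sum>a\<in>numerators q. peak N (frac (\<theta> + a / q)) + peak N (1 - frac (\<theta> + a / q)))
      = (\<Sum>i\<in>P. peak N (y i) + peak N (1 - y i))"
    unfolding P_def y_def by (subst sum.Sigma) (auto simp: case_prod_beta)
  also have "\<dots> \<le> 26 * (real s + 1)" using 1 2 unfolding sum.distrib by simp
  finally show ?thesis .
qed

lemma ramanujan_multiplier_bound:
  assumes q: "0 < q" and N: "1 \<le> N" "4 ^ s \<le> real N"
  shows "cmod (multiplier N (\<lambda>n. ramanujan_sum q (int n) / N) \<theta>)
     \<le> (\<Sum>a\<in>numerators q. peak (4 ^ s) (frac (\<theta> + a / q)) + peak (4 ^ s) (1 - frac (\<theta> + a / q)))"
proof -
  have "multiplier N (\<lambda>n. ramanujan_sum q (int n) / N) \<theta>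
     = (\<Sum>n=1..N. \<Sum>a\<in>numerators q. echar (real n * (\<theta> + a / q)) / N)"
    unfolding multiplier_def
  proof (intro sum.cong refl)
    fix n
    have "echar (of_int (int n) * real a / q) * echar (real n * \<theta>) = echar (real n * (\<theta> + a / q))" for a
      unfolding echar_add[symmetric] by (intro arg_cong[where f = echar]) (simp add: algebra_simps)
    thus "of_real (ramanujan_sum q (int n) / N) * echar (real n * \<theta>) = (\<Sum>a\<in>numerators q. echar (real n * (\<theta> + a / q)) / N)"
      unfolding of_real_divide ramanujan_sum_echar[OF q] numerators_def
      by (simp add: sum_divide_distrib sum_distrib_right)
  qed
  also have "\<dots> = (\<Sum>a\<in>numerators q. (\<Sum>n=1..N. echar (real n * (\<theta> + a / q))) / N)"
    unfolding sum_divide_distrib by (rule sum.swap)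
  finally have "cmod (multiplier N (\<lambda>n. ramanujan_sum q (int n) / N) \<theta>)
     \<le> (\<Sum>a\<in>numerators q. cmod ((\<Sum>n=1..N. echar (real n * (\<theta> + a / q))) / N))"
    by (simp only: norm_sum)
  also have "\<dots> \<le> (\<Sum>a\<in>numerators q. peak (4 ^ s) (frac (\<theta> + a / q)) + peak (4 ^ s) (1 - frac (\<theta> + a / q)))"
  proof (intro sum_mono)
    fix a
    define \<phi> where "\<phi> = \<theta> + real a / q"
    have f: "0 \<le> frac \<phi>" "0 \<le> 1 - frac \<phi>" using frac_lt_1[of \<phi>] by auto
    have "cmod ((\<Sum>n=1..N. echar (real n * \<phi>)) / N) \<le> N * (peak N (frac \<phi>) + peak N (1 - frac \<phi>)) / N"
      unfolding norm_divide norm_of_nat by (intro divide_right_mono Dirichlet_kernel_bound N) simp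
    also have "\<dots> = peak N (frac \<phi>) + peak N (1 - frac \<phi>)" using N by simp
    also have "\<dots> \<le> peak (4 ^ s) (frac \<phi>) + peak (4 ^ s) (1 - frac \<phi>)"
      using N f by (intro add_mono peak_antimono) auto
    finally show "cmod ((\<Sum>n=1..N. echar (real n * (\<theta> + a / q))) / N) \<le> peak (4 ^ s) (frac (\<theta> + a / q)) + peak (4 ^ s) (1 - frac (\<theta> + a / q))"
      unfolding \<phi>_def .
  qed
  finally show ?thesis .
qed

lemma sum_block_multipliers:
  assumes N: "\<And>q. q \<in> block s \<Longrightarrow> 1 \<le> N q \<and> 4 ^ s \<le> real (N q)"
  shows "(\<Sum>q\<in>block s. cmod (multiplier (N q) (\<lambda>n. ramanujan_sum q (int n) / N q) \<theta>)) \<le> 26 * (real s + 1)"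
proof -
  have "(\<Sum>q\<in>block s. cmod (multiplier (N q) (\<lambda>n. ramanujan_sum q (int n) / N q) \<theta>))
     \<le> (\<Sum>q\<in>block s. \<Sum>a\<in>numerators q. peak (4 ^ s) (frac (\<theta> + a / q)) + peak (4 ^ s) (1 - frac (\<theta> + a / q)))"
    using N block_pos by (intro sum_mono ramanujan_multiplier_bound) auto
  also have "\<dots> \<le> 26 * (real s + 1)" by (rule sum_peak_block) simp
  finally show ?thesis .
qed

definition ramanujan_avg :: "nat \<Rightarrow> nat \<Rightarrow> (int \<Rightarrow> real) \<Rightarrow> int \<Rightarrow> real" where
  "ramanujan_avg q N f x = (\<Sum>n=1..N. ramanujan_sum q (int n) / N * f (x + int n))"

text \<open>
  Almost orthogonality of different moduli: at each frequency the squares of the multipliers sum to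
  at most the square of their sum.
\<close>
lemma block_family_l2:
  fixes f :: "int \<Rightarrow> real"
  assumes N: "\<And>q. q \<in> block s \<Longrightarrow> 1 \<le> N q \<and> 4 ^ s \<le> real (N q)"
    and S: "finite S" "\<And>y. y \<notin> S \<Longrightarrow> f y = 0" and X: "finite X"
  shows "(\<Sum>q\<in>block s. \<Sum>x\<in>X. (ramanujan_avg q (N q) f x)\<^sup>2) \<le> (26 * (real s + 1))\<^sup>2 * (\<Sum>y\<in>S. (f y)\<^sup>2)"
  unfolding ramanujan_avg_def
proof (rule l2_bound_by_multipliers[OF S X finite_block])
  fix \<theta>
  define c where "c q = cmod (multiplier (N q) (\<lambda>n. ramanujan_sum q (int n) / N q) \<theta>)" for q
  have "(\<Sum>q\<in>block s. (c q)\<^sup>2) \<le> (\<Sum>q\<in>block s. c q * sum c (block s))"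
  proof (intro sum_mono)
    fix q assume "q \<in> block s"
    hence "c q \<le> sum c (block s)" by (intro member_le_sum) (auto simp: c_def)
    thus "(c q)\<^sup>2 \<le> c q * sum c (block s)" unfolding power2_eq_square by (intro mult_left_mono) (auto simp: c_def)
  qed
  also have "\<dots> = (sum c (block s))\<^sup>2" by (simp add: sum_distrib_right power2_eq_square)
  also have "\<dots> \<le> (26 * (real s + 1))\<^sup>2"
    using sum_block_multipliers[OF N] unfolding c_def by (intro power_mono sum_nonneg) auto
  finally show "(\<Sum>q\<in>block s. (cmod (multiplier (N q) (\<lambda>n. ramanujan_sum q (int n) / N q) \<theta>))\<^sup>2) \<le> (26 * (real s + 1))\<^sup>2"
    unfolding c_def .
qed

definition block_avg :: "(nat \<Rightarrow> real) \<Rightarrow> nat \<Rightarrow> nat \<Rightarrow> (int \<Rightarrow> real) \<Rightarrow> int \<Rightarrow> real" where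
  "block_avg \<gamma> s N f x = (\<Sum>q\<in>block s. \<gamma> q / q * ramanujan_avg q N f x)"

lemma block_avg_kernel:
  "block_avg \<gamma> s N f x = (\<Sum>n=1..N. (\<Sum>q\<in>block s. \<gamma> q * ramanujan_sum q (int n) / q) / N * f (x + int n))"
proof -
  have "block_avg \<gamma> s N f x = (\<Sum>q\<in>block s. \<Sum>n=1..N. \<gamma> q * ramanujan_sum q (int n) / q / N * f (x + int n))"
    unfolding block_avg_def ramanujan_avg_def by (simp add: sum_distrib_left mult_ac)
  also have "\<dots> = (\<Sum>n=1..N. \<Sum>q\<in>block s. \<gamma> q * ramanujan_sum q (int n) / q / N * f (x + int n))"
    by (rule sum.swap)
  finally show ?thesis by (simp add: sum_divide_distrib sum_distrib_right)
qed

text \<open>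
  The factor \<open>1 / q\<close> supplies the gain \<open>1 / 2 ^ s\<close>.
\<close>
lemma block_avg_l2:
  fixes f :: "int \<Rightarrow> real"
  assumes \<gamma>: "\<And>q. \<bar>\<gamma> q\<bar> \<le> 1" and N: "1 \<le> N" "4 ^ s \<le> real N"
    and S: "finite S" "\<And>y. y \<notin> S \<Longrightarrow> f y = 0" and X: "finite X"
  shows "(\<Sum>x\<in>X. (block_avg \<gamma> s N f x)\<^sup>2) \<le> (26 * (real s + 1) / 2 ^ s)\<^sup>2 * (\<Sum>y\<in>S. (f y)\<^sup>2)"
proof -
  have "(\<Sum>j\<in>{()}. \<Sum>x\<in>X. (\<Sum>n=1..N. (\<Sum>q\<in>block s. \<gamma> q * ramanujan_sum q (int n) / q) / N * f (x + int n))\<^sup>2)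
     \<le> (26 * (real s + 1) / 2 ^ s)\<^sup>2 * (\<Sum>y\<in>S. (f y)\<^sup>2)"
  proof (rule l2_bound_by_multipliers[OF S X finite.insertI[OF finite.emptyI]])
    fix \<theta>
    have "multiplier N (\<lambda>n. (\<Sum>q\<in>block s. \<gamma> q * ramanujan_sum q (int n) / q) / N) \<theta>
       = (\<Sum>n=1..N. \<Sum>q\<in>block s. of_real (\<gamma> q / q) * (of_real (ramanujan_sum q (int n) / N) * echar (real n * \<theta>)))"
      unfolding multiplier_def by (simp add: sum_divide_distrib sum_distrib_left sum_distrib_right mult_ac)
    also have "\<dots> = (\<Sum>q\<in>block s. of_real (\<gamma> q / q) * multiplier N (\<lambda>n. ramanujan_sum q (int n) / N) \<theta>)"
      unfolding multiplier_def sum_distrib_left by (rule sum.swap)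
    finally have "cmod (multiplier N (\<lambda>n. (\<Sum>q\<in>block s. \<gamma> q * ramanujan_sum q (int n) / q) / N) \<theta>)
       \<le> (\<Sum>q\<in>block s. cmod (of_real (\<gamma> q / q) * multiplier N (\<lambda>n. ramanujan_sum q (int n) / N) \<theta>))"
      by (simp only: norm_sum)
    also have "\<dots> \<le> (\<Sum>q\<in>block s. 1 / 2 ^ s * cmod (multiplier N (\<lambda>n. ramanujan_sum q (int n) / N) \<theta>))"
    proof (intro sum_mono)
      fix q assume q: "q \<in> block s"
      have "\<bar>\<gamma> q / q\<bar> \<le> 1 / 2 ^ s"
        unfolding abs_divide abs_of_nat using \<gamma>[of q] block_bounds[OF q] by (intro frac_le) auto
      thus "cmod (of_real (\<gamma> q / q) * multiplier N (\<lambda>n. ramanujan_sum q (int n) / N) \<theta>)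
         \<le> 1 / 2 ^ s * cmod (multiplier N (\<lambda>n. ramanujan_sum q (int n) / N) \<theta>)"
        unfolding norm_mult norm_of_real by (intro mult_right_mono) auto
    qed
    also have "\<dots> \<le> 1 / 2 ^ s * (26 * (real s + 1))"
      unfolding sum_distrib_left[symmetric] using sum_block_multipliers[of s "\<lambda>_. N"] N by (intro mult_left_mono) auto
    finally show "(\<Sum>j\<in>{()}. (cmod (multiplier N (\<lambda>n. (\<Sum>q\<in>block s. \<gamma> q * ramanujan_sum q (int n) / q) / N) \<theta>))\<^sup>2)
       \<le> (26 * (real s + 1) / 2 ^ s)\<^sup>2"
      by (simp add: power_mono)
  qed
  thus ?thesis unfolding block_avg_kernel by simp
qed

text \<open>
  The double average puts on \<open>m\<close> the coefficient
  \<open>c\<^sub>q * c\<^sub>q\<close>, summed over full periods as soon as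
  \<open>L < m \<le> N\<close>; there \<open>ramanujan_sum_convolution\<close> returns
  \<open>c\<^sub>q\<close> exactly. The error lives on the two boundary windows of length
  \<open>L\<close>, where all coefficients are at most \<open>q ^ 2 / N\<close>.
\<close>
lemma ramanujan_avg_reproducing:
  assumes q: "0 < q" and L: "L = q * k" "0 < k" and N: "1 \<le> N"
  shows "\<bar>ramanujan_avg q N f x - ramanujan_avg q N (ramanujan_avg q L f) x\<bar>
    \<le> 2 * (real q)\<^sup>2 / N * (\<Sum>m\<in>{1..L} \<union> {N<..N + L}. \<bar>f (x + int m)\<bar>)"
proof -
  define c where "c n = ramanujan_sum q n" for n :: int
  \<comment> \<open>The two boundary windows; below, \<open>A m\<close> is the coefficient of the double average before normalisation.\<close>
  define W where "W = {1..L} \<union> {N<..N + L}"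
  have L0: "0 < L" using L q by simp
  have cq: "\<bar>c n\<bar> \<le> q" for n unfolding c_def by (rule ramanujan_sum_abs_le[OF q])
  define A where "A m = (\<Sum>l=1..L. if 1 \<le> int m - int l \<and> int m - int l \<le> int N then c (int l) * c (int m - int l) else 0)" for m :: nat
  have "ramanujan_avg q N (ramanujan_avg q L f) x
     = (\<Sum>n=1..N. \<Sum>l=1..L. c (int l) * c (int n) / (N * L) * f (x + int n + int l))"
    unfolding ramanujan_avg_def c_def by (simp add: sum_distrib_left mult_ac)
  also have "\<dots> = (\<Sum>l=1..L. \<Sum>n=1..N. c (int l) * c (int n) / (N * L) * f (x + int n + int l))"
    by (rule sum.swap)
  also have "\<dots> = (\<Sum>l=1..L. \<Sum>m=1..N + L. (if 1 \<le> int m - int l \<and> int m - int l \<le> int N then c (int l) * c (int m - int l) else 0) / (N * L) * f (x + int m))"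
  proof (rule sum.cong[OF refl])
    fix l assume l: "l \<in> {1..L}"
    have "(\<Sum>n=1..N. c (int l) * c (int n) / (N * L) * f (x + int n + int l))
       = (\<Sum>m\<in>{m\<in>{1..N + L}. 1 \<le> int m - int l \<and> int m - int l \<le> int N}. c (int l) * c (int m - int l) / (N * L) * f (x + int m))"
      using l by (intro sum.reindex_bij_witness[of _ "\<lambda>m. m - l" "\<lambda>n. n + l"]) (auto simp: algebra_simps of_nat_diff)
    also have "\<dots> = (\<Sum>m=1..N + L. if 1 \<le> int m - int l \<and> int m - int l \<le> int N then c (int l) * c (int m - int l) / (N * L) * f (x + int m) else 0)"
      by (rule sum.inter_filter) simp
    finally show "(\<Sum>n=1..N. c (int l) * c (int n) / (N * L) * f (x + int n + int l))
       = (\<Sum>m=1..N + L. (if 1 \<le> int m - int l \<and> int m - int l \<le> int N then c (int l) * c (int m - int l) else 0) / (N * L) * f (x + int m))"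
      by (auto intro: sum.cong elim!: trans)
  qed
  also have "\<dots> = (\<Sum>m=1..N + L. A m / (N * L) * f (x + int m))"
    unfolding A_def sum_divide_distrib sum_distrib_right by (rule sum.swap)
  finally have rep: "ramanujan_avg q N (ramanujan_avg q L f) x = (\<Sum>m=1..N + L. A m / (N * L) * f (x + int m))" .
  have ext: "ramanujan_avg q N f x = (\<Sum>m=1..N + L. (if m \<le> N then c (int m) / N else 0) * f (x + int m))"
  proof -
    have "(\<Sum>m=1..N + L. (if m \<le> N then c (int m) / N else 0) * f (x + int m))
       = (\<Sum>m=1..N. (if m \<le> N then c (int m) / N else 0) * f (x + int m))"
      by (intro sum.mono_neutral_right) auto
    thus ?thesis unfolding ramanujan_avg_def c_def by simp
  qed
  have Aeq: "A m = L * c (int m)" if "L < m" "m \<le> N" for m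
  proof -
    have "A m = (\<Sum>l=1..L. c (int l) * c (int m - int l))"
      unfolding A_def using that by (intro sum.cong) auto
    thus ?thesis unfolding c_def L using ramanujan_sum_convolution[OF q] by simp
  qed
  have Ab: "\<bar>A m\<bar> \<le> L * (real q)\<^sup>2" for m
  proof -
    have "\<bar>A m\<bar> \<le> (\<Sum>l=1..L. (real q)\<^sup>2)"
      unfolding A_def
    proof (rule order_trans[OF sum_abs], intro sum_mono)
      fix l
      have "\<bar>c (int l) * c (int m - int l)\<bar> \<le> real q * real q"
        unfolding abs_mult by (intro mult_mono cq) auto
      thus "\<bar>if 1 \<le> int m - int l \<and> int m - int l \<le> int N then c (int l) * c (int m - int l) else 0\<bar> \<le> (real q)\<^sup>2"
        by (simp add: power2_eq_square)
    qed
    thus ?thesis by simp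
  qed
  have "ramanujan_avg q N f x - ramanujan_avg q N (ramanujan_avg q L f) x
     = (\<Sum>m=1..N + L. ((if m \<le> N then c (int m) / N else 0) - A m / (N * L)) * f (x + int m))"
    unfolding rep unfolding ext by (simp add: sum_subtractf left_diff_distrib)
  also have "\<bar>\<dots>\<bar> \<le> (\<Sum>m=1..N + L. (if m \<in> W then 2 * (real q)\<^sup>2 / N * \<bar>f (x + int m)\<bar> else 0))"
  proof (rule order_trans[OF sum_abs], intro sum_mono)
    fix m assume m: "m \<in> {1..N + L}"
    show "\<bar>((if m \<le> N then c (int m) / N else 0) - A m / (N * L)) * f (x + int m)\<bar>
       \<le> (if m \<in> W then 2 * (real q)\<^sup>2 / N * \<bar>f (x + int m)\<bar> else 0)"
    proof (cases "m \<in> W")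
      case False
      hence "L < m" "m \<le> N" using m unfolding W_def by auto
      thus ?thesis using Aeq[of m] L0 N by simp
    next
      case True
      have q2: "real q \<le> (real q)\<^sup>2" using q by (simp add: power2_eq_square)
      have 1: "\<bar>if m \<le> N then c (int m) / N else 0\<bar> \<le> (real q)\<^sup>2 / N"
      proof (cases "m \<le> N")
        case True
        have "\<bar>c (int m)\<bar> \<le> (real q)\<^sup>2" using cq[of "int m"] q2 by linarith
        thus ?thesis using True by (simp add: abs_divide divide_right_mono)
      qed simp
      have "\<bar>A m / (N * L)\<bar> \<le> L * (real q)\<^sup>2 / (N * L)"
        unfolding abs_divide abs_of_nat by (rule divide_right_mono[OF Ab]) simp
      also have "\<dots> = (real q)\<^sup>2 / N" using L0 by simp
      finally have "\<bar>(if m \<le> N then c (int m) / N else 0) - A m / (N * L)\<bar> \<le> (real q)\<^sup>2 / N + (real q)\<^sup>2 / N"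
        using add_mono[OF 1] abs_triangle_ineq4 order_trans by blast
      hence "\<bar>(if m \<le> N then c (int m) / N else 0) - A m / (N * L)\<bar> * \<bar>f (x + int m)\<bar> \<le> 2 * (real q)\<^sup>2 / N * \<bar>f (x + int m)\<bar>"
        by (intro mult_right_mono) auto
      thus ?thesis using True by (simp only: if_True abs_mult)
    qed
  qed
  also have "\<dots> = (\<Sum>m\<in>{m\<in>{1..N + L}. m \<in> W}. 2 * (real q)\<^sup>2 / N * \<bar>f (x + int m)\<bar>)"
    by (rule sum.inter_filter[symmetric]) simp
  also have "\<dots> \<le> (\<Sum>m\<in>W. 2 * (real q)\<^sup>2 / N * \<bar>f (x + int m)\<bar>)"
    by (intro sum_mono2) (auto simp: W_def)
  finally show ?thesis unfolding W_def sum_distrib_left .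
qed

lemma sum_shift_le:
  fixes g :: "int \<Rightarrow> real"
  assumes "finite S" "\<And>y. y \<notin> S \<Longrightarrow> g y = 0" "\<And>y. 0 \<le> g y" "finite X"
  shows "(\<Sum>x\<in>X. g (x + m)) \<le> sum g S"
proof -
  have "(\<Sum>x\<in>X. g (x + m)) = sum g ((\<lambda>x. x + m) ` X)" by (subst sum.reindex) (auto simp: inj_on_def)
  also have "\<dots> = sum g ((\<lambda>x. x + m) ` X \<inter> S)"
    using assms by (intro sum.mono_neutral_right) auto
  also have "\<dots> \<le> sum g S" using assms by (intro sum_mono2) auto
  finally show ?thesis .
qed

lemma window_sum_l2:
  fixes f :: "int \<Rightarrow> real" and W :: "nat set"
  assumes S: "finite S" "\<And>y. y \<notin> S \<Longrightarrow> f y = 0" and X: "finite X"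
  shows "(\<Sum>x\<in>X. (\<Sum>m\<in>W. \<bar>f (x + int m)\<bar>)\<^sup>2) \<le> (real (card W))\<^sup>2 * (\<Sum>y\<in>S. (f y)\<^sup>2)"
proof -
  have "(\<Sum>m\<in>W. \<bar>f (x + int m)\<bar>)\<^sup>2 \<le> real (card W) * (\<Sum>m\<in>W. (f (x + int m))\<^sup>2)" for x
    using Cauchy_Schwarz_ineq_sum[of "\<lambda>_. 1" "\<lambda>m. \<bar>f (x + int m)\<bar>" W] by simp
  hence "(\<Sum>x\<in>X. (\<Sum>m\<in>W. \<bar>f (x + int m)\<bar>)\<^sup>2) \<le> (\<Sum>x\<in>X. real (card W) * (\<Sum>m\<in>W. (f (x + int m))\<^sup>2))"
    by (intro sum_mono)
  also have "\<dots> = real (card W) * (\<Sum>m\<in>W. \<Sum>x\<in>X. (f (x + int m))\<^sup>2)"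
    unfolding sum_distrib_left[symmetric] by (subst sum.swap) (rule refl)
  also have "\<dots> \<le> real (card W) * (\<Sum>m\<in>W. \<Sum>y\<in>S. (f y)\<^sup>2)"
    using S X by (intro mult_left_mono sum_mono sum_shift_le[where g = "\<lambda>y. (f y)\<^sup>2"]) auto
  finally show ?thesis by (simp add: power2_eq_square mult.assoc)
qed

text \<open>
  After taking absolute values the common divisors \<open>d\<close> of \<open>q\<close> and
  \<open>n\<close> remain, and the multiples of \<open>d\<close> form an average of step
  \<open>d\<close>. There is one maximal function for each divisor of \<open>q\<close>, which is few
  compared with \<open>q\<close>.
\<close>
lemma ramanujan_avg_le_step_max:
  assumes q: "0 < q" and N: "1 \<le> N" "N \<le> R"
  shows "\<bar>ramanujan_avg q N g x\<bar> \<le> (\<Sum>d | d dvd q. step_max (int d) R (\<lambda>y. \<bar>g y\<bar>) x)"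
proof -
  have fin: "finite {d. d dvd q}" by (rule finite_divisors[OF q])
  have "\<bar>ramanujan_avg q N g x\<bar> \<le> (\<Sum>n=1..N. \<bar>ramanujan_sum q (int n) / N * g (x + int n)\<bar>)"
    unfolding ramanujan_avg_def by (rule sum_abs)
  also have "\<dots> \<le> (\<Sum>n=1..N. \<Sum>d\<in>{d\<in>{d. d dvd q}. d dvd n}. real d / N * \<bar>g (x + int n)\<bar>)"
  proof (intro sum_mono)
    fix n
    have "\<bar>ramanujan_sum q (int n)\<bar> \<le> (\<Sum>d | d dvd q \<and> int d dvd int n. real d)"
      by (rule ramanujan_sum_bound[OF q])
    also have "\<dots> = (\<Sum>d\<in>{d\<in>{d. d dvd q}. d dvd n}. real d)" by (intro sum.cong) auto
    finally have "\<bar>ramanujan_sum q (int n)\<bar> / N * \<bar>g (x + int n)\<bar> \<le> (\<Sum>d\<in>{d\<in>{d. d dvd q}. d dvd n}. real d) / N * \<bar>g (x + int n)\<bar>"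
      by (intro mult_right_mono divide_right_mono) auto
    thus "\<bar>ramanujan_sum q (int n) / N * g (x + int n)\<bar> \<le> (\<Sum>d\<in>{d\<in>{d. d dvd q}. d dvd n}. real d / N * \<bar>g (x + int n)\<bar>)"
      by (simp only: abs_mult abs_divide abs_of_nat sum_divide_distrib sum_distrib_right)
  qed
  also have "\<dots> = (\<Sum>d | d dvd q. \<Sum>n\<in>{n\<in>{1..N}. d dvd n}. real d / N * \<bar>g (x + int n)\<bar>)"
    using fin by (intro sum.swap_restrict) auto
  also have "\<dots> \<le> (\<Sum>d | d dvd q. step_max (int d) R (\<lambda>y. \<bar>g y\<bar>) x)"
  proof (intro sum_mono)
    fix d assume "d \<in> {d. d dvd q}"
    hence d: "0 < d" using q by (auto intro: dvd_pos_nat)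
    define k where "k = N div d"
    define G where "G = (\<Sum>j=1..k. \<bar>g (x + int d * int j)\<bar>)"
    have "(\<Sum>n\<in>{n\<in>{1..N}. d dvd n}. real d / N * \<bar>g (x + int n)\<bar>) = real d / N * G"
      unfolding sum_multiples[OF d] G_def k_def sum_distrib_left by simp
    also have "\<dots> \<le> step_max (int d) R (\<lambda>y. \<bar>g y\<bar>) x"
    proof (cases "k = 0")
      case True
      thus ?thesis unfolding G_def using N by (simp add: step_max_nonneg)
    next
      case False
      have "real k \<le> real N / d" unfolding k_def by (rule of_nat_div_le_of_nat)
      hence "real d / N \<le> 1 / k" using False d N by (simp add: field_simps)
      hence "real d / N * G \<le> 1 / k * G" unfolding G_def by (intro mult_right_mono sum_nonneg) auto
      also have "\<dots> = step_avg (int d) k (\<lambda>y. \<bar>g y\<bar>) x" unfolding step_avg_def G_def by simp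
      also have "\<dots> \<le> step_max (int d) R (\<lambda>y. \<bar>g y\<bar>) x"
        using False N unfolding k_def by (intro step_avg_le_max) (auto intro: order_trans[OF div_le_dividend])
      finally show ?thesis .
    qed
    finally show "(\<Sum>n\<in>{n\<in>{1..N}. d dvd n}. real d / N * \<bar>g (x + int n)\<bar>) \<le> step_max (int d) R (\<lambda>y. \<bar>g y\<bar>) x" .
  qed
  finally show ?thesis .
qed

text \<open>
  The short averaging length is \<open>q * 2 ^ s\<close>: a multiple of \<open>q\<close>, long
  enough for the spacing of the frequencies, and short enough to be negligible against
  \<open>4 ^ (3 * s)\<close>.
\<close>
lemma block_error_l2:
  fixes f :: "int \<Rightarrow> real"
  assumes q: "q \<in> block s" and N: "1 \<le> N"
    and S: "finite S" "\<And>y. y \<notin> S \<Longrightarrow> f y = 0" and X: "finite X"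
  shows "(\<Sum>x\<in>X. (ramanujan_avg q N f x - ramanujan_avg q N (ramanujan_avg q (q * 2 ^ s) f) x)\<^sup>2)
     \<le> (32 * 16 ^ s / N)\<^sup>2 * (\<Sum>y\<in>S. (f y)\<^sup>2)"
proof -
  define L where "L = q * 2 ^ s"
  define W where "W = {1..L} \<union> {N<..N + L}"
  have S0: "0 \<le> (\<Sum>y\<in>S. (f y)\<^sup>2)" by (intro sum_nonneg) auto
  have cW: "real (card W) \<le> 2 * L"
  proof -
    have "card W \<le> card {1..L} + card {N<..N + L}" unfolding W_def by (rule card_Un_le)
    thus ?thesis by simp
  qed
  have "(\<Sum>x\<in>X. (ramanujan_avg q N f x - ramanujan_avg q N (ramanujan_avg q L f) x)\<^sup>2)
     \<le> (\<Sum>x\<in>X. (2 * (real q)\<^sup>2 / N * (\<Sum>m\<in>W. \<bar>f (x + int m)\<bar>))\<^sup>2)"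
  proof (intro sum_mono power2_le_iff_abs_le[THEN iffD2] )
    fix x
    show "\<bar>ramanujan_avg q N f x - ramanujan_avg q N (ramanujan_avg q L f) x\<bar> \<le> 2 * (real q)\<^sup>2 / N * (\<Sum>m\<in>W. \<bar>f (x + int m)\<bar>)"
      unfolding W_def using ramanujan_avg_reproducing[OF block_pos[OF q] L_def _ N] by simp
  qed (auto intro!: mult_nonneg_nonneg sum_nonneg)
  also have "\<dots> = (2 * (real q)\<^sup>2 / N)\<^sup>2 * (\<Sum>x\<in>X. (\<Sum>m\<in>W. \<bar>f (x + int m)\<bar>)\<^sup>2)"
    unfolding power_mult_distrib sum_distrib_left[symmetric] ..
  also have "\<dots> \<le> (2 * (real q)\<^sup>2 / N)\<^sup>2 * ((real (card W))\<^sup>2 * (\<Sum>y\<in>S. (f y)\<^sup>2))"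
    by (intro mult_left_mono window_sum_l2[OF S X]) auto
  also have "\<dots> = (2 * (real q)\<^sup>2 * real (card W) / N)\<^sup>2 * (\<Sum>y\<in>S. (f y)\<^sup>2)"
    by (simp add: power_mult_distrib power_divide)
  also have "\<dots> \<le> (32 * 16 ^ s / N)\<^sup>2 * (\<Sum>y\<in>S. (f y)\<^sup>2)"
  proof (intro mult_right_mono power_mono divide_right_mono S0)
    have "2 * (real q)\<^sup>2 * real (card W) \<le> 2 * (2 * 2 ^ s)\<^sup>2 * (2 * ((2 * 2 ^ s) * 2 ^ s))"
    proof (intro mult_mono power_mono)
      have "real L \<le> (2 * 2 ^ s) * 2 ^ s" unfolding L_def using block_bounds(2)[OF q] by simp
      thus "real (card W) \<le> 2 * ((2 * 2 ^ s) * 2 ^ s)" using cW by linarith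
    qed (use block_bounds[OF q] in auto)
    also have "\<dots> = 32 * 16 ^ s"
    proof -
      have "(16::real) ^ s = 2 ^ s * 2 ^ s * 2 ^ s * 2 ^ s" by (simp flip: power_mult_distrib)
      thus ?thesis by (simp add: power2_eq_square)
    qed
    finally show "2 * (real q)\<^sup>2 * real (card W) \<le> 32 * 16 ^ s" .
  qed auto
  finally show ?thesis unfolding L_def .
qed

lemma sum_tau_block: "(\<Sum>q\<in>block s. real (tau q) / (real q)\<^sup>2) \<le> (real s + 2)\<^sup>2 / 2 ^ s"
proof -
  have "(\<Sum>q\<in>block s. real (tau q) / (real q)\<^sup>2) \<le> (\<Sum>q\<in>block s. real (tau q) ^ 1 / q * (1 / 2 ^ s))"
  proof (intro sum_mono)
    fix q assume q: "q \<in> block s"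
    have "real (tau q) / q * (1 / q) \<le> real (tau q) / q * (1 / 2 ^ s)"
      using block_bounds(1)[OF q] block_pos[OF q] by (intro mult_left_mono divide_left_mono) auto
    thus "real (tau q) / (real q)\<^sup>2 \<le> real (tau q) ^ 1 / q * (1 / 2 ^ s)"
      by (simp add: power2_eq_square)
  qed
  also have "\<dots> = (\<Sum>q\<in>block s. real (tau q) ^ 1 / q) * (1 / 2 ^ s)" by (simp only: sum_distrib_right)
  also have "\<dots> \<le> (\<Sum>q=1..2 ^ Suc s. real (tau q) ^ 1 / q) * (1 / 2 ^ s)"
    using block_pos[of _ s] by (intro mult_right_mono sum_mono2) (auto simp: block_def Suc_le_eq)
  also have "\<dots> \<le> harm (2 ^ Suc s) ^ (2 ^ 1) * (1 / 2 ^ s)"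
    by (intro mult_right_mono sum_tau_power_le) auto
  also have "\<dots> \<le> (real s + 2) ^ (2 ^ 1) * (1 / 2 ^ s)"
    using harm_pow2_le[of "Suc s"] by (intro mult_right_mono power_mono harm_nonneg) auto
  finally show ?thesis by simp
qed

text \<open>
  The bound for the block at all large scales simultaneously; no scale occurs on the right.
\<close>
definition block_majorant :: "nat \<Rightarrow> nat \<Rightarrow> (int \<Rightarrow> real) \<Rightarrow> int \<Rightarrow> real" where
  "block_majorant s R f x =
     (\<Sum>q\<in>block s. 1 / q * (\<Sum>d | d dvd q. step_max (int d) R (\<lambda>y. \<bar>ramanujan_avg q (q * 2 ^ s) f y\<bar>) x))"

text \<open>
  Cauchy-Schwarz over the pairs \<open>(q, d)\<close> with \<open>d dvd q\<close>. The weights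
  \<open>1 / q\<close> give \<open>(s + 2) ^ 2 / 2 ^ s\<close>, the number of divisors
  costs \<open>sqrt 2 ^ s\<close>, and the squared norms of the short averages sum up by almost
  orthogonality.
\<close>
lemma block_majorant_l2:
  fixes f :: "int \<Rightarrow> real"
  assumes S: "finite S" "\<And>y. y \<notin> S \<Longrightarrow> f y = 0" and X: "finite X" and R: "1 \<le> R"
  shows "(\<Sum>x\<in>X. (block_majorant s R f x)\<^sup>2) \<le> 2704 * HL_const * (real s + 2) ^ 4 / sqrt 2 ^ s * (\<Sum>y\<in>S. (f y)\<^sup>2)"
proof -
  define g where "g q = ramanujan_avg q (q * 2 ^ s) f" for q
  define M where "M d q x = step_max (int d) R (\<lambda>y. \<bar>g q y\<bar>) x" for d q x
  define P where "P = Sigma (block s) (\<lambda>q. {d. d dvd q})"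
  define F where "F = (\<Sum>y\<in>S. (f y)\<^sup>2)"
  have F0: "0 \<le> F" unfolding F_def by (intro sum_nonneg) auto
  \<comment> \<open>A common support of the short averages: their lengths \<open>q * 2 ^ s\<close> are at most \<open>2 * 4 ^ s\<close>.\<close>
  define Y where "Y = (\<lambda>(y, n). y - int n) ` (S \<times> {..2 * 4 ^ s})"
  have finY: "finite Y" unfolding Y_def using S by auto
  have gY: "g q y = 0" if q: "q \<in> block s" and y: "y \<notin> Y" for q y
    unfolding g_def ramanujan_avg_def
  proof (intro sum.neutral ballI)
    fix n assume n: "n \<in> {1..q * 2 ^ s}"
    have "real n \<le> real q * 2 ^ s" using n by (metis atLeastAtMost_iff of_nat_le_iff of_nat_mult of_nat_numeral of_nat_power)
    also have "\<dots> \<le> 2 * 2 ^ s * 2 ^ s" using block_bounds(2)[OF q] by (intro mult_right_mono) auto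
    also have "\<dots> = real (2 * 4 ^ s)" by (simp flip: power_mult_distrib)
    finally have "n \<le> 2 * 4 ^ s" by (simp only: of_nat_le_iff)
    have "y + int n \<notin> S"
    proof
      assume "y + int n \<in> S"
      hence "(\<lambda>(y, n). y - int n) (y + int n, n) \<in> Y" unfolding Y_def using \<open>n \<le> 2 * 4 ^ s\<close> by (intro imageI) auto
      thus False using y by simp
    qed
    thus "ramanujan_sum q (int n) / real (q * 2 ^ s) * f (y + int n) = 0" using S(2) by simp
  qed
  have finP: "finite P" unfolding P_def using block_pos by (auto intro!: finite_SigmaI)
  have A: "(block_majorant s R f x)\<^sup>2 \<le> (real s + 2)\<^sup>2 / 2 ^ s * (\<Sum>(q, d)\<in>P. (M d q x)\<^sup>2)" for x
  proof -
    have "block_majorant s R f x = (\<Sum>(q, d)\<in>P. 1 / q * M d q x)"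
      unfolding block_majorant_def P_def M_def g_def using block_pos
      by (subst sum.Sigma[symmetric]) (auto simp: sum_distrib_left)
    hence "(block_majorant s R f x)\<^sup>2 = (\<Sum>i\<in>P. (1 / real (fst i)) * M (snd i) (fst i) x)\<^sup>2"
      by (simp add: case_prod_beta)
    also have "\<dots> \<le> (\<Sum>i\<in>P. (1 / real (fst i))\<^sup>2) * (\<Sum>i\<in>P. (M (snd i) (fst i) x)\<^sup>2)"
      by (rule Cauchy_Schwarz_ineq_sum)
    also have "(\<Sum>i\<in>P. (1 / real (fst i))\<^sup>2) = (\<Sum>(q, d)\<in>P. (1 / real q)\<^sup>2)"
      by (intro sum.cong) auto
    also have "\<dots> = (\<Sum>q\<in>block s. \<Sum>d | d dvd q. (1 / real q)\<^sup>2)"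
      unfolding P_def using block_pos by (subst sum.Sigma) auto
    also have "\<dots> = (\<Sum>q\<in>block s. real (tau q) / (real q)\<^sup>2)" by (simp add: tau_def power_divide)
    also have "(\<Sum>q\<in>block s. real (tau q) / (real q)\<^sup>2) * (\<Sum>i\<in>P. (M (snd i) (fst i) x)\<^sup>2)
        \<le> (real s + 2)\<^sup>2 / 2 ^ s * (\<Sum>i\<in>P. (M (snd i) (fst i) x)\<^sup>2)"
      by (intro mult_right_mono sum_tau_block sum_nonneg) auto
    finally show ?thesis by (simp add: case_prod_beta)
  qed
  have "(\<Sum>x\<in>X. \<Sum>(q, d)\<in>P. (M d q x)\<^sup>2) = (\<Sum>(q, d)\<in>P. \<Sum>x\<in>X. (M d q x)\<^sup>2)"
    unfolding case_prod_beta by (rule sum.swap)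
  also have "\<dots> = (\<Sum>q\<in>block s. \<Sum>d | d dvd q. \<Sum>x\<in>X. (M d q x)\<^sup>2)"
    unfolding P_def using block_pos by (subst sum.Sigma) auto
  also have "\<dots> \<le> (\<Sum>q\<in>block s. \<Sum>d | d dvd q. HL_const * (\<Sum>y\<in>Y. (g q y)\<^sup>2))"
  proof (intro sum_mono)
    fix q d assume q: "q \<in> block s" and "d \<in> {d. d dvd q}"
    hence "0 < d" using block_pos[OF q] by (auto intro: dvd_pos_nat)
    thus "(\<Sum>x\<in>X. (M d q x)\<^sup>2) \<le> HL_const * (\<Sum>y\<in>Y. (g q y)\<^sup>2)"
      unfolding M_def using gY[OF q] by (intro Hardy_Littlewood_l2_step finY X R) auto
  qed
  also have "\<dots> = (\<Sum>q\<in>block s. real (tau q) * (HL_const * (\<Sum>y\<in>Y. (g q y)\<^sup>2)))" by (simp add: tau_def)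
  also have "\<dots> \<le> (\<Sum>q\<in>block s. 4 * sqrt 2 ^ s * (HL_const * (\<Sum>y\<in>Y. (g q y)\<^sup>2)))"
  proof (intro sum_mono mult_right_mono)
    fix q assume q: "q \<in> block s"
    have "real (tau q) \<le> 2 * sqrt q" by (rule tau_le_sqrt[OF block_pos[OF q]])
    also have "\<dots> \<le> 2 * sqrt (2 * 2 ^ s)" using block_bounds[OF q] by simp
    also have "\<dots> = 2 * (sqrt 2 * sqrt 2 ^ s)" by (simp add: real_sqrt_mult real_sqrt_power)
    also have "\<dots> \<le> 2 * (2 * sqrt 2 ^ s)" using sqrt2_less_2 by (intro mult_left_mono mult_right_mono) auto
    finally show "real (tau q) \<le> 4 * sqrt 2 ^ s" by simp
  qed (use HL_const_nonneg in \<open>auto intro!: mult_nonneg_nonneg sum_nonneg\<close>)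
  also have "\<dots> = 4 * sqrt 2 ^ s * HL_const * (\<Sum>q\<in>block s. \<Sum>y\<in>Y. (g q y)\<^sup>2)"
    by (simp add: sum_distrib_left mult_ac)
  also have "\<dots> \<le> 4 * sqrt 2 ^ s * HL_const * ((26 * (real s + 1))\<^sup>2 * F)"
  proof (intro mult_left_mono)
    have "1 \<le> q * 2 ^ s \<and> 4 ^ s \<le> real (q * 2 ^ s)" if q: "q \<in> block s" for q
    proof
      show "1 \<le> q * 2 ^ s" using block_pos[OF q] by (simp add: Suc_le_eq)
      have "(4::real) ^ s = 2 ^ s * 2 ^ s" by (simp flip: power_mult_distrib)
      thus "4 ^ s \<le> real (q * 2 ^ s)" using block_bounds(1)[OF q] by simp
    qed
    thus "(\<Sum>q\<in>block s. \<Sum>y\<in>Y. (g q y)\<^sup>2) \<le> (26 * (real s + 1))\<^sup>2 * F"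
      unfolding g_def F_def by (intro block_family_l2 S finY)
  qed (use HL_const_nonneg in auto)
  finally have B: "(\<Sum>x\<in>X. \<Sum>(q, d)\<in>P. (M d q x)\<^sup>2) \<le> 4 * sqrt 2 ^ s * HL_const * ((26 * (real s + 1))\<^sup>2 * F)" .
  have "(\<Sum>x\<in>X. (block_majorant s R f x)\<^sup>2) \<le> (real s + 2)\<^sup>2 / 2 ^ s * (\<Sum>x\<in>X. \<Sum>(q, d)\<in>P. (M d q x)\<^sup>2)"
    by (rule order_trans[OF sum_mono[OF A]]) (simp only: sum_distrib_left[of "(real s + 2)\<^sup>2 / 2 ^ s", symmetric] order_refl)
  also have "\<dots> \<le> (real s + 2)\<^sup>2 / 2 ^ s * (4 * sqrt 2 ^ s * HL_const * ((26 * (real s + 1))\<^sup>2 * F))"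
    by (intro mult_left_mono B) auto
  also have "\<dots> \<le> (real s + 2)\<^sup>2 / 2 ^ s * (4 * sqrt 2 ^ s * HL_const * ((26 * (real s + 2))\<^sup>2 * F))"
    using HL_const_nonneg F0 by (intro mult_left_mono mult_right_mono power_mono) auto
  also have "\<dots> = 2704 * HL_const * (real s + 2) ^ 4 / sqrt 2 ^ s * F"
  proof -
    define z where "z = sqrt 2 ^ s"
    have z: "z \<noteq> 0" "2 ^ s = z * z" unfolding z_def by (auto simp flip: power_mult_distrib)
    show ?thesis unfolding z_def[symmetric] z(2) using z(1) by (simp add: field_simps power_mult_distrib eval_nat_numeral)
  qed
  finally show ?thesis unfolding F_def .
qed

text \<open>
  Each \<open>C\<^sub>q f\<close> is split into the double average, which is dominated by the
  scale-free majorant, and the reproducing error.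
\<close>
lemma block_avg_pointwise:
  fixes f :: "int \<Rightarrow> real"
  assumes \<gamma>: "\<And>q. \<bar>\<gamma> q\<bar> \<le> 1" and N: "1 \<le> N" "N \<le> R"
  shows "(block_avg \<gamma> s N f x)\<^sup>2 \<le> 2 * (block_majorant s R f x)\<^sup>2
    + 2 / 2 ^ s * (\<Sum>q\<in>block s. (ramanujan_avg q N f x - ramanujan_avg q N (ramanujan_avg q (q * 2 ^ s) f) x)\<^sup>2)"
proof -
  define g where "g q = ramanujan_avg q (q * 2 ^ s) f" for q
  define e where "e q = ramanujan_avg q N f x - ramanujan_avg q N (g q) x" for q
  have "\<bar>block_avg \<gamma> s N f x\<bar> \<le> (\<Sum>q\<in>block s. \<bar>\<gamma> q / q * ramanujan_avg q N f x\<bar>)"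
    unfolding block_avg_def by (rule sum_abs)
  also have "\<dots> \<le> (\<Sum>q\<in>block s. 1 / q * (\<Sum>d | d dvd q. step_max (int d) R (\<lambda>y. \<bar>g q y\<bar>) x) + 1 / q * \<bar>e q\<bar>)"
  proof (intro sum_mono)
    fix q assume q: "q \<in> block s"
    have "\<bar>ramanujan_avg q N f x\<bar> \<le> \<bar>ramanujan_avg q N (g q) x\<bar> + \<bar>e q\<bar>" unfolding e_def by linarith
    also have "\<dots> \<le> (\<Sum>d | d dvd q. step_max (int d) R (\<lambda>y. \<bar>g q y\<bar>) x) + \<bar>e q\<bar>"
      using ramanujan_avg_le_step_max[OF block_pos[OF q] N] by (intro add_right_mono) auto
    finally have "1 / q * \<bar>ramanujan_avg q N f x\<bar> \<le> 1 / q * ((\<Sum>d | d dvd q. step_max (int d) R (\<lambda>y. \<bar>g q y\<bar>) x) + \<bar>e q\<bar>)"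
      by (intro mult_left_mono) auto
    moreover have "\<bar>\<gamma> q / q * ramanujan_avg q N f x\<bar> \<le> 1 / q * \<bar>ramanujan_avg q N f x\<bar>"
      unfolding abs_mult abs_divide abs_of_nat by (intro mult_right_mono divide_right_mono \<gamma>) auto
    ultimately show "\<bar>\<gamma> q / q * ramanujan_avg q N f x\<bar>
       \<le> 1 / q * (\<Sum>d | d dvd q. step_max (int d) R (\<lambda>y. \<bar>g q y\<bar>) x) + 1 / q * \<bar>e q\<bar>"
      unfolding distrib_left by linarith
  qed
  also have "\<dots> = block_majorant s R f x + (\<Sum>q\<in>block s. 1 / q * \<bar>e q\<bar>)"
    unfolding sum.distrib block_majorant_def g_def ..
  finally have le: "\<bar>block_avg \<gamma> s N f x\<bar> \<le> block_majorant s R f x + (\<Sum>q\<in>block s. 1 / q * \<bar>e q\<bar>)" (is "_ \<le> ?a + ?b") .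
  have "(block_avg \<gamma> s N f x)\<^sup>2 \<le> (?a + ?b)\<^sup>2"
    using power_mono[OF le, of 2] by simp
  also have "\<dots> \<le> 2 * ?a\<^sup>2 + 2 * ?b\<^sup>2"
    using sum_squares_bound[of ?a ?b] by (simp add: power2_sum)
  also have "?b\<^sup>2 \<le> (\<Sum>q\<in>block s. (1 / real q)\<^sup>2) * (\<Sum>q\<in>block s. \<bar>e q\<bar>\<^sup>2)"
    by (rule Cauchy_Schwarz_ineq_sum)
  also have "\<dots> \<le> 1 / 2 ^ s * (\<Sum>q\<in>block s. \<bar>e q\<bar>\<^sup>2)"
  proof (intro mult_right_mono sum_nonneg)
    have "(\<Sum>q\<in>block s. (1 / real q)\<^sup>2) \<le> (\<Sum>q\<in>block s. (1 / 2 ^ s)\<^sup>2)"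
      using block_bounds block_pos by (intro sum_mono power_mono divide_left_mono) auto
    also have "\<dots> = 1 / 2 ^ s" by (simp add: card_block power2_eq_square)
    finally show "(\<Sum>q\<in>block s. (1 / real q)\<^sup>2) \<le> 1 / 2 ^ s" .
  qed auto
  finally show ?thesis unfolding e_def g_def by simp
qed

text \<open>
  The scales below \<open>3 * s\<close> contribute 1352, the reproducing errors 4096, and the
  majorant twice its own constant.
\<close>
definition l2_const :: real where "l2_const = 5448 + 5408 * HL_const"

text \<open>
  The supremum over the scales \<open>s \<le> J < 3 * s\<close> is replaced by the sum of the
  single-scale bounds. For \<open>J \<ge> 3 * s\<close> the majorant serves all scales at once,
  and the reproducing errors form a geometric series in \<open>J\<close>.
\<close>
lemma block_maximal_l2:
  fixes f :: "int \<Rightarrow> real"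
  assumes \<gamma>: "\<And>J q. \<bar>\<gamma> J q\<bar> \<le> 1"
    and S: "finite S" "\<And>y. y \<notin> S \<Longrightarrow> f y = 0" and X: "finite X"
    and J: "\<And>x. x \<in> X \<Longrightarrow> s \<le> J x \<and> J x \<le> m"
  shows "(\<Sum>x\<in>X. (block_avg (\<gamma> (J x)) s (4 ^ J x) f x)\<^sup>2) \<le> l2_const * (real s + 2) ^ 4 / sqrt 2 ^ s * (\<Sum>y\<in>S. (f y)\<^sup>2)"
proof -
  define F where "F = (\<Sum>y\<in>S. (f y)\<^sup>2)"
  have F0: "0 \<le> F" unfolding F_def by (intro sum_nonneg) auto
  define z where "z = sqrt 2 ^ s"
  have z: "1 \<le> z" "2 ^ s = z * z" unfolding z_def by (auto simp flip: power_mult_distrib intro: one_le_power)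
  have s2: "1 \<le> (real s + 2) ^ 4" by (intro one_le_power) auto
  define e where "e q j x = ramanujan_avg q (4 ^ j) f x - ramanujan_avg q (4 ^ j) (ramanujan_avg q (q * 2 ^ s) f) x" for q j x
  define R where "R = (4::nat) ^ m"
  have R: "1 \<le> R" unfolding R_def by simp
  have pt: "(block_avg (\<gamma> (J x)) s (4 ^ J x) f x)\<^sup>2
    \<le> (\<Sum>j\<in>{s..<3 * s}. (block_avg (\<gamma> j) s (4 ^ j) f x)\<^sup>2)
     + (2 * (block_majorant s R f x)\<^sup>2 + (\<Sum>j\<in>{3 * s..m}. 2 / 2 ^ s * (\<Sum>q\<in>block s. (e q j x)\<^sup>2)))"
    (is "_ \<le> ?a x + (?b x + ?c x)") if x: "x \<in> X" for x
  proof -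
    have a: "0 \<le> ?a x" by (intro sum_nonneg) auto
    have c: "0 \<le> ?c x" by (intro sum_nonneg mult_nonneg_nonneg) auto
    have b: "0 \<le> ?b x" by simp
    show ?thesis
    proof (cases "J x < 3 * s")
      case True
      have "(block_avg (\<gamma> (J x)) s (4 ^ J x) f x)\<^sup>2 \<le> ?a x"
        using True J[OF x] by (intro member_le_sum[where f = "\<lambda>j. (block_avg (\<gamma> j) s (4 ^ j) f x)\<^sup>2"]) auto
      thus ?thesis using b c by linarith
    next
      case False
      have "(4::nat) ^ J x \<le> R" unfolding R_def using J[OF x] by (intro power_increasing) auto
      hence "(block_avg (\<gamma> (J x)) s (4 ^ J x) f x)\<^sup>2 \<le> ?b x + 2 / 2 ^ s * (\<Sum>q\<in>block s. (e q (J x) x)\<^sup>2)"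
        unfolding e_def by (intro block_avg_pointwise \<gamma>) auto
      moreover have "2 / 2 ^ s * (\<Sum>q\<in>block s. (e q (J x) x)\<^sup>2) \<le> ?c x"
        using False J[OF x] by (intro member_le_sum[where f = "\<lambda>j. 2 / 2 ^ s * (\<Sum>q\<in>block s. (e q j x)\<^sup>2)"] mult_nonneg_nonneg sum_nonneg) auto
      ultimately show ?thesis using a by linarith
    qed
  qed
  have A: "(\<Sum>x\<in>X. ?a x) \<le> 1352 * (real s + 2) ^ 4 / z * F"
  proof -
    have "(\<Sum>x\<in>X. ?a x) = (\<Sum>j\<in>{s..<3 * s}. \<Sum>x\<in>X. (block_avg (\<gamma> j) s (4 ^ j) f x)\<^sup>2)" by (rule sum.swap)
    also have "\<dots> \<le> (\<Sum>j\<in>{s..<3 * s}. (26 * (real s + 1) / 2 ^ s)\<^sup>2 * F)"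
      unfolding F_def by (intro sum_mono block_avg_l2 \<gamma> S X) auto
    also have "\<dots> = 2 * real s * (26 * (real s + 1) / 2 ^ s)\<^sup>2 * F" by simp
    also have "\<dots> \<le> 2 * (real s + 2) * (26 * (real s + 2) / z)\<^sup>2 * F"
    proof (intro mult_right_mono F0 mult_mono power_mono frac_le)
      have "z * 1 \<le> z * z" using z by (intro mult_left_mono) auto
      thus "z \<le> 2 ^ s" unfolding z by simp
    qed (use z in auto)
    also have "\<dots> = 1352 * (real s + 2) ^ 3 / (z * z) * F"
    proof -
      define u where "u = real s + 2"
      show ?thesis unfolding u_def[symmetric] by (simp add: power_mult_distrib power_divide eval_nat_numeral)
    qed
    also have "\<dots> \<le> 1352 * (real s + 2) ^ 4 / (z * 1) * F"
    proof (intro mult_right_mono F0 frac_le mult_left_mono)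
      show "(real s + 2) ^ 3 \<le> (real s + 2) ^ 4" by (intro power_increasing) auto
    qed (use z in auto)
    finally show ?thesis by simp
  qed
  have B: "(\<Sum>x\<in>X. ?b x) \<le> 2 * (2704 * HL_const * (real s + 2) ^ 4 / z * F)"
    unfolding sum_distrib_left[symmetric] F_def z_def by (intro mult_left_mono block_majorant_l2 S X R) auto
  have C: "(\<Sum>x\<in>X. ?c x) \<le> 4096 * (real s + 2) ^ 4 / z * F"
  proof -
    have "(\<Sum>x\<in>X. ?c x) = (\<Sum>j\<in>{3 * s..m}. 2 / 2 ^ s * (\<Sum>q\<in>block s. \<Sum>x\<in>X. (e q j x)\<^sup>2))"
      by (subst sum.swap, intro sum.cong refl, subst sum_distrib_left[symmetric], subst sum.swap, rule refl)
    also have "\<dots> \<le> (\<Sum>j\<in>{3 * s..m}. 2 / 2 ^ s * (\<Sum>q\<in>block s. (32 * 16 ^ s / 4 ^ j)\<^sup>2 * F))"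
    proof (intro sum_mono mult_left_mono)
      fix j q assume "q \<in> block s"
      thus "(\<Sum>x\<in>X. (e q j x)\<^sup>2) \<le> (32 * 16 ^ s / 4 ^ j)\<^sup>2 * F"
        unfolding e_def F_def using block_error_l2[of q s "4 ^ j" S f X] S X by simp
    qed auto
    also have "\<dots> = (\<Sum>j\<in>{3 * s..m}. 2048 * F * ((16 ^ s)\<^sup>2 * (1/16) ^ j))"
    proof (intro sum.cong refl)
      fix j
      have "((4::real) ^ j)\<^sup>2 = 16 ^ j" by (simp add: power_mult[symmetric] power_mult mult.commute[of j 2])
      thus "2 / 2 ^ s * (\<Sum>q\<in>block s. (32 * 16 ^ s / 4 ^ j)\<^sup>2 * F) = 2048 * F * ((16 ^ s)\<^sup>2 * (1/16) ^ j)"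
        by (simp add: card_block power_mult_distrib power_divide)
    qed
    also have "\<dots> = 2048 * F * ((16 ^ s)\<^sup>2 * (\<Sum>j\<in>{3 * s..m}. (1/16) ^ j))"
      by (simp only: sum_distrib_left)
    also have "\<dots> \<le> 2048 * F * ((16 ^ s)\<^sup>2 * (2 * (1/16) ^ (3 * s)))"
    proof (intro mult_left_mono)
      show "(\<Sum>j\<in>{3 * s..m}. (1/16) ^ j) \<le> 2 * (1/16::real) ^ (3 * s)"
      proof (cases "3 * s \<le> m")
        case True
        have "(\<Sum>j=3 * s..m. (1/16::real) ^ j) = ((1/16) ^ (3 * s) - (1/16) ^ Suc m) / (1 - 1/16)"
          using True by (simp add: sum_gp)
        also have "\<dots> \<le> (1/16) ^ (3 * s) / (1/2)" by (intro frac_le) auto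
        finally show ?thesis by simp
      qed auto
    qed (use F0 in auto)
    also have "\<dots> = 4096 * (1/16) ^ s * F"
    proof -
      have "((16::real) ^ s)\<^sup>2 * (1/16) ^ (3 * s) = (1/16) ^ s"
        by (simp add: power_divide power_mult[symmetric] eval_nat_numeral power_mult_distrib power_add field_simps)
      thus ?thesis by simp
    qed
    also have "\<dots> \<le> 4096 * ((real s + 2) ^ 4 / z) * F"
    proof (intro mult_right_mono mult_left_mono F0)
      have "z \<le> 16 ^ s" unfolding z_def using sqrt2_less_2 by (intro power_mono) auto
      hence "1 / 16 ^ s \<le> (real s + 2) ^ 4 / z" using s2 z by (intro frac_le) auto
      thus "(1/16) ^ s \<le> (real s + 2) ^ 4 / z" by (simp add: power_divide)
    qed auto
    finally show ?thesis by simp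
  qed
  have "(\<Sum>x\<in>X. (block_avg (\<gamma> (J x)) s (4 ^ J x) f x)\<^sup>2) \<le> (\<Sum>x\<in>X. ?a x + (?b x + ?c x))"
    by (intro sum_mono pt)
  also have "\<dots> = (\<Sum>x\<in>X. ?a x) + ((\<Sum>x\<in>X. ?b x) + (\<Sum>x\<in>X. ?c x))" by (simp only: sum.distrib)
  also have "\<dots> \<le> 1352 * (real s + 2) ^ 4 / z * F + (2 * (2704 * HL_const * (real s + 2) ^ 4 / z * F) + 4096 * (real s + 2) ^ 4 / z * F)"
    using A B C by linarith
  also have "\<dots> = l2_const * (real s + 2) ^ 4 / z * F"
    unfolding l2_const_def by (simp add: algebra_simps add_divide_distrib)
  finally show ?thesis unfolding z_def F_def .
qed

section \<open>Weighted decay of the block maximal functions\<close>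

text \<open>
  With \<open>\<alpha>\<close> the average of \<open>1\<^sub>E\<close>, the number of divisors
  \<open>t\<close> is split at the threshold \<open>T = \<alpha> powr (- 1 / m)\<close>:
  below it, \<open>t\<close> costs the factor \<open>T\<close>; above it,
  \<open>t \<le> t ^ m / T ^ (m - 1)\<close> and the \<open>m\<close>-th moment applies.
\<close>
lemma block_avg_restricted:
  fixes h :: "int \<Rightarrow> real"
  assumes \<gamma>: "\<And>q. \<bar>\<gamma> q\<bar> \<le> 1" and N: "1 \<le> N" "N \<le> R" and m: "1 \<le> m"
    and h: "\<And>y. \<bar>h y\<bar> \<le> indicator E y"
  shows "\<bar>block_avg \<gamma> s N h x\<bar>
    \<le> 2 * (1 + (real s + 2) ^ (2 ^ m - 1)) * step_max 1 R (indicator E) x powr (1 - 1 / m)"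
proof -
  define V where "V n = (\<Sum>q\<in>block s. \<gamma> q * ramanujan_sum q (int n) / q)" for n
  define t where "t n = real (small_divisors (2 ^ Suc s) n)" for n
  define I where "I n = (indicator E (x + int n) :: real)" for n
  define \<alpha> where "\<alpha> = step_avg 1 N (indicator E) x"
  have V: "\<bar>V n\<bar> \<le> 2 * t n" for n
    unfolding V_def t_def block_def using ramanujan_block_bound[OF \<gamma>, where s = s and n = n] by simp
  have I: "I n = 0 \<or> I n = 1" for n unfolding I_def by (auto simp: indicator_def)
  have \<alpha>I: "\<alpha> = (\<Sum>n=1..N. I n) / N" unfolding \<alpha>_def step_avg_def I_def by simp
  have \<alpha>0: "0 \<le> \<alpha>" unfolding \<alpha>I using I by (intro divide_nonneg_nonneg sum_nonneg) (metis order_refl zero_le_one, simp)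
  have "\<bar>block_avg \<gamma> s N h x\<bar> \<le> (\<Sum>n=1..N. \<bar>V n / N * h (x + int n)\<bar>)"
    unfolding block_avg_kernel V_def by (rule sum_abs)
  also have "\<dots> \<le> (\<Sum>n=1..N. 2 * t n / N * I n)"
    unfolding abs_mult abs_divide abs_of_nat
    using V h by (intro sum_mono mult_mono divide_right_mono) (auto simp: I_def t_def)
  also have "\<dots> = 2 * (\<Sum>n=1..N. t n * I n) / N"
    by (simp add: sum_distrib_left sum_divide_distrib mult_ac)
  finally have 1: "\<bar>block_avg \<gamma> s N h x\<bar> \<le> 2 * (\<Sum>n=1..N. t n * I n) / N" .
  show ?thesis
  proof (cases "\<alpha> = 0")
    case True
    hence "(\<Sum>n=1..N. I n) = 0" unfolding \<alpha>I using N by simp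
    hence "\<forall>n\<in>{1..N}. I n = 0"
      by (subst (asm) sum_nonneg_eq_0_iff) (auto simp: I_def)
    hence "(\<Sum>n=1..N. t n * I n) = 0" by simp
    moreover have "0 \<le> 2 * (1 + (real s + 2) ^ (2 ^ m - 1)) * step_max 1 R (indicator E) x powr (1 - 1 / m)" by simp
    ultimately show ?thesis using 1 by simp
  next
    case False
    hence \<alpha>: "0 < \<alpha>" using \<alpha>0 by simp
    define T where "T = \<alpha> powr (- 1 / m)"
    have T: "0 < T" unfolding T_def using \<alpha> by simp
    have Tm: "T ^ (m - 1) = \<alpha> powr (- (1 - 1 / m))"
      unfolding T_def using \<alpha> m by (simp add: powr_realpow[symmetric] powr_powr field_simps of_nat_diff)
    have pt: "t n * I n \<le> T * I n + t n ^ m / T ^ (m - 1)" for n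
    proof (cases "I n = 0 \<or> t n \<le> T")
      case True
      have "0 \<le> t n ^ m / T ^ (m - 1)" unfolding t_def using T by simp
      thus ?thesis using True I[of n] by auto
    next
      case False
      hence I1: "I n = 1" and tT: "T \<le> t n" using I[of n] by auto
      have "T ^ (m - 1) * t n \<le> t n ^ (m - 1) * t n"
        using tT T by (intro mult_right_mono power_mono) auto
      also have "\<dots> = t n ^ m" using m by (cases m) auto
      finally have "t n \<le> t n ^ m / T ^ (m - 1)" using T by (simp add: field_simps)
      thus ?thesis using I1 T by simp
    qed
    have "(\<Sum>n=1..N. t n * I n) \<le> (\<Sum>n=1..N. T * I n + t n ^ m / T ^ (m - 1))" by (intro sum_mono pt)
    also have "\<dots> = T * (\<alpha> * N) + (\<Sum>n=1..N. t n ^ m) / T ^ (m - 1)"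
    proof -
      have aN: "(\<Sum>n=1..N. I n) = \<alpha> * N" unfolding \<alpha>I using N by simp
      show ?thesis
        unfolding sum.distrib sum_distrib_left[symmetric] sum_divide_distrib[symmetric] aN ..
    qed
    also have "\<dots> \<le> T * (\<alpha> * N) + (N * (real s + 2) ^ (2 ^ m - 1)) / T ^ (m - 1)"
    proof (intro add_left_mono divide_right_mono)
      have "(\<Sum>n=1..N. t n ^ m) \<le> N * harm (2 ^ Suc s) ^ (2 ^ m - 1)"
        unfolding t_def by (rule small_divisors_moment)
      also have "\<dots> \<le> N * (real s + 2) ^ (2 ^ m - 1)"
        using harm_pow2_le[of "Suc s"] by (intro mult_left_mono power_mono harm_nonneg) auto
      finally show "(\<Sum>n=1..N. t n ^ m) \<le> N * (real s + 2) ^ (2 ^ m - 1)" .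
    qed (use T in auto)
    also have "\<dots> = N * ((1 + (real s + 2) ^ (2 ^ m - 1)) * \<alpha> powr (1 - 1 / m))"
    proof -
      have a: "T * \<alpha> = \<alpha> powr (1 - 1 / m)"
        unfolding T_def using \<alpha> by (simp add: powr_diff powr_minus field_simps)
      have b: "z / T ^ (m - 1) = z * \<alpha> powr (1 - 1 / m)" for z
        unfolding Tm using \<alpha> by (simp add: powr_minus divide_simps)
      show ?thesis unfolding b by (simp add: a[symmetric] algebra_simps)
    qed
    finally have "2 * (\<Sum>n=1..N. t n * I n) / N \<le> 2 * (1 + (real s + 2) ^ (2 ^ m - 1)) * \<alpha> powr (1 - 1 / m)"
      using N by (simp add: field_simps)
    also have "\<dots> \<le> 2 * (1 + (real s + 2) ^ (2 ^ m - 1)) * step_max 1 R (indicator E) x powr (1 - 1 / m)"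
      unfolding \<alpha>_def using N \<alpha>0 m by (intro mult_left_mono powr_mono2 step_avg_le_max) (auto simp: \<alpha>_def)
    finally show ?thesis using 1 by linarith
  qed
qed

text \<open>
  Hoelder's inequality for two sums of which only upper bounds are known.
\<close>
lemma Young_interpolation_sum:
  fixes u v g :: "'a \<Rightarrow> real"
  assumes \<theta>: "0 \<le> \<theta>" "\<theta> \<le> 1" and a: "0 < a" and b: "0 < b"
    and u: "\<And>x. x \<in> X \<Longrightarrow> 0 \<le> u x" "sum u X \<le> a" and v: "\<And>x. x \<in> X \<Longrightarrow> 0 \<le> v x" "sum v X \<le> b"
    and g: "\<And>x. x \<in> X \<Longrightarrow> 0 < u x \<Longrightarrow> 0 < v x \<Longrightarrow> g x \<le> u x powr \<theta> * v x powr (1 - \<theta>)"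
      "\<And>x. x \<in> X \<Longrightarrow> u x = 0 \<or> v x = 0 \<Longrightarrow> g x \<le> 0"
  shows "sum g X \<le> a powr \<theta> * b powr (1 - \<theta>)"
proof -
  have "sum g X \<le> (\<Sum>x\<in>X. a powr \<theta> * b powr (1 - \<theta>) * (\<theta> * (u x / a) + (1 - \<theta>) * (v x / b)))"
  proof (intro sum_mono)
    fix x assume x: "x \<in> X"
    show "g x \<le> a powr \<theta> * b powr (1 - \<theta>) * (\<theta> * (u x / a) + (1 - \<theta>) * (v x / b))"
    proof (cases "u x = 0 \<or> v x = 0")
      case True
      have "0 \<le> a powr \<theta> * b powr (1 - \<theta>) * (\<theta> * (u x / a) + (1 - \<theta>) * (v x / b))"
        using \<theta> a b u(1)[OF x] v(1)[OF x] by simp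
      thus ?thesis using g(2)[OF x True] by linarith
    next
      case False
      hence p: "0 < u x" "0 < v x" using u(1)[OF x] v(1)[OF x] by auto
      have "g x \<le> u x powr \<theta> * v x powr (1 - \<theta>)" by (rule g(1)[OF x p])
      also have "\<dots> = a powr \<theta> * b powr (1 - \<theta>) * ((u x / a) powr \<theta> * (v x / b) powr (1 - \<theta>))"
        using a b p by (simp add: powr_divide)
      also have "\<dots> \<le> a powr \<theta> * b powr (1 - \<theta>) * (\<theta> * (u x / a) + (1 - \<theta>) * (v x / b))"
        using \<theta> a b p by (intro mult_left_mono Youngs_inequality_0) auto
      finally show ?thesis .
    qed
  qed
  also have "\<dots> = a powr \<theta> * b powr (1 - \<theta>) * (\<theta> * (sum u X / a) + (1 - \<theta>) * (sum v X / b))"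
    unfolding sum_distrib_left[symmetric] sum.distrib sum_divide_distrib[symmetric] ..
  also have "\<dots> \<le> a powr \<theta> * b powr (1 - \<theta>) * (\<theta> * 1 + (1 - \<theta>) * 1)"
    using \<theta> a b u v by (intro mult_left_mono add_mono) auto
  finally show ?thesis by simp
qed

text \<open>
  Bernoulli's inequality for \<open>1 + \<delta> = y powr (1 / k)\<close>.
\<close>
lemma polynomial_le_exponential:
  assumes k: "0 < k" and y: "1 < (y::real)"
  shows "\<exists>C>0. \<forall>s::nat. (real s + 2) powr k \<le> C * y ^ s"
proof -
  define \<delta> where "\<delta> = y powr (1 / k) - 1"
  have \<delta>: "0 < \<delta>" unfolding \<delta>_def using k y by simp
  have e: "(1 + \<delta>) powr k = y" unfolding \<delta>_def using k y by (simp add: powr_powr)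
  have "(real s + 2) powr k \<le> (1 / \<delta>) powr k * y ^ 2 * y ^ s" for s :: nat
  proof -
    have "1 + real (s + 2) * \<delta> \<le> (1 + \<delta>) ^ (s + 2)" using \<delta> by (intro Bernoulli_inequality) auto
    hence "1 + (real s + 2) * \<delta> \<le> (1 + \<delta>) ^ (s + 2)" by (simp only: of_nat_add of_nat_numeral)
    hence "(real s + 2) * \<delta> \<le> (1 + \<delta>) ^ (s + 2)" by linarith
    hence "real s + 2 \<le> 1 / \<delta> * (1 + \<delta>) ^ (s + 2)" using \<delta> by (simp add: field_simps)
    hence "(real s + 2) powr k \<le> (1 / \<delta> * (1 + \<delta>) ^ (s + 2)) powr k" using k by (intro powr_mono2) auto
    also have "\<dots> = (1 / \<delta>) powr k * ((1 + \<delta>) ^ (s + 2)) powr k"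
      by (rule powr_mult)
    also have "((1 + \<delta>) ^ (s + 2)) powr k = y ^ (s + 2)"
    proof -
      have "((1 + \<delta>) ^ n) powr k = ((1 + \<delta>) powr k) ^ n" for n :: nat
        using \<delta> by (simp add: powr_realpow[symmetric] powr_powr mult.commute)
      thus ?thesis unfolding e .
    qed
    finally show ?thesis by (simp add: power_add power2_eq_square mult_ac)
  qed
  thus ?thesis using \<delta> y k by (intro exI[of _ "(1 / \<delta>) powr k * y ^ 2"]) auto
qed

text \<open>
  All conditions hold in the limit \<open>m \<rightarrow> \<infinity>\<close>. The number
  \<open>1 / m\<close> will serve as the loss in \<open>block_avg_restricted\<close>, as the
  parameter of the interpolation lemma and as the proportion of the \<open>\<ell>\<^sup>2\<close>
  bound.
\<close>
lemma exponents_exist: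
  fixes p p2 b :: real
  assumes "1 < p" "p2 < p" "1 < b"
  shows "\<exists>m::nat. (2::nat) \<le> m \<and> p2 \<le> p / (1 + 1/m) - 2 * (1/m) \<and> 0 < p / (1 + 1/m) - 2 * (1/m) \<and>
     (1 + (1/m) * p / (1 - 1/m)) / (1 - 1/m) \<le> b \<and> 0 < 1 - (1/m) * p / (1 - 1/m)"
proof -
  define t where "t m = inverse (real m)" for m :: nat
  have t: "t \<longlonglongrightarrow> 0" unfolding t_def by (rule tendsto_inverse_0_at_top[OF filterlim_real_sequentially])
  have "(\<lambda>m. p / (1 + t m) - 2 * t m) \<longlonglongrightarrow> p / (1 + 0) - 2 * 0" by (intro tendsto_intros t) auto
  hence l1: "(\<lambda>m. p / (1 + t m) - 2 * t m) \<longlonglongrightarrow> p" by simp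
  have 1: "\<forall>\<^sub>F m in sequentially. p2 < p / (1 + t m) - 2 * t m" by (rule order_tendstoD(1)[OF l1 assms(2)])
  have 2: "\<forall>\<^sub>F m in sequentially. 0 < p / (1 + t m) - 2 * t m" by (rule order_tendstoD(1)[OF l1]) (use assms in simp)
  have "(\<lambda>m. (1 + t m * p / (1 - t m)) / (1 - t m)) \<longlonglongrightarrow> (1 + 0 * p / (1 - 0)) / (1 - 0)" by (intro tendsto_intros t) auto
  hence l3: "(\<lambda>m. (1 + t m * p / (1 - t m)) / (1 - t m)) \<longlonglongrightarrow> 1" by simp
  have 3: "\<forall>\<^sub>F m in sequentially. (1 + t m * p / (1 - t m)) / (1 - t m) < b" by (rule order_tendstoD(2)[OF l3 assms(3)])
  have "(\<lambda>m. 1 - t m * p / (1 - t m)) \<longlonglongrightarrow> 1 - 0 * p / (1 - 0)" by (intro tendsto_intros t) auto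
  hence l4: "(\<lambda>m. 1 - t m * p / (1 - t m)) \<longlonglongrightarrow> 1" by simp
  have 4: "\<forall>\<^sub>F m in sequentially. 0 < 1 - t m * p / (1 - t m)" by (rule order_tendstoD(1)[OF l4]) simp
  have "\<forall>\<^sub>F m in sequentially. (2::nat) \<le> m \<and> p2 < p / (1 + t m) - 2 * t m \<and> 0 < p / (1 + t m) - 2 * t m \<and>
      (1 + t m * p / (1 - t m)) / (1 - t m) < b \<and> 0 < 1 - t m * p / (1 - t m)"
    using 1 2 3 4 eventually_ge_at_top[of 2] by eventually_elim auto
  then obtain m where "(2::nat) \<le> m \<and> p2 < p / (1 + t m) - 2 * t m \<and> 0 < p / (1 + t m) - 2 * t m \<and>
      (1 + t m * p / (1 - t m)) / (1 - t m) < b \<and> 0 < 1 - t m * p / (1 - t m)"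
    unfolding eventually_sequentially by blast
  thus ?thesis unfolding t_def by (intro exI[of _ m]) (auto simp: divide_inverse)
qed

lemma l2_const_pos: "0 < l2_const"
  unfolding l2_const_def using HL_const_nonneg by simp

lemma block_avg_zero: "(\<And>y. f y = 0) \<Longrightarrow> block_avg \<gamma> s N f x = 0"
  unfolding block_avg_def ramanujan_avg_def by simp

lemma block_avg_scale: "block_avg \<gamma> s N (\<lambda>y. c * f y) x = c * block_avg \<gamma> s N f x"
  unfolding block_avg_kernel by (simp add: sum_distrib_left mult_ac)

lemma block_avg_sum: "block_avg \<gamma> s N (\<lambda>y. \<Sum>k\<in>I. F k y) x = (\<Sum>k\<in>I. block_avg \<gamma> s N (F k) x)"
  unfolding block_avg_kernel sum_distrib_left by (rule sum.swap)

text \<open>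
  The restricted bounds for the interpolation lemma. For a corner \<open>(p', b')\<close> the
  quantity \<open>T h powr p' * w powr b'\<close> is the product of
  \<open>(T h)\<^sup>2\<close> to the power \<open>t\<close> and
  \<open>T h powr p1 * w powr b1\<close> to the power \<open>1 - t\<close>. The first sum
  decays in \<open>s\<close>; the second is bounded by a power of \<open>s\<close> because
  \<open>p1 * (1 - t)\<close> still exceeds the improved index \<open>p0\<close> and
  \<open>b1\<close> is an admissible power of the weight.
\<close>
lemma block_maximal_weighted:
  assumes p: "1 < p" and w: "\<And>x. 0 < w x" and K: "Ap_bound p w K"
  shows "\<exists>C \<rho>. 0 \<le> C \<and> 0 < \<rho> \<and> \<rho> < 1 \<and> (\<forall>\<gamma> s k J X S f.
    (\<forall>j q. \<bar>\<gamma> j q\<bar> \<le> 1) \<longrightarrow> finite X \<longrightarrow> finite S \<longrightarrow> (\<forall>y. y \<notin> S \<longrightarrow> f y = 0) \<longrightarrow>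
    (\<forall>x\<in>X. s \<le> J x \<and> J x \<le> k) \<longrightarrow>
    (\<Sum>x\<in>X. \<bar>block_avg (\<gamma> (J x)) s (4 ^ J x) f x\<bar> powr p * w x) \<le> C * \<rho> ^ s * (\<Sum>y\<in>S. \<bar>f y\<bar> powr p * w y))"
proof -
  obtain p0 b K' where p0: "1 < p0" "p0 < p" and b: "1 < b"
    and K': "\<And>b'. 0 < b' \<Longrightarrow> b' \<le> b \<Longrightarrow> Ap_bound p0 (\<lambda>x. w x powr b') K'"
    using Ap_open[OF p w K] by blast
  have w0: "w x \<noteq> 0" for x using w[of x] by simp
  have K1: "1 \<le> K'" using Ap_bound_ge_1[OF p0(1) _ K'[of 1]] w0 b by simp
  \<comment> \<open>Room between the weak-type index \<open>p0\<close> and \<open>p\<close>: strong-type bounds will be used at \<open>p2\<close>.\<close>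
  define p2 where "p2 = (p0 + p) / 2"
  have p2: "p0 < p2" "p2 < p" unfolding p2_def using p0 by auto
  obtain m :: nat where m: "2 \<le> m" and e1: "p2 \<le> p / (1 + 1/m) - 2 * (1/m)" and e2: "0 < p / (1 + 1/m) - 2 * (1/m)"
    and e3: "(1 + (1/m) * p / (1 - 1/m)) / (1 - 1/m) \<le> b" and e4: "0 < 1 - (1/m) * p / (1 - 1/m)"
    using exponents_exist[OF p p2(2) b] by (elim exE conjE) (rule that)
  define t where "t = 1 / real m"
  have t: "0 < t" "t \<le> 1/2" unfolding t_def using m by (auto simp: field_simps)
  define c where "c = (2::nat) ^ m - 1"
  define H where "H s = 2 * (1 + (real s + 2) ^ c)" for s :: nat
  have H1: "1 \<le> H s" for s
  proof -
    have "1 \<le> 2 * (1 + z)" if "0 \<le> z" for z :: real using that by simp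
    thus ?thesis unfolding H_def by simp
  qed
  define Kr where "Kr = K' * 4 powr p0 / (1 - 2 powr (p0 - p2))"
  have Kr: "1 \<le> Kr"
  proof -
    have "(2::real) powr (p0 - p2) < 1" using p2 by (intro powr_less_one) auto
    moreover have "1 \<le> (4::real) powr p0" using p0 by (intro ge_one_powr_ge_zero) auto
    hence "1 * 1 \<le> K' * 4 powr p0" using K1 by (intro mult_mono) auto
    moreover have "0 < (2::real) powr (p0 - p2)" by simp
    ultimately have "1 - 2 powr (p0 - p2) \<le> K' * 4 powr p0" "0 < 1 - (2::real) powr (p0 - p2)"
      by linarith+
    thus ?thesis unfolding Kr_def by (simp only: pos_le_divide_eq mult_1)
  qed
  define a where "a s = l2_const * (real s + 2) ^ 4 / sqrt 2 ^ s" for s :: nat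
  have a: "0 < a s" for s unfolding a_def using l2_const_pos by simp
  define \<beta> where "\<beta> s = 2 powr b * Kr * H s powr (4 * p)" for s
  have \<beta>: "1 \<le> \<beta> s" for s
  proof -
    have "1 * 1 * 1 \<le> 2 powr b * Kr * H s powr (4 * p)"
      using Kr b p H1[of s] by (intro mult_mono ge_one_powr_ge_zero) auto
    thus ?thesis unfolding \<beta>_def by simp
  qed
  define B where "B s = a s powr t * \<beta> s powr (1 - t)" for s
  have main: "(\<Sum>x\<in>X. \<bar>block_avg (\<gamma> (J x)) s (4 ^ J x) f x\<bar> powr p * w x) \<le> interp_const p t * B s * (\<Sum>y\<in>S. \<bar>f y\<bar> powr p * w y)"
    if \<gamma>: "\<And>j q. \<bar>\<gamma> j q\<bar> \<le> 1" and X: "finite X" and S: "finite S" and f: "\<And>y. y \<notin> S \<Longrightarrow> f y = 0"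
      and J: "\<And>x. x \<in> X \<Longrightarrow> s \<le> J x \<and> J x \<le> k"
    for \<gamma> :: "nat \<Rightarrow> nat \<Rightarrow> real" and s k J X S and f :: "int \<Rightarrow> real"
  proof -
    define T where "T f x = \<bar>block_avg (\<gamma> (J x)) s (4 ^ J x) f x\<bar>" for f x
    define R where "R = (4::nat) ^ k"
    have R: "1 \<le> R" unfolding R_def by simp
    have "(\<Sum>x\<in>X. T f x powr p * w x) \<le> interp_const p t * B s * (\<Sum>y\<in>S. \<bar>f y\<bar> powr p * w y)"
    proof (rule interpolation_from_level_sets[where T = T])
      show "0 \<le> T f x" for f x unfolding T_def by simp
      show "T (\<lambda>y. c * f y) x = c * T f x" if "0 < c" for c f x
        unfolding T_def block_avg_scale using that by (simp add: abs_mult)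
      show "T (\<lambda>y. \<Sum>k\<in>I. F k y) x \<le> (\<Sum>k\<in>I. T (F k) x)" for I :: "(int \<times> int) set" and F x
        unfolding T_def block_avg_sum by (rule sum_abs)
      show "0 \<le> B s" unfolding B_def by simp
      fix E :: "int set" and h :: "int \<Rightarrow> real" and i :: int and \<sigma> \<tau> :: real
      assume E: "finite E" and lev: "\<forall>y\<in>E. 2 powr of_int i \<le> w y \<and> w y \<le> 2 * 2 powr of_int i"
        and h: "\<forall>y. \<bar>h y\<bar> \<le> indicator E y" and \<sigma>: "\<sigma> \<in> {t, -t}" and \<tau>: "\<tau> \<in> {t, -t}"
      define p' where "p' = p / (1 + \<sigma>)"
      define b' where "b' = 1 + \<tau> * p / (1 + \<sigma>)"
      define p1 where "p1 = (p' - 2 * t) / (1 - t)"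
      define b1 where "b1 = b' / (1 - t)"
      define W where "W = (2::real) powr of_int i"
      have W: "0 < W" unfolding W_def by simp
      have \<sigma>b: "1 - t \<le> 1 + \<sigma>" "1 + \<sigma> \<le> 1 + t" and \<tau>b: "- t \<le> \<tau>" "\<tau> \<le> t" using \<sigma> \<tau> t by auto
      have p'b: "p / (1 + t) \<le> p'" "p' \<le> p / (1 - t)"
        unfolding p'_def using \<sigma>b t p by (auto intro!: divide_left_mono)
      have p'0: "0 < p'" unfolding p'_def using p \<sigma>b t by simp
      have p1: "p1 * (1 - t) = p' - 2 * t" "0 < p1" "p2 \<le> p1 * (1 - t)"
      proof -
        show 1: "p1 * (1 - t) = p' - 2 * t" unfolding p1_def using t by simp
        have "p2 \<le> p' - 2 * t" "0 < p' - 2 * t" using e1 e2 p'b(1) unfolding t_def[symmetric] by linarith+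
        thus "p2 \<le> p1 * (1 - t)" "0 < p1" unfolding 1 p1_def using t by auto
      qed
      have p14: "p1 \<le> 4 * p"
      proof -
        have "p / (1 - t) \<le> p / (1/2)" using t p by (intro divide_left_mono) auto
        hence "p' \<le> 2 * p" using p'b(2) by simp
        hence "p1 \<le> (2 * p) / (1/2)" unfolding p1_def using t p by (intro frac_le) auto
        thus ?thesis by simp
      qed
      have ab: "\<bar>\<tau> * p / (1 + \<sigma>)\<bar> \<le> t * p / (1 - t)"
        unfolding abs_divide abs_mult using \<sigma>b \<tau>b t p by (intro frac_le mult_mono) auto
      have b'0: "0 < b'" using ab e4 unfolding b'_def t_def[symmetric] by linarith
      have b1: "0 < b1" "b1 \<le> b" "b1 * (1 - t) = b'"
      proof -
        show "0 < b1" unfolding b1_def using b'0 t by simp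
        show "b1 * (1 - t) = b'" unfolding b1_def using t by simp
        have "b1 \<le> (1 + t * p / (1 - t)) / (1 - t)"
          unfolding b1_def b'_def using t by (intro divide_right_mono add_left_mono order_trans[OF abs_ge_self ab]) auto
        thus "b1 \<le> b" using e3 unfolding t_def[symmetric] by linarith
      qed
      have T0: "0 \<le> T h x" for x unfolding T_def by simp
      have "(\<Sum>x\<in>X. T h x powr p' * w x powr b') \<le> B s * card E * W powr b'"
      proof (cases "E = {}")
        case True
        hence "h y = 0" for y using h by (metis abs_le_zero_iff indicator_simps(2) empty_iff)
        hence "T h x = 0" for x unfolding T_def by (simp add: block_avg_zero)
        thus ?thesis using True by simp
      next
        case False
        hence cE: "0 < real (card E)" using E by (simp add: card_gt_0_iff)
        define M where "M x = step_max 1 R (indicator E) x" for x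
        have M: "0 \<le> M x" "M x \<le> 1" for x unfolding M_def using step_max_indicator_bounds[OF R] by auto
        have TM: "T h x \<le> H s * M x powr (1 - t)" if x: "x \<in> X" for x
        proof -
          have "(4::nat) ^ J x \<le> R" unfolding R_def using J[OF x] by (intro power_increasing) auto
          thus ?thesis unfolding T_def H_def c_def M_def t_def
            using h m by (intro block_avg_restricted \<gamma>) auto
        qed
        have "(\<Sum>x\<in>X. T h x powr p' * w x powr b') \<le> (a s * card E) powr t * (\<beta> s * (card E * W powr b1)) powr (1 - t)"
        proof (rule Young_interpolation_sum[where u = "\<lambda>x. (T h x)\<^sup>2" and v = "\<lambda>x. T h x powr p1 * w x powr b1"])
          show "(\<Sum>x\<in>X. (T h x)\<^sup>2) \<le> a s * card E"
          proof -
            have hE: "h y = 0" if "y \<notin> E" for y using h[rule_format, of y] that by simp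
            have "(\<Sum>x\<in>X. (T h x)\<^sup>2) \<le> a s * (\<Sum>y\<in>E. (h y)\<^sup>2)"
              unfolding T_def a_def power2_abs by (intro block_maximal_l2[where m = k] \<gamma> E hE X J)
            also have "\<dots> \<le> a s * (\<Sum>y\<in>E. 1)"
            proof (intro mult_left_mono sum_mono)
              fix y assume "y \<in> E"
              hence "\<bar>h y\<bar> \<le> 1" using h[rule_format, of y] by simp
              thus "(h y)\<^sup>2 \<le> 1" using abs_square_le_1 by blast
            qed (use a[of s] in auto)
            finally show ?thesis by simp
          qed
          show "(\<Sum>x\<in>X. T h x powr p1 * w x powr b1) \<le> \<beta> s * (card E * W powr b1)"
          proof -
            have "(\<Sum>x\<in>X. T h x powr p1 * w x powr b1) \<le> (\<Sum>x\<in>X. (H s powr (4 * p) * M x powr p2) * w x powr b1)"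
            proof (intro sum_mono mult_right_mono)
              fix x assume x: "x \<in> X"
              have "T h x powr p1 \<le> (H s * M x powr (1 - t)) powr p1"
                using TM[OF x] T0 p1 by (intro powr_mono2) auto
              also have "\<dots> = H s powr p1 * M x powr (p1 * (1 - t))"
                using H1[of s] M[of x] by (simp add: powr_mult powr_powr mult.commute)
              also have "\<dots> \<le> H s powr (4 * p) * M x powr p2"
                using H1[of s] M[of x] p1 p14 by (intro mult_mono powr_mono powr_mono') auto
              finally show "T h x powr p1 \<le> H s powr (4 * p) * M x powr p2" .
            qed auto
            also have "\<dots> = H s powr (4 * p) * (\<Sum>x\<in>X. M x powr p2 * w x powr b1)"
              by (simp only: sum_distrib_left mult.assoc)
            also have "\<dots> \<le> H s powr (4 * p) * (Kr * (\<Sum>y\<in>E. w y powr b1))"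
              unfolding M_def Kr_def
              by (intro mult_left_mono restricted_strong_type[OF p0(1) _ K'[OF b1(1,2)] p2(1) E X R]) (auto simp: w0)
            also have "\<dots> \<le> H s powr (4 * p) * (Kr * (\<Sum>y\<in>E. 2 powr b * W powr b1))"
            proof (intro mult_left_mono sum_mono)
              fix y assume "y \<in> E"
              hence "w y \<le> 2 * W" using lev unfolding W_def by blast
              hence "w y powr b1 \<le> (2 * W) powr b1" using b1 w[of y] by (intro powr_mono2) auto
              also have "\<dots> = 2 powr b1 * W powr b1" using W by (simp add: powr_mult)
              also have "\<dots> \<le> 2 powr b * W powr b1" using b1 by (intro mult_right_mono powr_mono) auto
              finally show "w y powr b1 \<le> 2 powr b * W powr b1" .
            qed (use Kr in auto)
            also have "\<dots> = \<beta> s * (card E * W powr b1)" unfolding \<beta>_def by simp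
            finally show ?thesis .
          qed
          show "T h x powr p' * w x powr b' \<le> (T h x)\<^sup>2 powr t * (T h x powr p1 * w x powr b1) powr (1 - t)"
            if "0 < (T h x)\<^sup>2" for x
          proof -
            have Tp: "0 < T h x" using that T0[of x] by (simp add: order_less_le)
            have "(T h x)\<^sup>2 powr t * (T h x powr p1 * w x powr b1) powr (1 - t)
               = (T h x powr (2 * t) * T h x powr (p1 * (1 - t))) * w x powr (b1 * (1 - t))"
            proof -
              have "(T h x)\<^sup>2 powr t = T h x powr (2 * t)"
                using Tp powr_powr[of "T h x" 2 t] by simp
              moreover have "(T h x powr p1 * w x powr b1) powr (1 - t) = T h x powr (p1 * (1 - t)) * w x powr (b1 * (1 - t))"
                by (simp only: powr_mult powr_powr)
              ultimately show ?thesis by (simp only: mult.assoc)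
            qed
            also have "\<dots> = T h x powr p' * w x powr b'"
              unfolding powr_add[symmetric] p1(1) b1(3) by simp
            finally show ?thesis by simp
          qed
          show "T h x powr p' * w x powr b' \<le> 0" if "(T h x)\<^sup>2 = 0 \<or> T h x powr p1 * w x powr b1 = 0" for x
            using that w0 by auto
        qed (use t cE a[of s] \<beta>[of s] W in \<open>auto intro!: mult_pos_pos\<close>)
        also have "\<dots> = B s * card E * W powr b'"
        proof -
          have "(a s * card E) powr t * (\<beta> s * (card E * W powr b1)) powr (1 - t)
            = B s * (real (card E) powr t * real (card E) powr (1 - t)) * W powr (b1 * (1 - t))"
            unfolding B_def using a[of s] \<beta>[of s] cE W by (simp add: powr_mult powr_powr mult_ac)
          thus ?thesis unfolding powr_add[symmetric] b1(3) using cE by simp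
        qed
        finally show ?thesis .
      qed
      thus "(\<Sum>x\<in>X. T h x powr (p / (1 + \<sigma>)) * w x powr (1 + \<tau> * p / (1 + \<sigma>)))
          \<le> B s * card E * (2 powr of_int i) powr (1 + \<tau> * p / (1 + \<sigma>))"
        unfolding p'_def b'_def W_def .
    qed (use p t w X S f in auto)
    thus ?thesis unfolding T_def .
  qed
  have p4: "0 < 4 * t + 4 * p * real c"
    using t p by (intro add_pos_nonneg) auto
  have y1: "1 < (2::real) powr (t / 4)" using t by simp
  obtain C1 where C1: "C1 > 0" "\<And>s::nat. (real s + 2) powr (4 * t + 4 * p * real c) \<le> C1 * (2 powr (t / 4)) ^ s"
    using polynomial_le_exponential[OF p4 y1] by blast
  \<comment> \<open>The \<open>\<ell>\<^sup>2\<close> decay contributes \<open>2 powr (- t / 2)\<close>; half of it pays for the powers of \<open>s\<close>.\<close>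
  define \<rho> where "\<rho> = (2::real) powr (- t / 4)"
  have \<rho>: "0 < \<rho>" "\<rho> < 1" unfolding \<rho>_def using t powr_less_one[of 2 "- t / 4"] by auto
  define C2 where "C2 = l2_const powr t * (2 powr b * Kr * 4 powr (4 * p)) * C1"
  have C2: "0 \<le> C2" unfolding C2_def using C1 Kr by simp
  have Bs: "B s \<le> C2 * \<rho> ^ s" for s
  proof -
    define u where "u = real s + 2"
    have u: "1 \<le> u" unfolding u_def by simp
    have uc: "1 \<le> u ^ c" using u by (rule one_le_power)
    have "\<beta> s powr (1 - t) \<le> \<beta> s powr 1" using \<beta>[of s] t by (intro powr_mono) auto
    also have "\<dots> = \<beta> s" using \<beta>[of s] by simp
    also have "\<dots> \<le> 2 powr b * Kr * (4 * u ^ c) powr (4 * p)"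
      unfolding \<beta>_def using H1[of s] Kr uc p unfolding H_def u_def[symmetric]
      by (intro mult_left_mono powr_mono2) auto
    also have "\<dots> = 2 powr b * Kr * 4 powr (4 * p) * u powr (4 * p * real c)"
      using u by (simp add: powr_mult powr_realpow[symmetric] powr_powr mult_ac)
    finally have 1: "\<beta> s powr (1 - t) \<le> 2 powr b * Kr * 4 powr (4 * p) * u powr (4 * p * real c)" .
    have sq: "sqrt 2 ^ s = (2::real) powr (real s / 2)"
      by (simp add: powr_half_sqrt[symmetric] powr_power mult.commute)
    have 2: "a s powr t = l2_const powr t * u powr (4 * t) * 2 powr (- t * real s / 2)"
    proof -
      have 3: "(u ^ 4) powr t = u powr (4 * t)" using u powr_powr[of u 4 t] by simp
      have 4: "((2::real) powr (real s / 2)) powr t = inverse (2 powr (- t * real s / 2))"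
        by (simp add: powr_powr powr_minus mult.commute)
      show ?thesis
        unfolding a_def u_def[symmetric] sq powr_mult powr_divide 3 4
        by (simp only: inverse_eq_divide divide_divide_eq_right div_by_1)
    qed
    have "B s \<le> (l2_const powr t * u powr (4 * t) * 2 powr (- t * real s / 2)) * (2 powr b * Kr * 4 powr (4 * p) * u powr (4 * p * real c))"
      unfolding B_def 2 using 1 by (intro mult_left_mono) auto
    also have "\<dots> = l2_const powr t * (2 powr b * Kr * 4 powr (4 * p)) * u powr (4 * t + 4 * p * real c) * 2 powr (- t * real s / 2)"
      unfolding powr_add by (simp add: mult_ac)
    also have "\<dots> \<le> l2_const powr t * (2 powr b * Kr * 4 powr (4 * p)) * (C1 * (2 powr (t / 4)) ^ s) * 2 powr (- t * real s / 2)"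
      unfolding u_def using C1(2)[of s] Kr by (intro mult_left_mono mult_right_mono) auto
    also have "\<dots> = C2 * ((2 powr (t / 4)) ^ s * 2 powr (- t * real s / 2))" unfolding C2_def by (simp only: mult_ac)
    also have "(2 powr (t / 4)) ^ s * 2 powr (- t * real s / 2) = \<rho> ^ s"
    proof -
      have pp: "((2::real) powr z) ^ s = 2 powr (z * real s)" for z
        by (simp add: powr_power mult.commute)
      show ?thesis unfolding \<rho>_def pp powr_add[symmetric] by (simp add: field_simps)
    qed
    finally show ?thesis .
  qed
  have ic: "0 \<le> interp_const p t" unfolding interp_const_def by simp
  show ?thesis
  proof (rule exI[of _ "interp_const p t * C2"], rule exI[of _ \<rho>], intro conjI allI impI)
    show "0 \<le> interp_const p t * C2" using ic C2 by simp
    fix \<gamma> :: "nat \<Rightarrow> nat \<Rightarrow> real" and s k :: nat and J :: "int \<Rightarrow> nat" and X S :: "int set" and f :: "int \<Rightarrow> real"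
    assume as: "\<forall>j q. \<bar>\<gamma> j q\<bar> \<le> 1" "finite X" "finite S" "\<forall>y. y \<notin> S \<longrightarrow> f y = 0" "\<forall>x\<in>X. s \<le> J x \<and> J x \<le> k"
    have "(\<Sum>x\<in>X. \<bar>block_avg (\<gamma> (J x)) s (4 ^ J x) f x\<bar> powr p * w x) \<le> interp_const p t * B s * (\<Sum>y\<in>S. \<bar>f y\<bar> powr p * w y)"
      by (rule main) (use as in auto)
    also have "\<dots> \<le> interp_const p t * (C2 * \<rho> ^ s) * (\<Sum>y\<in>S. \<bar>f y\<bar> powr p * w y)"
      using Bs[of s] ic by (intro mult_right_mono mult_left_mono sum_nonneg mult_nonneg_nonneg less_imp_le[OF w]) auto
    finally show "(\<Sum>x\<in>X. \<bar>block_avg (\<gamma> (J x)) s (4 ^ J x) f x\<bar> powr p * w x)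
      \<le> interp_const p t * C2 * \<rho> ^ s * (\<Sum>y\<in>S. \<bar>f y\<bar> powr p * w y)" by (simp only: mult.assoc)
  qed (use \<rho> in auto)
qed

text \<open>
  Since the block norms decay geometrically, one block dominates up to a factor
  \<open>r ^ s\<close> with \<open>r\<close> so close to one that
  \<open>r powr (- p * s) * \<rho> ^ s\<close> is still summable.
\<close>
lemma summed_blocks_weighted:
  assumes p: "1 < p" and w: "\<And>x. 0 < w x" and K: "Ap_bound p w K"
  shows "\<exists>C. 0 \<le> C \<and> (\<forall>\<gamma> J k X S f.
    (\<forall>j q. \<bar>\<gamma> j q\<bar> \<le> 1) \<longrightarrow> finite X \<longrightarrow> finite S \<longrightarrow> (\<forall>y. y \<notin> S \<longrightarrow> f y = 0) \<longrightarrow> (\<forall>x\<in>X. J x \<le> k) \<longrightarrow>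
    (\<Sum>x\<in>X. \<bar>\<Sum>s\<le>J x. block_avg (\<gamma> (J x)) s (4 ^ J x) f x\<bar> powr p * w x) \<le> C * (\<Sum>y\<in>S. \<bar>f y\<bar> powr p * w y))"
proof -
  obtain C \<rho> where C: "0 \<le> C" and \<rho>: "0 < \<rho>" "\<rho> < 1" and bound: "\<forall>\<gamma> s k J X S f.
    (\<forall>j q. \<bar>\<gamma> j q\<bar> \<le> 1) \<longrightarrow> finite X \<longrightarrow> finite S \<longrightarrow> (\<forall>y. y \<notin> S \<longrightarrow> f y = 0) \<longrightarrow>
    (\<forall>x\<in>X. s \<le> J x \<and> J x \<le> k) \<longrightarrow>
    (\<Sum>x\<in>X. \<bar>block_avg (\<gamma> (J x)) s (4 ^ J x) f x\<bar> powr p * w x) \<le> C * \<rho> ^ s * (\<Sum>y\<in>S. \<bar>f y\<bar> powr p * w y)"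
    using block_maximal_weighted[OF p w K] by (elim exE conjE) (rule that)
  \<comment> \<open>Half of the decay is spent: \<open>r powr (- p * s) * \<rho> ^ s = sqrt \<rho> ^ s\<close>.\<close>
  define r where "r = \<rho> powr (1 / (2 * p))"
  have r: "0 < r" "r < 1" unfolding r_def using \<rho> p powr_less_mono2[of "1 / (2 * p)" \<rho> 1] by auto
  define D where "D = 1 / (1 - r)"
  have D: "0 < D" unfolding D_def using r by simp
  have rp: "(r ^ s) powr (- p) * \<rho> ^ s = sqrt \<rho> ^ s" for s
  proof -
    have "(r ^ s) powr (- p) = (\<rho> powr (- (1/2))) ^ s"
      unfolding r_def using \<rho> p by (simp add: powr_realpow[symmetric] powr_powr powr_power mult_ac)
    also have "\<rho> powr (- (1/2)) = 1 / sqrt \<rho>" using \<rho> by (simp add: powr_minus_divide powr_half_sqrt)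
    finally have "(r ^ s) powr (- p) * \<rho> ^ s = (\<rho> / sqrt \<rho>) ^ s" by (simp add: power_divide)
    also have "\<rho> / sqrt \<rho> = sqrt \<rho>" using \<rho> by (simp add: real_div_sqrt)
    finally show ?thesis .
  qed
  have sq: "0 < sqrt \<rho>" "sqrt \<rho> < 1" using \<rho> by auto
  show ?thesis
  proof (intro exI[of _ "D powr p * (C / (1 - sqrt \<rho>))"] conjI allI impI)
    show "0 \<le> D powr p * (C / (1 - sqrt \<rho>))" using C sq by simp
    fix \<gamma> :: "nat \<Rightarrow> nat \<Rightarrow> real" and J :: "int \<Rightarrow> nat" and k :: nat and X S :: "int set" and f :: "int \<Rightarrow> real"
    assume as: "\<forall>j q. \<bar>\<gamma> j q\<bar> \<le> 1" "finite X" "finite S" "\<forall>y. y \<notin> S \<longrightarrow> f y = 0" "\<forall>x\<in>X. J x \<le> k"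
    define F where "F = (\<Sum>y\<in>S. \<bar>f y\<bar> powr p * w y)"
    have F: "0 \<le> F" unfolding F_def by (intro sum_nonneg mult_nonneg_nonneg less_imp_le[OF w]) auto
    define T where "T s x = \<bar>block_avg (\<gamma> (J x)) s (4 ^ J x) f x\<bar>" for s x
    have pt: "\<bar>\<Sum>s\<le>J x. block_avg (\<gamma> (J x)) s (4 ^ J x) f x\<bar> powr p * w x
       \<le> D powr p * (\<Sum>s\<le>k. if s \<le> J x then (r ^ s) powr (- p) * (T s x powr p * w x) else 0)"
      if x: "x \<in> X" for x
    proof -
      define L where "L = \<bar>\<Sum>s\<le>J x. block_avg (\<gamma> (J x)) s (4 ^ J x) f x\<bar>"
      have gs: "(\<Sum>s\<le>J x. r ^ s) \<le> D"
      proof -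
        have "(\<Sum>s\<le>J x. r ^ s) \<le> (\<Sum>s. r ^ s)" using r by (intro sum_le_suminf summable_geometric) auto
        thus ?thesis unfolding D_def using r by (simp add: suminf_geometric)
      qed
      have "\<exists>s\<in>{..J x}. L * r ^ s \<le> D * T s x"
        using r gs by (intro exists_dominant_term) (auto simp: L_def T_def intro: sum_abs)
      then obtain s where s: "s \<le> J x" "L * r ^ s \<le> D * T s x" by auto
      have "L \<le> D * T s x * (1 / r ^ s)" using s(2) r by (simp add: field_simps)
      hence "L powr p \<le> (D * T s x * (1 / r ^ s)) powr p"
        using p by (intro powr_mono2) (auto simp: L_def)
      also have "\<dots> = D powr p * ((r ^ s) powr (- p) * T s x powr p)"
        by (simp only: powr_mult powr_divide powr_one_eq_one powr_minus_divide mult_ac)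
      finally have "L powr p * w x \<le> D powr p * ((r ^ s) powr (- p) * T s x powr p) * w x"
        by (intro mult_right_mono less_imp_le[OF w])
      also have "\<dots> = D powr p * (if s \<le> J x then (r ^ s) powr (- p) * (T s x powr p * w x) else 0)"
        using s by (simp add: mult_ac)
      also have "\<dots> \<le> D powr p * (\<Sum>s\<le>k. if s \<le> J x then (r ^ s) powr (- p) * (T s x powr p * w x) else 0)"
      proof (intro mult_left_mono)
        have "s \<in> {..k}" using s as(5) x by auto
        thus "(if s \<le> J x then (r ^ s) powr (- p) * (T s x powr p * w x) else 0)
          \<le> (\<Sum>s\<le>k. if s \<le> J x then (r ^ s) powr (- p) * (T s x powr p * w x) else 0)"
          by (rule member_le_sum[where f = "\<lambda>s. if s \<le> J x then (r ^ s) powr (- p) * (T s x powr p * w x) else 0"])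
             (auto intro!: mult_nonneg_nonneg less_imp_le[OF w])
      qed auto
      finally show ?thesis unfolding L_def .
    qed
    have "(\<Sum>x\<in>X. \<bar>\<Sum>s\<le>J x. block_avg (\<gamma> (J x)) s (4 ^ J x) f x\<bar> powr p * w x)
       \<le> (\<Sum>x\<in>X. D powr p * (\<Sum>s\<le>k. if s \<le> J x then (r ^ s) powr (- p) * (T s x powr p * w x) else 0))"
      by (intro sum_mono pt)
    also have "\<dots> = D powr p * (\<Sum>s\<le>k. \<Sum>x\<in>X. if s \<le> J x then (r ^ s) powr (- p) * (T s x powr p * w x) else 0)"
      unfolding sum_distrib_left[of "D powr p", symmetric] by (subst sum.swap) (rule refl)
    also have "\<dots> \<le> D powr p * (\<Sum>s\<le>k. C * F * sqrt \<rho> ^ s)"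
    proof (intro mult_left_mono sum_mono)
      fix s
      have "(\<Sum>x\<in>X. if s \<le> J x then (r ^ s) powr (- p) * (T s x powr p * w x) else 0)
         = (\<Sum>x\<in>{x\<in>X. s \<le> J x}. (r ^ s) powr (- p) * (T s x powr p * w x))"
        by (rule sum.inter_filter[OF as(2), symmetric])
      also have "\<dots> = (r ^ s) powr (- p) * (\<Sum>x\<in>{x\<in>X. s \<le> J x}. T s x powr p * w x)"
        by (rule sum_distrib_left[symmetric])
      also have "\<dots> \<le> (r ^ s) powr (- p) * (C * \<rho> ^ s * F)"
        unfolding T_def F_def using as by (intro mult_left_mono bound[rule_format, where k = k]) auto
      also have "\<dots> = C * F * sqrt \<rho> ^ s" unfolding rp[symmetric] by (simp only: mult_ac)
      finally show "(\<Sum>x\<in>X. if s \<le> J x then (r ^ s) powr (- p) * (T s x powr p * w x) else 0) \<le> C * F * sqrt \<rho> ^ s" .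
    qed auto
    also have "\<dots> = D powr p * (C * F * (\<Sum>s\<le>k. sqrt \<rho> ^ s))" by (simp only: sum_distrib_left)
    also have "\<dots> \<le> D powr p * (C * F * (1 / (1 - sqrt \<rho>)))"
    proof (intro mult_left_mono)
      have "(\<Sum>s\<le>k. sqrt \<rho> ^ s) \<le> (\<Sum>s. sqrt \<rho> ^ s)" using sq by (intro sum_le_suminf summable_geometric) auto
      thus "(\<Sum>s\<le>k. sqrt \<rho> ^ s) \<le> 1 / (1 - sqrt \<rho>)" using sq by (simp add: suminf_geometric)
    qed (use C F in auto)
    finally show "(\<Sum>x\<in>X. \<bar>\<Sum>s\<le>J x. block_avg (\<gamma> (J x)) s (4 ^ J x) f x\<bar> powr p * w x)
      \<le> D powr p * (C / (1 - sqrt \<rho>)) * (\<Sum>y\<in>S. \<bar>f y\<bar> powr p * w y)"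
      unfolding F_def by simp
  qed
qed

section \<open>The divisor averages\<close>

text \<open>
  The blocks with \<open>s \<le> J\<close> reach up to \<open>2 ^ (J + 1) - 1\<close>, but
  the harmonic number vanishes for moduli above \<open>2 ^ J\<close>.
\<close>
lemma small_divisors_blocks:
  "real (small_divisors (2 ^ J) n) = (\<Sum>s\<le>J. \<Sum>q\<in>block s. harm (2 ^ J div q) * ramanujan_sum q (int n) / q)"
proof -
  have un: "(\<Union>s\<le>J. block s) = {1..<2 ^ Suc J}"
  proof (induction J)
    case (Suc J)
    have "(\<Union>s\<le>Suc J. block s) = block (Suc J) \<union> {1..<2 ^ Suc J}"
      using Suc.IH by (simp add: atMost_Suc)
    also have "\<dots> = {1..<2 ^ Suc (Suc J)}" unfolding block_def by auto
    finally show ?case .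
  qed (auto simp: block_def)
  have dj: "block s \<inter> block s' = {}" if "s \<noteq> s'" for s s'
  proof -
    have "block s \<inter> block s' = {}" if "s < s'" for s s'
    proof -
      have "(2::nat) ^ Suc s \<le> 2 ^ s'" using that by (intro power_increasing) auto
      thus ?thesis unfolding block_def by auto
    qed
    thus ?thesis using that by (metis Int_commute nat_neq_iff)
  qed
  have "(\<Sum>s\<le>J. \<Sum>q\<in>block s. harm (2 ^ J div q) * ramanujan_sum q (int n) / q)
     = (\<Sum>q\<in>(\<Union>s\<le>J. block s). harm (2 ^ J div q) * ramanujan_sum q (int n) / q)"
    using dj by (intro sum.UNION_disjoint[symmetric]) auto
  also have "\<dots> = (\<Sum>q=1..2 ^ J. harm (2 ^ J div q) * ramanujan_sum q (int n) / q)"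
    unfolding un by (intro sum.mono_neutral_right) (auto simp: harm_def)
  also have "\<dots> = real (small_divisors (2 ^ J) n)"
    unfolding small_divisors_ramanujan by (intro sum.cong) auto
  finally show ?thesis ..
qed

text \<open>
  The least \<open>J\<close> with \<open>N \<le> 4 ^ J\<close>; then
  \<open>4 ^ J \<le> 4 * N\<close>, and \<open>D(N)\<close> is at least half of
  \<open>N\<close> times the \<open>N\<close>-th harmonic number, which is of order
  \<open>J\<close>.
\<close>
lemma exists_scale:
  assumes "1 \<le> (N::nat)"
  shows "\<exists>J. N \<le> 4 ^ J \<and> real (4 ^ J) * (real J + 1) \<le> 16 * real (divisor_sum N) \<and> J \<le> N"
proof -
  have "\<exists>J. N \<le> 4 ^ J" using less_exp[of N] power_mono[of 2 "4::nat" N] by (intro exI[of _ N]) linarith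
  define J where "J = (LEAST J. N \<le> 4 ^ J)"
  have NJ: "N \<le> 4 ^ J" unfolding J_def by (rule LeastI_ex) fact
  have JN: "J \<le> N" unfolding J_def
    using less_exp[of N] power_mono[of 2 "4::nat" N] by (intro Least_le) linarith
  have D: "real N * harm N \<le> 2 * real (divisor_sum N)" using divisor_sum_ge[of N] by simp
  show ?thesis
  proof (cases J)
    case 0
    hence "N = 1" using NJ assms by simp
    hence "1 \<le> 2 * real (divisor_sum N)" using D by (simp add: harm_def)
    thus ?thesis using 0 NJ JN by (intro exI[of _ J]) auto
  next
    case (Suc i)
    have "\<not> N \<le> 4 ^ i" using not_less_Least[of i "\<lambda>J. N \<le> 4 ^ J"] Suc unfolding J_def by simp
    hence i: "4 ^ i < N" by simp
    have "real i + 1 \<le> harm (4 ^ i)"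
      using harm_pow2_ge[of "2 * i"] by (simp add: power_mult)
    also have "\<dots> \<le> harm N" using i by (intro harm_mono) auto
    finally have h: "real i + 1 \<le> harm N" .
    have "(4::real) ^ i \<le> real N" using i by (metis less_imp_le of_nat_le_iff of_nat_numeral of_nat_power)
    hence "4 ^ i * (real i + 1) \<le> real N * harm N" using h by (intro mult_mono) auto
    also have "\<dots> \<le> 2 * real (divisor_sum N)" by (rule D)
    finally have m: "4 ^ i * (real i + 1) \<le> 2 * real (divisor_sum N)" .
    have "real (4 ^ J) * (real J + 1) \<le> 4 * 4 ^ i * (2 * (real i + 1))"
      unfolding Suc by (auto intro!: mult_mono)
    also have "\<dots> = 8 * (4 ^ i * (real i + 1))" by simp
    also have "\<dots> \<le> 8 * (2 * real (divisor_sum N))" using m by (intro mult_left_mono) auto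
    finally show ?thesis using NJ JN by (intro exI[of _ J]) simp
  qed
qed

text \<open>
  The coefficients \<open>\<gamma> J q\<close>, normalised by \<open>J + 1\<close>, which has
  the order of the logarithm of \<open>4 ^ J\<close>.
\<close>
definition scale_weight :: "nat \<Rightarrow> nat \<Rightarrow> real" where
  "scale_weight J q = harm (2 ^ J div q) / (real J + 1)"

lemma scale_weight_bound: "\<bar>scale_weight J q\<bar> \<le> 1"
proof -
  have "harm (2 ^ J div q) \<le> (harm (2 ^ J) :: real)" by (intro harm_mono div_le_dividend)
  also have "\<dots> \<le> real J + 1" by (rule harm_pow2_le)
  finally show ?thesis unfolding scale_weight_def using harm_nonneg[of "2 ^ J div q", where 'a = real] by simp
qed

text \<open>
  Positivity allows the replacement of \<open>d(n)\<close> by twice the number of small divisors and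
  of \<open>N\<close> by the larger scale \<open>4 ^ J\<close>.
\<close>
lemma divisor_avg_le_blocks:
  fixes g :: "int \<Rightarrow> real"
  assumes N: "1 \<le> N" "N \<le> 4 ^ J" and D: "real (4 ^ J) * (real J + 1) \<le> 16 * real (divisor_sum N)"
    and g: "\<And>y. 0 \<le> g y"
  shows "1 / real (divisor_sum N) * (\<Sum>n=1..N. real (divisor_fun n) * g (x + int n))
    \<le> 32 * (\<Sum>s\<le>J. block_avg (scale_weight J) s (4 ^ J) g x)"
proof -
  define M where "M = real (4 ^ J) * (real J + 1)"
  have M: "0 < M" unfolding M_def by simp
  have Dp: "1 / real (divisor_sum N) \<le> 16 / M"
    using D M unfolding M_def[symmetric] by (simp add: field_simps)
  have "(\<Sum>n=1..N. real (divisor_fun n) * g (x + int n)) \<le> (\<Sum>n=1..4 ^ J. real (divisor_fun n) * g (x + int n))"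
    using N g by (intro sum_mono2) auto
  also have "\<dots> \<le> (\<Sum>n=1..4 ^ J. (2 * real (small_divisors (2 ^ J) n)) * g (x + int n))"
  proof (intro sum_mono mult_right_mono g)
    fix n :: nat assume n: "n \<in> {1..4 ^ J}"
    have "(4::nat) ^ J = 2 ^ J * 2 ^ J" by (simp flip: power_mult_distrib)
    hence "tau n \<le> 2 * small_divisors (2 ^ J) n" using n by (intro tau_le_small_divisors) auto
    thus "real (divisor_fun n) \<le> 2 * real (small_divisors (2 ^ J) n)"
      unfolding divisor_fun_eq_tau by linarith
  qed
  finally have 1: "(\<Sum>n=1..N. real (divisor_fun n) * g (x + int n))
    \<le> 2 * (\<Sum>n=1..4 ^ J. real (small_divisors (2 ^ J) n) * g (x + int n))"
    by (simp only: sum_distrib_left mult.assoc)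
  have 2: "(\<Sum>s\<le>J. block_avg (scale_weight J) s (4 ^ J) g x)
     = (\<Sum>n=1..4 ^ J. real (small_divisors (2 ^ J) n) * g (x + int n)) / M"
  proof -
    have "(\<Sum>s\<le>J. block_avg (scale_weight J) s (4 ^ J) g x)
       = (\<Sum>n=1..4 ^ J. \<Sum>s\<le>J. (\<Sum>q\<in>block s. scale_weight J q * ramanujan_sum q (int n) / q) / real (4 ^ J) * g (x + int n))"
      unfolding block_avg_kernel by (rule sum.swap)
    also have "\<dots> = (\<Sum>n=1..4 ^ J. real (small_divisors (2 ^ J) n) * g (x + int n) / M)"
    proof (rule sum.cong[OF refl])
      fix n
      have "(\<Sum>s\<le>J. (\<Sum>q\<in>block s. scale_weight J q * ramanujan_sum q (int n) / q)) = real (small_divisors (2 ^ J) n) / (real J + 1)"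
        unfolding small_divisors_blocks scale_weight_def by (simp add: sum_divide_distrib mult.commute)
      hence "(\<Sum>s\<le>J. (\<Sum>q\<in>block s. scale_weight J q * ramanujan_sum q (int n) / q)) / real (4 ^ J) * g (x + int n)
         = real (small_divisors (2 ^ J) n) * g (x + int n) / M"
        unfolding M_def by simp
      thus "(\<Sum>s\<le>J. (\<Sum>q\<in>block s. scale_weight J q * ramanujan_sum q (int n) / q) / real (4 ^ J) * g (x + int n))
         = real (small_divisors (2 ^ J) n) * g (x + int n) / M"
        by (simp only: sum_divide_distrib sum_distrib_right)
    qed
    finally show ?thesis by (simp only: sum_divide_distrib)
  qed
  have "1 / real (divisor_sum N) * (\<Sum>n=1..N. real (divisor_fun n) * g (x + int n))
     \<le> 16 / M * (2 * (\<Sum>n=1..4 ^ J. real (small_divisors (2 ^ J) n) * g (x + int n)))"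
    using M by (intro mult_mono Dp 1 sum_nonneg mult_nonneg_nonneg g) auto
  also have "\<dots> = 32 * (\<Sum>s\<le>J. block_avg (scale_weight J) s (4 ^ J) g x)" unfolding 2 by simp
  finally show ?thesis .
qed

text \<open>
  For finitely many points and bounded lengths only finitely many values of \<open>f\<close> matter,
  so \<open>f\<close> may be truncated to a finitely supported nonnegative function. The lengths
  \<open>N x\<close> are arbitrary, which makes the bound one for the maximal function.
\<close>
lemma divisor_avg_weighted_finite:
  assumes p: "1 < p" and w: "\<And>x. 0 < w x" and K: "Ap_bound p w K"
  shows "\<exists>C. 0 \<le> C \<and> (\<forall>f \<in> weighted_lp p w. \<forall>X N. finite X \<longrightarrow> (\<forall>x\<in>X. 1 \<le> N x) \<longrightarrow>
    (\<Sum>x\<in>X. cmod (divisor_avg (N x) f x) powr p * w x) \<le> C * (\<Sum>\<^sub>\<infinity>x\<in>UNIV. cmod (f x) powr p * w x))"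
proof -
  obtain C where C: "0 \<le> C" and bound: "\<forall>\<gamma> J k X S f.
    (\<forall>j q. \<bar>\<gamma> j q\<bar> \<le> 1) \<longrightarrow> finite X \<longrightarrow> finite S \<longrightarrow> (\<forall>y. y \<notin> S \<longrightarrow> f y = 0) \<longrightarrow> (\<forall>x\<in>X. J x \<le> k) \<longrightarrow>
    (\<Sum>x\<in>X. \<bar>\<Sum>s\<le>J x. block_avg (\<gamma> (J x)) s (4 ^ J x) f x\<bar> powr p * w x) \<le> C * (\<Sum>y\<in>S. \<bar>f y\<bar> powr p * w y)"
    using summed_blocks_weighted[OF p w K] by (elim exE conjE) (rule that)
  show ?thesis
  proof (intro exI[of _ "32 powr p * C"] conjI ballI allI impI)
    show "0 \<le> 32 powr p * C" using C by simp
    fix f :: "int \<Rightarrow> complex" and X :: "int set" and N :: "int \<Rightarrow> nat"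
    assume f: "f \<in> weighted_lp p w" and X: "finite X" and N: "\<forall>x\<in>X. 1 \<le> N x"
    have summ: "(\<lambda>x. cmod (f x) powr p * w x) summable_on UNIV" using f unfolding weighted_lp_def by simp
    have ex: "\<forall>x\<in>X. \<exists>J. N x \<le> 4 ^ J \<and> real (4 ^ J) * (real J + 1) \<le> 16 * real (divisor_sum (N x)) \<and> J \<le> N x"
      using exists_scale N by blast
    obtain J where J: "\<And>x. x \<in> X \<Longrightarrow> N x \<le> 4 ^ J x \<and> real (4 ^ J x) * (real (J x) + 1) \<le> 16 * real (divisor_sum (N x)) \<and> J x \<le> N x"
      using bchoice[OF ex] by blast
    define k where "k = Max (insert 0 (J ` X))"
    have Jk: "J x \<le> k" if "x \<in> X" for x unfolding k_def using X that by (intro Max_ge) auto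
    define S where "S = (\<lambda>(x, n). x + int n) ` (X \<times> {1..4 ^ k})"
    have S: "finite S" unfolding S_def using X by auto
    define g where "g y = (if y \<in> S then cmod (f y) else 0)" for y
    have g0: "0 \<le> g y" for y unfolding g_def by simp
    have pt: "cmod (divisor_avg (N x) f x) powr p * w x
      \<le> 32 powr p * (\<bar>\<Sum>s\<le>J x. block_avg (scale_weight (J x)) s (4 ^ J x) g x\<bar> powr p * w x)" if x: "x \<in> X" for x
    proof -
      have "cmod (divisor_avg (N x) f x) = 1 / real (divisor_sum (N x)) * cmod (\<Sum>n=1..N x. of_nat (divisor_fun n) * f (x + int n))"
        unfolding divisor_avg_def by (simp add: norm_mult norm_divide)
      also have "\<dots> \<le> 1 / real (divisor_sum (N x)) * (\<Sum>n=1..N x. real (divisor_fun n) * g (x + int n))"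
      proof (intro mult_left_mono sum_norm_le)
        fix n assume n: "n \<in> {1..N x}"
        have "(4::nat) ^ J x \<le> 4 ^ k" using Jk[OF x] by (intro power_increasing) auto
        moreover have "N x \<le> 4 ^ J x" "1 \<le> n" "n \<le> N x" using n J[OF x] by auto
        ultimately have "n \<in> {1..4 ^ k}" unfolding atLeastAtMost_iff by linarith
        hence "(\<lambda>(x, n). x + int n) (x, n) \<in> S" unfolding S_def using x by (intro imageI) auto
        thus "cmod (of_nat (divisor_fun n) * f (x + int n)) \<le> real (divisor_fun n) * g (x + int n)"
          unfolding g_def by (simp add: norm_mult)
      qed auto
      also have "\<dots> \<le> 32 * (\<Sum>s\<le>J x. block_avg (scale_weight (J x)) s (4 ^ J x) g x)"
        using J[OF x] N x by (intro divisor_avg_le_blocks g0) auto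
      also have "\<dots> \<le> 32 * \<bar>\<Sum>s\<le>J x. block_avg (scale_weight (J x)) s (4 ^ J x) g x\<bar>" by simp
      finally have "cmod (divisor_avg (N x) f x) powr p \<le> (32 * \<bar>\<Sum>s\<le>J x. block_avg (scale_weight (J x)) s (4 ^ J x) g x\<bar>) powr p"
        using p by (intro powr_mono2) auto
      also have "\<dots> = 32 powr p * \<bar>\<Sum>s\<le>J x. block_avg (scale_weight (J x)) s (4 ^ J x) g x\<bar> powr p"
        by (simp only: powr_mult)
      finally show ?thesis unfolding mult.assoc[symmetric] by (intro mult_right_mono less_imp_le[OF w])
    qed
    have "(\<Sum>x\<in>X. cmod (divisor_avg (N x) f x) powr p * w x)
      \<le> 32 powr p * (\<Sum>x\<in>X. \<bar>\<Sum>s\<le>J x. block_avg (scale_weight (J x)) s (4 ^ J x) g x\<bar> powr p * w x)"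
      unfolding sum_distrib_left by (intro sum_mono pt)
    also have "\<dots> \<le> 32 powr p * (C * (\<Sum>y\<in>S. \<bar>g y\<bar> powr p * w y))"
      by (intro mult_left_mono bound[rule_format, where k = k] S X) (auto simp: scale_weight_bound g_def Jk)
    also have "(\<Sum>y\<in>S. \<bar>g y\<bar> powr p * w y) = (\<Sum>y\<in>S. cmod (f y) powr p * w y)"
      by (intro sum.cong) (auto simp: g_def)
    also have "32 powr p * (C * (\<Sum>y\<in>S. cmod (f y) powr p * w y)) \<le> 32 powr p * (C * (\<Sum>\<^sub>\<infinity>x\<in>UNIV. cmod (f x) powr p * w x))"
      using C by (intro mult_left_mono finite_sum_le_infsum[OF summ S]) (auto intro: mult_nonneg_nonneg less_imp_le[OF w])
    finally show "(\<Sum>x\<in>X. cmod (divisor_avg (N x) f x) powr p * w x)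
      \<le> 32 powr p * C * (\<Sum>\<^sub>\<infinity>x\<in>UNIV. cmod (f x) powr p * w x)" by (simp only: mult.assoc)
  qed
qed

theorem corollary1p5:
  fixes p :: real and w :: "int \<Rightarrow> real"
  assumes "1 < p" and "is_weight w" and "muckenhoupt p w"
  shows "\<exists>C. \<forall>f \<in> weighted_lp p w.
           (\<forall>x. divisor_max_finite f x) \<and>
           divisor_max f \<in> weighted_lp p w \<and>
           weighted_lp_norm p w (divisor_max f) \<le> C * weighted_lp_norm p w f"
proof -
  have p: "1 < p" by fact
  have w: "0 < w x" for x using assms(2) unfolding is_weight_def by simp
  obtain K where K: "Ap_bound p w K" using muckenhoupt_imp_Ap_bound[OF assms(3)] by blast
  obtain C where C: "0 \<le> C" and bound: "\<forall>f \<in> weighted_lp p w. \<forall>X N. finite X \<longrightarrow> (\<forall>x\<in>X. 1 \<le> N x) \<longrightarrow>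
    (\<Sum>x\<in>X. cmod (divisor_avg (N x) f x) powr p * w x) \<le> C * (\<Sum>\<^sub>\<infinity>x\<in>UNIV. cmod (f x) powr p * w x)"
    using divisor_avg_weighted_finite[OF p w K] by (elim exE conjE) (rule that)
  show ?thesis
  proof (intro exI[of _ "(2 powr p * C) powr (1 / p)"] ballI)
    fix f :: "int \<Rightarrow> complex" assume f: "f \<in> weighted_lp p w"
    define F where "F = (\<Sum>\<^sub>\<infinity>x\<in>UNIV. cmod (f x) powr p * w x)"
    have F: "0 \<le> F" unfolding F_def by (intro infsum_nonneg mult_nonneg_nonneg less_imp_le[OF w]) auto
    have fin: "divisor_max_finite f x" for x
      unfolding divisor_max_finite_def
    proof (rule bdd_aboveI2)
      fix N :: nat assume N: "N \<in> {1..}"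
      have "(\<Sum>y\<in>{x}. cmod (divisor_avg ((\<lambda>_. N) y) f y) powr p * w y) \<le> C * F"
        unfolding F_def using N by (intro bound[rule_format] f) auto
      hence "cmod (divisor_avg N f x) powr p \<le> C * F / w x" using w[of x] by (simp add: field_simps)
      hence "(cmod (divisor_avg N f x) powr p) powr (1 / p) \<le> (C * F / w x) powr (1 / p)"
        using p by (intro powr_mono2) auto
      thus "cmod (divisor_avg N f x) \<le> (C * F / w x) powr (1 / p)" using p by (simp add: powr_powr)
    qed
    have ub: "cmod (divisor_avg N f x) \<le> divisor_max f x" if "1 \<le> N" for N x
      unfolding divisor_max_def using fin[of x] that unfolding divisor_max_finite_def by (intro cSUP_upper) auto
    have nonneg: "0 \<le> divisor_max f x" for x using order_trans[OF norm_ge_zero ub[of 1 x]] by simp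
    \<comment> \<open>A length that nearly attains the supremum, at the cost of a factor two, replaces a limiting argument.\<close>
    have sel: "\<exists>N\<ge>1. divisor_max f x \<le> 2 * cmod (divisor_avg N f x)" for x
    proof (cases "divisor_max f x = 0")
      case True
      thus ?thesis by (intro exI[of _ 1]) auto
    next
      case False
      hence "divisor_max f x / 2 < (SUP N\<in>{1..}. cmod (divisor_avg N f x))"
        using nonneg[of x] unfolding divisor_max_def by simp
      then obtain N where "N \<in> {1..}" "divisor_max f x / 2 < cmod (divisor_avg N f x)"
        using fin[of x] unfolding divisor_max_finite_def by (subst (asm) less_cSUP_iff) auto
      thus ?thesis by (intro exI[of _ N]) auto
    qed
    obtain N where N: "\<And>x. 1 \<le> N x" "\<And>x. divisor_max f x \<le> 2 * cmod (divisor_avg (N x) f x)"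
      using sel by metis
    have sums: "(\<Sum>x\<in>X. norm (divisor_max f x) powr p * w x) \<le> 2 powr p * C * F" if X: "finite X" for X
    proof -
      have "(\<Sum>x\<in>X. norm (divisor_max f x) powr p * w x) \<le> (\<Sum>x\<in>X. 2 powr p * (cmod (divisor_avg (N x) f x) powr p * w x))"
      proof (intro sum_mono)
        fix x
        have "norm (divisor_max f x) powr p \<le> (2 * cmod (divisor_avg (N x) f x)) powr p"
          using N(2)[of x] nonneg[of x] p by (intro powr_mono2) auto
        also have "\<dots> = 2 powr p * cmod (divisor_avg (N x) f x) powr p" by (simp only: powr_mult)
        finally show "norm (divisor_max f x) powr p * w x \<le> 2 powr p * (cmod (divisor_avg (N x) f x) powr p * w x)"
          unfolding mult.assoc[symmetric] by (intro mult_right_mono less_imp_le[OF w])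
      qed
      also have "\<dots> = 2 powr p * (\<Sum>x\<in>X. cmod (divisor_avg (N x) f x) powr p * w x)" by (simp only: sum_distrib_left)
      also have "\<dots> \<le> 2 powr p * (C * F)" unfolding F_def using N by (intro mult_left_mono bound[rule_format] f X) auto
      finally show ?thesis by simp
    qed
    have pos: "0 \<le> norm (divisor_max f x) powr p * w x" for x by (intro mult_nonneg_nonneg less_imp_le[OF w]) auto
    have summ: "(\<lambda>x. norm (divisor_max f x) powr p * w x) summable_on UNIV"
      using sums pos by (intro nonneg_bdd_above_summable_on bdd_aboveI2) auto
    have "(\<Sum>\<^sub>\<infinity>x\<in>UNIV. norm (divisor_max f x) powr p * w x) \<le> 2 powr p * C * F"
      using sums by (intro infsum_le_finite_sums summ) auto
    hence "weighted_lp_norm p w (divisor_max f) \<le> (2 powr p * C * F) powr (1 / p)"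
      unfolding weighted_lp_norm_def using p pos by (intro powr_mono2 infsum_nonneg) auto
    also have "\<dots> = (2 powr p * C) powr (1 / p) * weighted_lp_norm p w f"
      unfolding weighted_lp_norm_def F_def by (simp only: powr_mult)
    finally show "(\<forall>x. divisor_max_finite f x) \<and> divisor_max f \<in> weighted_lp p w \<and>
       weighted_lp_norm p w (divisor_max f) \<le> (2 powr p * C) powr (1 / p) * weighted_lp_norm p w f"
      using fin summ unfolding weighted_lp_def by simp
  qed
qed

end
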